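(* Let $J:=(\mathbb R^p\times\mathbb R^q)^{(n)}$ be the $n$-jet space, $d:=\dim J$, and consider a system of partial differential equations $$\Delta_\nu(x,\mathrm{pr}^{(n)}u)=0\qquad(1\le\nu\le l)$$ with $\Delta=(\Delta_1,\dots,\Delta_l)\in\mathcal G(J)^l$. Let $\Phi$ be a projectable generalized group action on $\mathbb R^p\times\mathbb R^q$ with infinitesimal generator $\xi$, and put $S_\Delta:=\{\tilde z\in\widetilde J_c:\Delta(\tilde z)=0\}$. Suppose that: (a) $\mathrm{pr}^{(n)}\Phi$ is a strictly $\mathcal G$-complete generalized group action on $J$ (with generator $\mathrm{pr}^{(n)}\xi$); (b) there are $\eta_0>0$ and an open $U\subseteq J$ with $\widetilde U_c\supseteq\mathrm{pr}^{(n)}\Phi\big((-\eta_0,\eta_0)^\sim_c\times S_\Delta\big)$ such that $\Delta$ is of maximal rank on $U$ via a generalized chart $\psi\in\mathcal G[U,V]$, $V\subseteq\mathbb R^d$ open; (c) with $\bar\xi:=(\psi^{-1})^*(\mathrm{pr}^{(n)}\xi)$, either (i) $V=\mathbb R^d$ and $\bar\xi$ has a representative $(\bar\xi_\varepsilon)_\varepsilon$ for which there are $C,\varepsilon_0>0$ with $|\bar\xi_\varepsilon(x)|\le C(1+|x|)$ for all $x\in\mathbb R^d$, $\varepsilon<\varepsilon_0$; or (ii) $V$ is a box and $D\bar\xi$ is locally of $L^\infty$-log-type. If $$\mathrm{pr}^{(n)}\xi(\Delta)(\tilde z)=0\quad\text{for all }\tilde z\in\widetilde J_c\text{ with }\Delta(\tilde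 z)=0,$$ then $\Phi$ is a symmetry group of the system $\Delta_\nu(x,\mathrm{pr}^{(n)}u)=0$ $(1\le\nu\le l)$.
   Context: Throughout $I=(0,1]$, $K\subset\subset M$ means $K$ is a compact subset of the manifold $M$, and $O(\cdot)$-estimates are for $\varepsilon\to0$. Colombeau algebra. $\mathcal E_M(M)$ is the set of nets $(u_\varepsilon)_{\varepsilon\in I}\in C^\infty(M)^I$ such that for all $K\subset\subset M$ and all linear differential operators $P$ on $M$ there is $N\in\mathbb N$ with $\sup_K|Pu_\varepsilon|=O(\varepsilon^{-N})$. $\mathcal N(M)$ is the set of $(u_\varepsilon)_\varepsilon\in\mathcal E_M(M)$ with $\sup_K|u_\varepsilon|=O(\varepsilon^{k})$ for all $K\subset\subset M$, $k\in\mathbb N$. $\mathcal G(M):=\mathcal E_M(M)/\mathcal N(M)$. $\widetilde{\mathbb R}$ is the set of nets $(r_\varepsilon)\in\mathbb R^I$ with $|r_\varepsilon|=O(\varepsilon^{-N})$ for some $N$, modulo nets with $|r_\varepsilon|=O(\varepsilon^k)$ for all $k$. $\widetilde M_c$ (compactly supported generalized points) is the set of nets $(x_\varepsilon)\in M^I$ that stay in some compact subset of $M$ for small $\varepsilon$, modulo $(x_\varepsilon)\sim(y_\varepsilon)$ iff $d_h(x_\varepsilon,y_\varepsilon)=O(\varepsilon^k)$ for all $k$ ($d_h$ the distance of any Riemannian metric). For open subsets $U$ (e.g. an interval), $\widetilde U_c$ is defined likewise. Point values: $u(\tilde x):=[(u_\varepsilon(x_\varepsilon))_\varepsilon]$.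 c-bounded functions. A net $(u_\varepsilon)\in C^\infty(M,N)^I$ is c-bounded if for every $K\subset\subset M$ there are $\varepsilon_0>0$, $K'\subset\subset N$ with $u_\varepsilon(K)\subseteq K'$ for all $\varepsilon<\varepsilon_0$. $\mathcal E_M[M,N]$ is the set of c-bounded nets with $(f\circ u_\varepsilon)_\varepsilon\in\mathcal E_M(M)$ for all $f\in C^\infty(N)$; $(u_\varepsilon)\sim(v_\varepsilon)$ iff $(f\circ u_\varepsilon-f\circ v_\varepsilon)_\varepsilon\in\mathcal N(M)$ for all $f\in C^\infty(N)$; $\mathcal G[M,N]:=\mathcal E_M[M,N]/\sim$. Compositions are defined on representatives. Generalized vector fields. $\mathcal G^1_0(M)$: nets of smooth vector fields on $M$ all of whose derivatives are $O(\varepsilon^{-N})$ for some $N$ uniformly on compact sets, modulo nets that are $O(\varepsilon^k)$ for all $k$ uniformly on compact sets. $\xi(f):=[(\xi_\varepsilon(f_\varepsilon))_\varepsilon]$, componentwise for tuples $f$. Hybrid space. For a vector bundle $\pi:E\to N$, $\mathcal G^h[M,E]$ consists of nets $(u_\varepsilon)\in C^\infty(M,E)^I$ such that $(\pi\circ u_\varepsilon)$ is c-bounded and, in charts of $M$ (domain $A$) and vector bundle charts of $E$ (over $B$), all derivatives of the local expressions of $u_\varepsilon$ are $O(\varepsilon^{-N})$ for some $N$ uniformly on $L\cap(\pi\circ u_\varepsilon)^{-1}(L')$, $L\subset\subset A,L'\subset\subset B$; two nets $(u_\varepsilon)$, $(v_\varepsilon)$ are identified if $d_h(\pi\circ u_\varepsilon,\pi\circ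 v_\varepsilon)\to0$ uniformly on compact sets and all derivatives of the differences of the local expressions are $O(\varepsilon^k)$ for all $k$, uniformly on $L\cap(\pi\circ u_\varepsilon)^{-1}(L')\cap(\pi\circ v_\varepsilon)^{-1}(L')$. Generalized group actions. A generalized group action on $M$ is $\Phi\in\mathcal G[\mathbb R\times M,M]$ with $\Phi(0,\cdot)=\mathrm{id}$ in $\mathcal G[M,M]$ and $\Phi(\eta_1+\eta_2,x)=\Phi(\eta_1,\Phi(\eta_2,x))$ in $\mathcal G[\mathbb R^2\times M,M]$. $\xi\in\mathcal G^1_0(M)$ is an infinitesimal generator of $\Phi$ if $\frac{d}{d\eta}\Phi(\eta,x)=\xi(\Phi(\eta,x))$ in $\mathcal G^h[\mathbb R\times M,TM]$. If for given $\xi$ there is a unique generalized group action satisfying this equation, $\xi$ and $\Phi$ are called $\mathcal G$-complete; they are strictly $\mathcal G$-complete if in addition there are representatives such that $\Phi_\varepsilon$ is the flow of $\xi_\varepsilon$ for each $\varepsilon\in I$. Projectable actions. A generalized group action $\Phi$ on $\mathbb R^p\times\mathbb R^q$ is projectable if $\Phi(\eta,(x,u))=(\Xi_\eta(x),\Psi_\eta(x,u))$ with $\Xi\in\mathcal G[\mathbb R\times\mathbb R^p,\mathbb R^p]$, $\Psi\in\mathcal G[\mathbb R\times\mathbb R^{p+q},\mathbb R^q]$. For $\eta\in\widetilde{\mathbb R}_c$ and $u\in\mathcal G[\mathbb R^p,\mathbb R^q]$, $\Phi_\eta(u)\in\mathcal G[\mathbb R^p,\mathbb R^q]$ is $x\mapsto\Psi_\eta(\Xi_{-\eta}(x),u(\Xi_{-\eta}(x)))$.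 Jets and prolongations. $J=(\mathbb R^p\times\mathbb R^q)^{(n)}$ is the Euclidean space with coordinates $(x,u^{(n)})$, $x\in\mathbb R^p$, $u^{(n)}$ having one coordinate for each component of $u\in\mathbb R^q$ and each partial derivative of order $0,\dots,n$; $\mathrm{pr}^{(n)}h(x)$ is the collection of all partial derivatives of orders $0,\dots,n$ of $h:\mathbb R^p\to\mathbb R^q$ at $x$. For $z\in J$ with $x$-part $(z_1,\dots,z_p)$ choose $h\in C^\infty(\mathbb R^p,\mathbb R^q)$ with $(z_1,\dots,z_p,\mathrm{pr}^{(n)}h(z_1,\dots,z_p))=z$ (e.g. a Taylor polynomial) and set $$\mathrm{pr}^{(n)}\Phi(\eta,z):=\big(\Xi_\eta(z_1,\dots,z_p),\ \mathrm{pr}^{(n)}(\Phi_\eta(h))(\Xi_\eta(z_1,\dots,z_p))\big);$$ this does not depend on the choice of $h$. The $n$-th prolongation of $\xi$ is $\mathrm{pr}^{(n)}\xi|_z:=\frac{d}{d\eta}\big|_{\eta=0}\mathrm{pr}^{(n)}\Phi(\eta,z)$. Solutions and symmetry groups. $u\in\mathcal G[\mathbb R^p,\mathbb R^q]$ is a solution of the system if $x\mapsto(x,\mathrm{pr}^{(n)}u(x))$ is c-bounded, i.e. belongs to $\mathcal G[\mathbb R^p,J]$, and $\Delta_\nu(x,\mathrm{pr}^{(n)}u(x))=0$ in $\mathcal G(\mathbb R^p)$ for all $\nu$; equivalently, the generalized graph $\{(\tilde x,\mathrm{pr}^{(n)}u(\tilde x)):\tilde x\in\widetilde{\mathbb R}^p_c\}$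 is contained in $S_\Delta$. $\Phi$ is a symmetry group of the system if for every solution $u$ and every $\eta\in\widetilde{\mathbb R}_c$, $\Phi_\eta(u)$ is again a solution. Maximal rank via a generalized chart. $\Delta\in\mathcal G(J)^l$ is of maximal rank on the open $U\subseteq J$ via $\psi\in\mathcal G[U,V]$ if there are $\varepsilon_0>0$ and diffeomorphisms $\psi_\varepsilon:U\to V$ ($\varepsilon\in(0,\varepsilon_0]$) with $\psi=[(\psi_\varepsilon)_\varepsilon]\in\mathcal G[U,V]$, $\psi^{-1}:=[(\psi_\varepsilon^{-1})_\varepsilon]\in\mathcal G[V,U]$ and $\Delta\circ\psi^{-1}=\big((x_1,\dots,x_d)\mapsto(x_1,\dots,x_k,0,\dots,0)\big)$ in $\mathcal G(V)^l$, where $k=\min(d,l)$. For a generalized vector field $\zeta$ on $J$, $(\psi^{-1})^*\zeta:=[(T\psi_\varepsilon\circ\zeta_\varepsilon|_U\circ\psi_\varepsilon^{-1})_\varepsilon]$. A box in $\mathbb R^d$ is a product of $d$ finite or infinite open intervals. $D\bar\xi$ is locally of $L^\infty$-log-type if for every $K\subset\subset V$ and every representative there is $C>0$ with $\sup_K\|D\bar\xi_\varepsilon\|\le C|\log\varepsilon|$ for small $\varepsilon$. *)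

theory Defs
  imports "HOL-Analysis.Analysis" "HOL-Library.Landau_Symbols"
begin

text \<open>
  All manifolds are open subsets of Euclidean spaces, with their global chart. Elements of the
  Colombeau-type quotient spaces are handled through representing nets \<open>u :: real \<Rightarrow> _\<close>, of which
  only the values at \<open>\<epsilon> \<in> I = (0,1]\<close> matter; equality in a quotient space is the
  corresponding equivalence of nets (\<open>G_eq\<close>, \<open>GMap_eq\<close>, \<open>GVec_eq\<close>, \<open>Ghyb_eq\<close>, \<open>gen_pt_eq\<close>).
  A map defined on an open set is a total function whose values outside that set are irrelevant.
\<close>

type_synonym 'n rvec = "real^'n"

abbreviation I_eps :: "real set" where "I_eps \<equiv> {0<..1}"

section \<open>Smooth functions and derivatives\<close>

primrec higher_differentiable_on ::
  "'a::real_normed_vector set \<Rightarrow> ('a \<Rightarrow> 'b::real_normed_vector) \<Rightarrow> nat \<Rightarrow> bool" where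
  "higher_differentiable_on M f 0 \<longleftrightarrow> continuous_on M f"
| "higher_differentiable_on M f (Suc n) \<longleftrightarrow>
     (\<forall>x\<in>M. f differentiable (at x)) \<and>
     (\<forall>v. higher_differentiable_on M (\<lambda>x. frechet_derivative f (at x) v) n)"

text \<open>Meaningful for open \<open>M\<close>.\<close>

definition smooth_on :: "'a::real_normed_vector set \<Rightarrow> ('a \<Rightarrow> 'b::real_normed_vector) \<Rightarrow> bool" where
  "smooth_on M f \<longleftrightarrow> (\<forall>n. higher_differentiable_on M f n)"

definition partials ::
  "'a::real_normed_vector list \<Rightarrow> ('a \<Rightarrow> 'b::real_normed_vector) \<Rightarrow> 'a \<Rightarrow> 'b" where
  "partials vs f = foldr (\<lambda>v g x. frechet_derivative g (at x) v) vs f"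

definition lin_diff_op ::
  "'a::euclidean_space set \<Rightarrow> (('a \<Rightarrow> real) \<Rightarrow> 'a \<Rightarrow> real) \<Rightarrow> bool" where
  "lin_diff_op M P \<longleftrightarrow>
     (\<exists>(A :: 'a list set) a. finite A \<and> (\<forall>\<beta>\<in>A. set \<beta> \<subseteq> Basis \<and> smooth_on M (a \<beta>)) \<and>
        P = (\<lambda>u x. \<Sum>\<beta>\<in>A. a \<beta> x * partials \<beta> u x))"

section \<open>Asymptotic estimates\<close>

text \<open>\<open>sup\<^sub>x\<^sub>\<in>\<^sub>A\<^sub>\<epsilon> |f\<^sub>\<epsilon>(x)| = O(g(\<epsilon>))\<close>, written without the supremum because \<open>A\<^sub>\<epsilon>\<close> may be empty.\<close>

definition unif_bigo ::
  "(real \<Rightarrow> 'a set) \<Rightarrow> (real \<Rightarrow> 'a \<Rightarrow> 'b::real_normed_vector) \<Rightarrow> (real \<Rightarrow> real) \<Rightarrow> bool" where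
  "unif_bigo A f g \<longleftrightarrow> (\<exists>C. \<forall>\<^sub>F \<epsilon> in at_right 0. \<forall>x\<in>A \<epsilon>. norm (f \<epsilon> x) \<le> C * g \<epsilon>)"

definition unif_moderate ::
  "(real \<Rightarrow> 'a set) \<Rightarrow> (real \<Rightarrow> 'a \<Rightarrow> 'b::real_normed_vector) \<Rightarrow> bool" where
  "unif_moderate A f \<longleftrightarrow> (\<exists>N::nat. unif_bigo A f (\<lambda>\<epsilon>. inverse (\<epsilon> ^ N)))"

definition unif_negligible ::
  "(real \<Rightarrow> 'a set) \<Rightarrow> (real \<Rightarrow> 'a \<Rightarrow> 'b::real_normed_vector) \<Rightarrow> bool" where
  "unif_negligible A f \<longleftrightarrow> (\<forall>k::nat. unif_bigo A f (\<lambda>\<epsilon>. \<epsilon> ^ k))"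

text \<open>A moderate net of reals that is zero in the ring of generalized numbers.\<close>

definition zero_num :: "(real \<Rightarrow> real) \<Rightarrow> bool" where
  "zero_num r \<longleftrightarrow> (\<forall>k::nat. r \<in> O[at_right 0](\<lambda>\<epsilon>. \<epsilon> ^ k))"

section \<open>The Colombeau algebra\<close>

definition EM :: "'a::euclidean_space set \<Rightarrow> (real \<Rightarrow> 'a \<Rightarrow> real) set" where
  "EM M = {u. (\<forall>\<epsilon>\<in>I_eps. smooth_on M (u \<epsilon>)) \<and>
     (\<forall>K P. compact K \<and> K \<subseteq> M \<and> lin_diff_op M P \<longrightarrow> unif_moderate (\<lambda>_. K) (\<lambda>\<epsilon>. P (u \<epsilon>)))}"

definition Negl :: "'a::euclidean_space set \<Rightarrow> (real \<Rightarrow> 'a \<Rightarrow> real) set" where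
  "Negl M = {u \<in> EM M. \<forall>K. compact K \<and> K \<subseteq> M \<longrightarrow> unif_negligible (\<lambda>_. K) u}"

definition G_eq :: "'a::euclidean_space set \<Rightarrow> (real \<Rightarrow> 'a \<Rightarrow> real) \<Rightarrow> (real \<Rightarrow> 'a \<Rightarrow> real) \<Rightarrow> bool" where
  "G_eq M u v \<longleftrightarrow> u \<in> EM M \<and> v \<in> EM M \<and> (\<lambda>\<epsilon> x. u \<epsilon> x - v \<epsilon> x) \<in> Negl M"

section \<open>Compactly supported generalized points\<close>

definition gen_pt :: "'a::euclidean_space set \<Rightarrow> (real \<Rightarrow> 'a) \<Rightarrow> bool" where
  "gen_pt M x \<longleftrightarrow> (\<forall>\<epsilon>\<in>I_eps. x \<epsilon> \<in> M) \<and>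
     (\<exists>K. compact K \<and> K \<subseteq> M \<and> (\<forall>\<^sub>F \<epsilon> in at_right 0. x \<epsilon> \<in> K))"

definition gen_pt_eq :: "(real \<Rightarrow> 'a::euclidean_space) \<Rightarrow> (real \<Rightarrow> 'a) \<Rightarrow> bool" where
  "gen_pt_eq x y \<longleftrightarrow> (\<forall>k::nat. (\<lambda>\<epsilon>. dist (x \<epsilon>) (y \<epsilon>)) \<in> O[at_right 0](\<lambda>\<epsilon>. \<epsilon> ^ k))"

section \<open>c-bounded generalized functions\<close>

definition c_bounded ::
  "'a::euclidean_space set \<Rightarrow> 'b::euclidean_space set \<Rightarrow> (real \<Rightarrow> 'a \<Rightarrow> 'b) \<Rightarrow> bool" where
  "c_bounded M N u \<longleftrightarrow> (\<forall>K. compact K \<and> K \<subseteq> M \<longrightarrow>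
     (\<exists>K'. compact K' \<and> K' \<subseteq> N \<and> (\<forall>\<^sub>F \<epsilon> in at_right 0. u \<epsilon> ` K \<subseteq> K')))"

definition EMap ::
  "'a::euclidean_space set \<Rightarrow> 'b::euclidean_space set \<Rightarrow> (real \<Rightarrow> 'a \<Rightarrow> 'b) set" where
  "EMap M N = {u. (\<forall>\<epsilon>\<in>I_eps. smooth_on M (u \<epsilon>) \<and> u \<epsilon> ` M \<subseteq> N) \<and> c_bounded M N u \<and>
     (\<forall>f :: 'b \<Rightarrow> real. smooth_on N f \<longrightarrow> (\<lambda>\<epsilon>. f \<circ> u \<epsilon>) \<in> EM M)}"

definition GMap_eq ::
  "'a::euclidean_space set \<Rightarrow> 'b::euclidean_space set \<Rightarrow>
    (real \<Rightarrow> 'a \<Rightarrow> 'b) \<Rightarrow> (real \<Rightarrow> 'a \<Rightarrow> 'b) \<Rightarrow> bool" where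
  "GMap_eq M N u v \<longleftrightarrow> u \<in> EMap M N \<and> v \<in> EMap M N \<and>
     (\<forall>f :: 'b \<Rightarrow> real. smooth_on N f \<longrightarrow> (\<lambda>\<epsilon> x. f (u \<epsilon> x) - f (v \<epsilon> x)) \<in> Negl M)"

section \<open>Generalized vector fields and the hybrid space\<close>

definition EVec :: "'a::euclidean_space set \<Rightarrow> (real \<Rightarrow> 'a \<Rightarrow> 'a) set" where
  "EVec M = {X. (\<forall>\<epsilon>\<in>I_eps. smooth_on M (X \<epsilon>)) \<and>
     (\<forall>K vs. compact K \<and> K \<subseteq> M \<and> set vs \<subseteq> Basis \<longrightarrow>
        unif_moderate (\<lambda>_. K) (\<lambda>\<epsilon>. partials vs (X \<epsilon>)))}"

definition GVec_eq ::
  "'a::euclidean_space set \<Rightarrow> (real \<Rightarrow> 'a \<Rightarrow> 'a) \<Rightarrow> (real \<Rightarrow> 'a \<Rightarrow> 'a) \<Rightarrow> bool" where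
  "GVec_eq M X Y \<longleftrightarrow> X \<in> EVec M \<and> Y \<in> EVec M \<and>
     (\<forall>K. compact K \<and> K \<subseteq> M \<longrightarrow> unif_negligible (\<lambda>_. K) (\<lambda>\<epsilon> x. X \<epsilon> x - Y \<epsilon> x))"

text \<open>
  The hybrid space for the tangent bundle \<open>TN = N \<times> \<real>\<^sup>m\<close> of an open set \<open>N \<subseteq> \<real>\<^sup>m\<close>, with bundle
  projection \<open>fst\<close>; the estimates are those in the global charts.
\<close>

definition Ehyb ::
  "'a::euclidean_space set \<Rightarrow> 'b::euclidean_space set \<Rightarrow> (real \<Rightarrow> 'a \<Rightarrow> 'b \<times> 'b) set" where
  "Ehyb M N = {u. (\<forall>\<epsilon>\<in>I_eps. smooth_on M (u \<epsilon>) \<and> (fst \<circ> u \<epsilon>) ` M \<subseteq> N) \<and>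
     c_bounded M N (\<lambda>\<epsilon>. fst \<circ> u \<epsilon>) \<and>
     (\<forall>L L' vs. compact L \<and> L \<subseteq> M \<and> compact L' \<and> L' \<subseteq> N \<and> set vs \<subseteq> Basis \<longrightarrow>
        unif_moderate (\<lambda>\<epsilon>. L \<inter> {x. fst (u \<epsilon> x) \<in> L'}) (\<lambda>\<epsilon>. partials vs (u \<epsilon>)))}"

definition Ghyb_eq ::
  "'a::euclidean_space set \<Rightarrow> 'b::euclidean_space set \<Rightarrow>
    (real \<Rightarrow> 'a \<Rightarrow> 'b \<times> 'b) \<Rightarrow> (real \<Rightarrow> 'a \<Rightarrow> 'b \<times> 'b) \<Rightarrow> bool" where
  "Ghyb_eq M N u v \<longleftrightarrow> u \<in> Ehyb M N \<and> v \<in> Ehyb M N \<and>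
     (\<forall>L. compact L \<and> L \<subseteq> M \<longrightarrow>
        (\<forall>e>0. \<forall>\<^sub>F \<epsilon> in at_right 0. \<forall>x\<in>L. dist (fst (u \<epsilon> x)) (fst (v \<epsilon> x)) < e)) \<and>
     (\<forall>L L' vs. compact L \<and> L \<subseteq> M \<and> compact L' \<and> L' \<subseteq> N \<and> set vs \<subseteq> Basis \<longrightarrow>
        unif_negligible (\<lambda>\<epsilon>. L \<inter> {x. fst (u \<epsilon> x) \<in> L'} \<inter> {x. fst (v \<epsilon> x) \<in> L'})
          (\<lambda>\<epsilon>. partials vs (\<lambda>x. u \<epsilon> x - v \<epsilon> x)))"

section \<open>Generalized group actions\<close>

definition gen_group_action ::
  "'a::euclidean_space set \<Rightarrow> (real \<Rightarrow> real \<times> 'a \<Rightarrow> 'a) \<Rightarrow> bool" where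
  "gen_group_action M \<Phi> \<longleftrightarrow>
     \<Phi> \<in> EMap (UNIV \<times> M) M \<and>
     GMap_eq M M (\<lambda>\<epsilon> x. \<Phi> \<epsilon> (0, x)) (\<lambda>\<epsilon> x. x) \<and>
     GMap_eq ((UNIV :: (real \<times> real) set) \<times> M) M
       (\<lambda>\<epsilon> ((\<eta>\<^sub>1, \<eta>\<^sub>2), x). \<Phi> \<epsilon> (\<eta>\<^sub>1 + \<eta>\<^sub>2, x))
       (\<lambda>\<epsilon> ((\<eta>\<^sub>1, \<eta>\<^sub>2), x). \<Phi> \<epsilon> (\<eta>\<^sub>1, \<Phi> \<epsilon> (\<eta>\<^sub>2, x)))"

definition inf_generator ::
  "'a::euclidean_space set \<Rightarrow> (real \<Rightarrow> 'a \<Rightarrow> 'a) \<Rightarrow> (real \<Rightarrow> real \<times> 'a \<Rightarrow> 'a) \<Rightarrow> bool" where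
  "inf_generator M \<xi> \<Phi> \<longleftrightarrow> \<xi> \<in> EVec M \<and>
     Ghyb_eq (UNIV \<times> M) M
       (\<lambda>\<epsilon> (\<eta>, x). (\<Phi> \<epsilon> (\<eta>, x), vector_derivative (\<lambda>t. \<Phi> \<epsilon> (t, x)) (at \<eta>)))
       (\<lambda>\<epsilon> (\<eta>, x). (\<Phi> \<epsilon> (\<eta>, x), \<xi> \<epsilon> (\<Phi> \<epsilon> (\<eta>, x))))"

definition G_complete ::
  "'a::euclidean_space set \<Rightarrow> (real \<Rightarrow> 'a \<Rightarrow> 'a) \<Rightarrow> (real \<Rightarrow> real \<times> 'a \<Rightarrow> 'a) \<Rightarrow> bool" where
  "G_complete M \<xi> \<Phi> \<longleftrightarrow> gen_group_action M \<Phi> \<and> inf_generator M \<xi> \<Phi> \<and>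
     (\<forall>\<Phi>'. gen_group_action M \<Phi>' \<and> inf_generator M \<xi> \<Phi>' \<longrightarrow> GMap_eq (UNIV \<times> M) M \<Phi>' \<Phi>)"

definition is_flow ::
  "'a::euclidean_space set \<Rightarrow> ('a \<Rightarrow> 'a) \<Rightarrow> (real \<times> 'a \<Rightarrow> 'a) \<Rightarrow> bool" where
  "is_flow M X F \<longleftrightarrow> (\<forall>x\<in>M. F (0, x) = x \<and>
     (\<forall>\<eta>. F (\<eta>, x) \<in> M \<and> ((\<lambda>t. F (t, x)) has_vector_derivative X (F (\<eta>, x))) (at \<eta>)))"

definition strictly_G_complete ::
  "'a::euclidean_space set \<Rightarrow> (real \<Rightarrow> 'a \<Rightarrow> 'a) \<Rightarrow> (real \<Rightarrow> real \<times> 'a \<Rightarrow> 'a) \<Rightarrow> bool" where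
  "strictly_G_complete M \<xi> \<Phi> \<longleftrightarrow> G_complete M \<xi> \<Phi> \<and>
     (\<exists>\<xi>' \<Phi>'. GVec_eq M \<xi> \<xi>' \<and> GMap_eq (UNIV \<times> M) M \<Phi> \<Phi>' \<and>
        (\<forall>\<epsilon>\<in>I_eps. is_flow M (\<xi>' \<epsilon>) (\<Phi>' \<epsilon>)))"

text \<open>\<open>\<Phi>\<close> is projectable iff it is projectable via some \<open>\<Xi>\<close>, \<open>\<Psi>\<close>, whose classes are then determined by \<open>\<Phi>\<close>.\<close>

definition projectable_via ::
  "(real \<Rightarrow> real \<times> 'p::finite rvec \<times> 'q::finite rvec \<Rightarrow> 'p rvec \<times> 'q rvec) \<Rightarrow>
   (real \<Rightarrow> real \<times> 'p rvec \<Rightarrow> 'p rvec) \<Rightarrow>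
   (real \<Rightarrow> real \<times> 'p rvec \<times> 'q rvec \<Rightarrow> 'q rvec) \<Rightarrow> bool" where
  "projectable_via \<Phi> \<Xi> \<Psi> \<longleftrightarrow> \<Xi> \<in> EMap UNIV UNIV \<and> \<Psi> \<in> EMap UNIV UNIV \<and>
     GMap_eq UNIV UNIV \<Phi> (\<lambda>\<epsilon> (\<eta>, x, u). (\<Xi> \<epsilon> (\<eta>, x), \<Psi> \<epsilon> (\<eta>, x, u)))"

text \<open>\<open>\<Phi>\<^sub>\<eta>(h)\<close> for single smooth maps; applied to nets at each \<open>\<epsilon>\<close>.\<close>

definition transform ::
  "(real \<times> 'p::finite rvec \<Rightarrow> 'p rvec) \<Rightarrow> (real \<times> 'p rvec \<times> 'q::finite rvec \<Rightarrow> 'q rvec) \<Rightarrow>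
   real \<Rightarrow> ('p rvec \<Rightarrow> 'q rvec) \<Rightarrow> 'p rvec \<Rightarrow> 'q rvec" where
  "transform \<Xi> \<Psi> \<eta> h = (\<lambda>x. \<Psi> (\<eta>, \<Xi> (-\<eta>, x), h (\<Xi> (-\<eta>, x))))"

section \<open>Jets and prolongations\<close>

text \<open>
  The jet space is \<open>\<real>\<^sup>p \<times> (\<real>\<^sup>q)\<^sup>m\<close>, where the finite type \<open>'m\<close> labels the multi-indices of order at
  most \<open>n\<close> through a bijection \<open>\<mu>\<close>. The order \<open>n\<close> is thereby a natural number, although
  dimensions are types: for each \<open>n\<close>, any type \<open>'m\<close> of the right cardinality will do.
\<close>

type_synonym ('p, 'q, 'm) jet = "(real^'p) \<times> (real^'q^'m)"

definition jet_labelling :: "nat \<Rightarrow> ('m::finite \<Rightarrow> 'p::finite \<Rightarrow> nat) \<Rightarrow> bool" where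
  "jet_labelling n \<mu> \<longleftrightarrow> bij_betw \<mu> UNIV {\<alpha>. (\<Sum>i\<in>UNIV. \<alpha> i) \<le> n}"

definition mpartial ::
  "('p::{finite,linorder} \<Rightarrow> nat) \<Rightarrow> ('p rvec \<Rightarrow> 'b::real_normed_vector) \<Rightarrow> 'p rvec \<Rightarrow> 'b" where
  "mpartial \<alpha> h =
     partials (concat (map (\<lambda>i. replicate (\<alpha> i) (axis i 1)) (sorted_list_of_set UNIV))) h"

definition pr ::
  "('m::finite \<Rightarrow> 'p::{finite,linorder} \<Rightarrow> nat) \<Rightarrow> ('p rvec \<Rightarrow> 'q::finite rvec) \<Rightarrow> 'p rvec \<Rightarrow> ('q rvec, 'm) vec" where
  "pr \<mu> h x = (\<chi> m. mpartial (\<mu> m) h x)"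

definition taylor ::
  "('m::finite \<Rightarrow> 'p::finite \<Rightarrow> nat) \<Rightarrow> ('p, 'q::finite, 'm) jet \<Rightarrow> 'p rvec \<Rightarrow> 'q rvec" where
  "taylor \<mu> z y =
     (\<Sum>m\<in>UNIV. (\<Prod>i\<in>UNIV. (y $ i - fst z $ i) ^ \<mu> m i / fact (\<mu> m i)) *\<^sub>R (snd z $ m))"

text \<open>
  The prolonged action is independent of the function chosen to realise the jet \<open>z\<close> only as a
  generalized function: representatives satisfy \<open>\<Xi>(-\<eta>, \<Xi>(\<eta>, x)) = x\<close> merely up to
  negligible nets. The Taylor polynomial, which depends smoothly on \<open>z\<close>, fixes a representative.
\<close>

definition pr_action ::
  "('m::finite \<Rightarrow> 'p::{finite,linorder} \<Rightarrow> nat) \<Rightarrow>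
   (real \<Rightarrow> real \<times> 'p rvec \<Rightarrow> 'p rvec) \<Rightarrow>
   (real \<Rightarrow> real \<times> 'p rvec \<times> 'q::finite rvec \<Rightarrow> 'q rvec) \<Rightarrow>
   real \<Rightarrow> real \<times> ('p, 'q, 'm) jet \<Rightarrow> ('p, 'q, 'm) jet" where
  "pr_action \<mu> \<Xi> \<Psi> = (\<lambda>\<epsilon> (\<eta>, z).
     (\<Xi> \<epsilon> (\<eta>, fst z), pr \<mu> (transform (\<Xi> \<epsilon>) (\<Psi> \<epsilon>) \<eta> (taylor \<mu> z)) (\<Xi> \<epsilon> (\<eta>, fst z))))"

definition pr_field ::
  "('m::finite \<Rightarrow> 'p::{finite,linorder} \<Rightarrow> nat) \<Rightarrow>
   (real \<Rightarrow> real \<times> 'p rvec \<Rightarrow> 'p rvec) \<Rightarrow>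
   (real \<Rightarrow> real \<times> 'p rvec \<times> 'q::finite rvec \<Rightarrow> 'q rvec) \<Rightarrow>
   real \<Rightarrow> ('p, 'q, 'm) jet \<Rightarrow> ('p, 'q, 'm) jet" where
  "pr_field \<mu> \<Xi> \<Psi> \<epsilon> z = vector_derivative (\<lambda>\<eta>. pr_action \<mu> \<Xi> \<Psi> \<epsilon> (\<eta>, z)) (at 0)"

text \<open>\<open>\<zeta>(f)\<close> for a generalized vector field \<open>\<zeta>\<close> and a generalized function \<open>f\<close>.\<close>

definition field_deriv ::
  "(real \<Rightarrow> 'a::euclidean_space \<Rightarrow> 'a) \<Rightarrow> (real \<Rightarrow> 'a \<Rightarrow> real) \<Rightarrow> real \<Rightarrow> 'a \<Rightarrow> real" where
  "field_deriv \<zeta> f \<epsilon> z = frechet_derivative (f \<epsilon>) (at z) (\<zeta> \<epsilon> z)"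

section \<open>Solutions and symmetry groups\<close>

definition zero_points ::
  "nat \<Rightarrow> (nat \<Rightarrow> real \<Rightarrow> 'a::euclidean_space \<Rightarrow> real) \<Rightarrow> (real \<Rightarrow> 'a) set" where
  "zero_points l \<Delta> = {z. gen_pt UNIV z \<and> (\<forall>\<nu>\<in>{1..l}. zero_num (\<lambda>\<epsilon>. \<Delta> \<nu> \<epsilon> (z \<epsilon>)))}"

definition solution ::
  "('m::finite \<Rightarrow> 'p::{finite,linorder} \<Rightarrow> nat) \<Rightarrow> nat \<Rightarrow>
   (nat \<Rightarrow> real \<Rightarrow> ('p, 'q::finite, 'm) jet \<Rightarrow> real) \<Rightarrow> (real \<Rightarrow> 'p rvec \<Rightarrow> 'q rvec) \<Rightarrow> bool" where
  "solution \<mu> l \<Delta> u \<longleftrightarrow> u \<in> EMap UNIV UNIV \<and>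
     (\<lambda>\<epsilon> x. (x, pr \<mu> (u \<epsilon>) x)) \<in> EMap UNIV UNIV \<and>
     (\<forall>\<nu>\<in>{1..l}. (\<lambda>\<epsilon> x. \<Delta> \<nu> \<epsilon> (x, pr \<mu> (u \<epsilon>) x)) \<in> Negl UNIV)"

definition symmetry_group ::
  "('m::finite \<Rightarrow> 'p::{finite,linorder} \<Rightarrow> nat) \<Rightarrow> nat \<Rightarrow>
   (nat \<Rightarrow> real \<Rightarrow> ('p, 'q::finite, 'm) jet \<Rightarrow> real) \<Rightarrow>
   (real \<Rightarrow> real \<times> 'p rvec \<Rightarrow> 'p rvec) \<Rightarrow>
   (real \<Rightarrow> real \<times> 'p rvec \<times> 'q rvec \<Rightarrow> 'q rvec) \<Rightarrow> bool" where
  "symmetry_group \<mu> l \<Delta> \<Xi> \<Psi> \<longleftrightarrow>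
     (\<forall>u \<eta>. solution \<mu> l \<Delta> u \<and> gen_pt UNIV \<eta> \<longrightarrow>
        solution \<mu> l \<Delta> (\<lambda>\<epsilon>. transform (\<Xi> \<epsilon>) (\<Psi> \<epsilon>) (\<eta> \<epsilon>) (u \<epsilon>)))"

section \<open>Maximal rank via a generalized chart\<close>

definition diffeo_pair ::
  "'a::euclidean_space set \<Rightarrow> 'b::euclidean_space set \<Rightarrow> ('a \<Rightarrow> 'b) \<Rightarrow> ('b \<Rightarrow> 'a) \<Rightarrow> bool" where
  "diffeo_pair U V f g \<longleftrightarrow> smooth_on U f \<and> smooth_on V g \<and> f ` U \<subseteq> V \<and> g ` V \<subseteq> U \<and>
     (\<forall>x\<in>U. g (f x) = x) \<and> (\<forall>y\<in>V. f (g y) = y)"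

text \<open>The coordinate \<open>x\<^sub>i\<close> of \<open>x = (x\<^sub>1, \<dots>, x\<^sub>d)\<close>, for \<open>1 \<le> i \<le> d\<close>.\<close>

definition nth_coord :: "nat \<Rightarrow> 'd::{finite,linorder} rvec \<Rightarrow> real" where
  "nth_coord i x = x $ (sorted_list_of_set UNIV ! (i - 1))"

text \<open>The nets \<open>\<psi>\<close>, \<open>\<psi>'\<close> are indexed by all of \<open>I\<close>, but mutually inverse only for \<open>\<epsilon> \<le> \<epsilon>\<^sub>0\<close>.\<close>

definition max_rank_via ::
  "nat \<Rightarrow> (nat \<Rightarrow> real \<Rightarrow> 'a::euclidean_space \<Rightarrow> real) \<Rightarrow> 'a set \<Rightarrow> ('d::{finite,linorder} rvec) set \<Rightarrow>
   (real \<Rightarrow> 'a \<Rightarrow> 'd rvec) \<Rightarrow> (real \<Rightarrow> 'd rvec \<Rightarrow> 'a) \<Rightarrow> bool" where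
  "max_rank_via l \<Delta> U V \<psi> \<psi>' \<longleftrightarrow>
     (\<exists>\<epsilon>\<^sub>0\<in>I_eps. \<forall>\<epsilon>\<in>{0<..\<epsilon>\<^sub>0}. diffeo_pair U V (\<psi> \<epsilon>) (\<psi>' \<epsilon>)) \<and>
     \<psi> \<in> EMap U V \<and> \<psi>' \<in> EMap V U \<and>
     (\<forall>\<nu>\<in>{1..l}. G_eq V (\<lambda>\<epsilon>. \<Delta> \<nu> \<epsilon> \<circ> \<psi>' \<epsilon>)
        (\<lambda>\<epsilon> x. if \<nu> \<le> min CARD('d) l then nth_coord \<nu> x else 0))"

definition push_field ::
  "(real \<Rightarrow> 'a::euclidean_space \<Rightarrow> 'b::euclidean_space) \<Rightarrow> (real \<Rightarrow> 'b \<Rightarrow> 'a) \<Rightarrow>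
   (real \<Rightarrow> 'a \<Rightarrow> 'a) \<Rightarrow> real \<Rightarrow> 'b \<Rightarrow> 'b" where
  "push_field \<psi> \<psi>' \<zeta> \<epsilon> y = frechet_derivative (\<psi> \<epsilon>) (at (\<psi>' \<epsilon> y)) (\<zeta> \<epsilon> (\<psi>' \<epsilon> y))"

definition is_box :: "'d::finite rvec set \<Rightarrow> bool" where
  "is_box V \<longleftrightarrow> (\<exists>a b :: 'd \<Rightarrow> ereal. (\<forall>i. a i < b i) \<and>
     V = {x. \<forall>i. a i < ereal (x $ i) \<and> ereal (x $ i) < b i})"

definition deriv_log_type :: "'a::euclidean_space set \<Rightarrow> (real \<Rightarrow> 'a \<Rightarrow> 'a) \<Rightarrow> bool" where
  "deriv_log_type V X \<longleftrightarrow>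
     (\<forall>K X'. compact K \<and> K \<subseteq> V \<and> GVec_eq V X X' \<longrightarrow>
        (\<exists>C>0. \<forall>\<^sub>F \<epsilon> in at_right 0. \<forall>x\<in>K. onorm (frechet_derivative (X' \<epsilon>) (at x)) \<le> C * \<bar>ln \<epsilon>\<bar>))"

definition linear_growth :: "(real \<Rightarrow> 'a::euclidean_space \<Rightarrow> 'a) \<Rightarrow> bool" where
  "linear_growth X \<longleftrightarrow>
     (\<exists>X'. GVec_eq UNIV X X' \<and>
        (\<exists>C>0. \<exists>\<epsilon>\<^sub>0>0. \<forall>\<epsilon>\<in>I_eps. \<epsilon> < \<epsilon>\<^sub>0 \<longrightarrow> (\<forall>x. norm (X' \<epsilon> x) \<le> C * (1 + norm x))))"

end

theory Submission
  imports Defs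
begin

text \<open>
  Let \<open>F = pr\<^sup>(\<^sup>n\<^sup>)\<Phi>\<close>. The heart of the matter is that \<open>F\<close> maps the zero set \<open>S\<^sub>\<Delta>\<close> of generalized points to
  itself. In the chart \<open>\<psi>\<close> the zero set is, up to negligible errors, the linear subspace on which the
  first \<open>k\<close> coordinates vanish, so setting these coordinates to zero gives a retraction \<open>\<rho>\<close> onto it.
  By the infinitesimal criterion a point \<open>x\<close> of the zero set satisfies \<open>\<Delta>(F(h, x)) = O(h\<^sup>2)\<close> up to
  moderate factors. With steps \<open>h\<close> of size \<open>\<epsilon>\<^sup>M\<close>, the discrete trajectory
  \<open>x\<^sub>j\<^sub>+\<^sub>1 = \<rho>(F(h, x\<^sub>j))\<close> stays in the zero set. The one-step errors \<open>O(\<epsilon>\<^sup>2\<^sup>M\<^sup>-\<^sup>N)\<close> are transported by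
  \<open>F\<close>, whose Lipschitz constants are moderate, and therefore add up over the \<open>O(\<epsilon>\<^sup>-\<^sup>M)\<close> steps instead of
  being amplified exponentially. So \<open>F(\<eta>, z)\<close> is arbitrarily close to the zero set as \<open>M\<close> grows.

  Invariance of \<open>S\<^sub>\<Delta>\<close> passes to solutions because the \<open>n\<close>-jet of \<open>\<Phi>\<^sub>\<eta>(u)\<close> at \<open>x\<close> depends only on the
  \<open>n\<close>-jet of \<open>u\<close> at \<open>\<Xi>\<^sub>-\<^sub>\<eta>(x)\<close>, so that the graph of \<open>pr\<^sup>(\<^sup>n\<^sup>)\<Phi>\<^sub>\<eta>(u)\<close> agrees with the image of the graph of
  \<open>pr\<^sup>(\<^sup>n\<^sup>)u\<close> under \<open>F(\<eta>, \<cdot>)\<close> up to negligible nets.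
\<close>

section \<open>Asymptotic estimates\<close>

text \<open>The derivatives of the generator are only moderate, so comparing trajectories by
  Gronwall would cost a factor exp(\<epsilon>^-N), which no negligible bound survives. The scheme
  avoids it as follows. The group law carries an error made at step j to the final time in a single
  application of F, whose Lipschitz constant on a fixed compact set is \<epsilon>^-N with N
  independent of j and of the step size; the negligible defects of the group law stay harmless when
  added \<epsilon>^-M times. The exponents for the retraction, the single step and the transport are
  known before M and the target accuracy, so M is chosen after them. Finally, the hypotheses speak
  of one generalized point or one net of times, whereas the scheme needs bounds uniform over
  \<epsilon>-dependent sets and over all times: these come from selecting for each \<epsilon> a
  worst point of the set, or a time at which the trajectory is closest to the complement of U. Since
  trajectories are known to stay in U for short times only, invariance is proved for such times and
  extended by cutting \<eta> into finitely many equal parts.\<close>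

lemma eventually_I_eps: "\<forall>\<^sub>F \<epsilon> in at_right 0. \<epsilon> \<in> I_eps"
  by (rule eventually_at_rightI[of 0 1]) auto

text \<open>Constants are absorbed this way throughout: for small \<epsilon> a factor C costs one
  power of \<epsilon>, so the estimates below carry exponents only.\<close>

lemma eventually_mult_less: "\<forall>\<^sub>F \<epsilon> in at_right (0::real). C * \<epsilon> < 1"
proof -
  have "((\<lambda>\<epsilon>. C * \<epsilon>) \<longlongrightarrow> C * 0) (at_right (0::real))"
    by (intro tendsto_intros)
  then show ?thesis
    by (rule order_tendstoD(2)) simp
qed

lemma unif_moderate_iff:
  "unif_moderate A f \<longleftrightarrow> (\<exists>N. \<forall>\<^sub>F \<epsilon> in at_right 0. \<forall>x\<in>A \<epsilon>. norm (f \<epsilon> x) \<le> inverse (\<epsilon> ^ N))"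
proof
  assume "unif_moderate A f"
  then obtain N C where *: "\<forall>\<^sub>F \<epsilon> in at_right 0. \<forall>x\<in>A \<epsilon>. norm (f \<epsilon> x) \<le> C * inverse (\<epsilon> ^ N)"
    unfolding unif_moderate_def unif_bigo_def by blast
  have "\<forall>\<^sub>F \<epsilon> in at_right 0. \<forall>x\<in>A \<epsilon>. norm (f \<epsilon> x) \<le> inverse (\<epsilon> ^ Suc N)"
    using * eventually_I_eps eventually_mult_less[of C]
  proof eventually_elim
    case (elim \<epsilon>)
    have "C * inverse (\<epsilon> ^ N) \<le> inverse (\<epsilon> ^ Suc N)"
      using elim by (simp add: field_simps)
    then show ?case using elim(1) by (meson order_trans)
  qed
  then show "\<exists>N. \<forall>\<^sub>F \<epsilon> in at_right 0. \<forall>x\<in>A \<epsilon>. norm (f \<epsilon> x) \<le> inverse (\<epsilon> ^ N)" by blast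
next
  assume "\<exists>N. \<forall>\<^sub>F \<epsilon> in at_right 0. \<forall>x\<in>A \<epsilon>. norm (f \<epsilon> x) \<le> inverse (\<epsilon> ^ N)"
  then show "unif_moderate A f"
    unfolding unif_moderate_def unif_bigo_def by (elim ex_forward) (intro exI[of _ 1], simp)
qed

lemma unif_negligible_iff:
  "unif_negligible A f \<longleftrightarrow> (\<forall>k. \<forall>\<^sub>F \<epsilon> in at_right 0. \<forall>x\<in>A \<epsilon>. norm (f \<epsilon> x) \<le> \<epsilon> ^ k)"
proof
  assume n: "unif_negligible A f"
  show "\<forall>k. \<forall>\<^sub>F \<epsilon> in at_right 0. \<forall>x\<in>A \<epsilon>. norm (f \<epsilon> x) \<le> \<epsilon> ^ k"
  proof
    fix k
    obtain C where *: "\<forall>\<^sub>F \<epsilon> in at_right 0. \<forall>x\<in>A \<epsilon>. norm (f \<epsilon> x) \<le> C * \<epsilon> ^ Suc k"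
      using n unfolding unif_negligible_def unif_bigo_def by blast
    show "\<forall>\<^sub>F \<epsilon> in at_right 0. \<forall>x\<in>A \<epsilon>. norm (f \<epsilon> x) \<le> \<epsilon> ^ k"
      using * eventually_I_eps eventually_mult_less[of C]
    proof eventually_elim
      case (elim \<epsilon>)
      have "C * \<epsilon> ^ Suc k \<le> \<epsilon> ^ k"
        using elim mult_right_mono[of "C * \<epsilon>" 1 "\<epsilon> ^ k"] by (simp add: mult.assoc)
      then show ?case using elim(1) by (meson order_trans)
    qed
  qed
next
  assume "\<forall>k. \<forall>\<^sub>F \<epsilon> in at_right 0. \<forall>x\<in>A \<epsilon>. norm (f \<epsilon> x) \<le> \<epsilon> ^ k"
  then show "unif_negligible A f"
    unfolding unif_negligible_def unif_bigo_def by (intro allI exI[of _ 1]) simp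
qed

lemma zero_num_iff: "zero_num r \<longleftrightarrow> (\<forall>k. \<forall>\<^sub>F \<epsilon> in at_right 0. \<bar>r \<epsilon>\<bar> \<le> \<epsilon> ^ k)"
proof -
  \<comment> \<open>A number is a function on the one-point set, so the constant-free form of
    uniform negligibility applies to it.\<close>
  have "zero_num r \<longleftrightarrow> unif_negligible (\<lambda>_. {()}) (\<lambda>\<epsilon> _. r \<epsilon>)"
    unfolding zero_num_def unif_negligible_def unif_bigo_def
  proof (intro all_cong1 iffI)
    fix k assume "r \<in> O[at_right 0](\<lambda>\<epsilon>. \<epsilon> ^ k)"
    then obtain c where "\<forall>\<^sub>F \<epsilon> in at_right 0. norm (r \<epsilon>) \<le> c * norm (\<epsilon> ^ k)"
      by (auto elim!: landau_o.bigE)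
    then have "\<forall>\<^sub>F \<epsilon> in at_right 0. \<forall>x\<in>{()}. norm (r \<epsilon>) \<le> c * \<epsilon> ^ k"
      using eventually_I_eps by eventually_elim (auto simp: power_abs)
    then show "\<exists>C. \<forall>\<^sub>F \<epsilon> in at_right 0. \<forall>x\<in>{()}. norm (r \<epsilon>) \<le> C * \<epsilon> ^ k" by blast
  next
    fix k assume "\<exists>C. \<forall>\<^sub>F \<epsilon> in at_right 0. \<forall>x\<in>{()}. norm (r \<epsilon>) \<le> C * \<epsilon> ^ k"
    then obtain C where C: "\<forall>\<^sub>F \<epsilon> in at_right 0. \<forall>x\<in>{()}. norm (r \<epsilon>) \<le> C * \<epsilon> ^ k" by blast
    have "\<forall>\<^sub>F \<epsilon> in at_right 0. norm (r \<epsilon>) \<le> C * norm (\<epsilon> ^ k)"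
      using C eventually_I_eps by eventually_elim (auto simp: power_abs)
    then show "r \<in> O[at_right 0](\<lambda>\<epsilon>. \<epsilon> ^ k)" by (rule bigoI)
  qed
  then show ?thesis by (simp add: unif_negligible_iff)
qed

lemma gen_pt_eq_iff: "gen_pt_eq x y \<longleftrightarrow> (\<forall>k. \<forall>\<^sub>F \<epsilon> in at_right 0. dist (x \<epsilon>) (y \<epsilon>) \<le> \<epsilon> ^ k)"
  using zero_num_iff[of "\<lambda>\<epsilon>. dist (x \<epsilon>) (y \<epsilon>)"]
  unfolding gen_pt_eq_def zero_num_def by simp

text \<open>The map \<open>j\<close> may depend on \<epsilon>; this lets bounds on a compact set be
  pulled back along a c-bounded net.\<close>

lemma unif_moderate_mono:
  assumes "unif_moderate A f" "\<forall>\<^sub>F \<epsilon> in at_right 0. \<forall>x\<in>B \<epsilon>. j \<epsilon> x \<in> A \<epsilon> \<and> norm (g \<epsilon> x) \<le> norm (f \<epsilon> (j \<epsilon> x))"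
  shows "unif_moderate B g"
proof -
  obtain N where *: "\<forall>\<^sub>F \<epsilon> in at_right 0. \<forall>x\<in>A \<epsilon>. norm (f \<epsilon> x) \<le> inverse (\<epsilon> ^ N)"
    using assms(1) unif_moderate_iff by blast
  have "\<forall>\<^sub>F \<epsilon> in at_right 0. \<forall>x\<in>B \<epsilon>. norm (g \<epsilon> x) \<le> inverse (\<epsilon> ^ N)"
    using * assms(2) by eventually_elim (meson order_trans)
  then show ?thesis using unif_moderate_iff by blast
qed

lemma unif_moderate_cong:
  assumes "\<forall>\<^sub>F \<epsilon> in at_right 0. \<forall>x\<in>A \<epsilon>. f \<epsilon> x = g \<epsilon> x"
  shows "unif_moderate A f \<longleftrightarrow> unif_moderate A g"
proof
  show "unif_moderate A f \<Longrightarrow> unif_moderate A g"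
    by (rule unif_moderate_mono[where j="\<lambda>_ x. x"]) (use assms in \<open>auto elim!: eventually_mono\<close>)
  show "unif_moderate A g \<Longrightarrow> unif_moderate A f"
    by (rule unif_moderate_mono[where j="\<lambda>_ x. x"]) (use assms in \<open>auto elim!: eventually_mono\<close>)
qed

lemma unif_moderate_const: "unif_moderate A (\<lambda>_ _. c)"
  unfolding unif_moderate_def unif_bigo_def by (rule exI[of _ 0], rule exI[of _ "norm c"]) simp

lemma unif_moderate_bilinear:
  assumes "bounded_bilinear bil" "unif_moderate A f" "unif_moderate A g"
  shows "unif_moderate A (\<lambda>\<epsilon> x. bil (f \<epsilon> x) (g \<epsilon> x))"
proof -
  interpret bounded_bilinear bil by fact
  obtain K where K: "K > 0" "\<And>a b. norm (bil a b) \<le> norm a * norm b * K"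
    using pos_bounded by blast
  obtain N where N: "\<forall>\<^sub>F \<epsilon> in at_right 0. \<forall>x\<in>A \<epsilon>. norm (f \<epsilon> x) \<le> inverse (\<epsilon> ^ N)"
    using assms(2) unif_moderate_iff by blast
  obtain N' where N': "\<forall>\<^sub>F \<epsilon> in at_right 0. \<forall>x\<in>A \<epsilon>. norm (g \<epsilon> x) \<le> inverse (\<epsilon> ^ N')"
    using assms(3) unif_moderate_iff by blast
  have "\<forall>\<^sub>F \<epsilon> in at_right 0. \<forall>x\<in>A \<epsilon>. norm (bil (f \<epsilon> x) (g \<epsilon> x)) \<le> K * inverse (\<epsilon> ^ (N + N'))"
    using N N' eventually_I_eps
  proof eventually_elim
    case (elim \<epsilon>)
    show ?case
    proof
      fix x assume "x \<in> A \<epsilon>"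
      then have "norm (f \<epsilon> x) * norm (g \<epsilon> x) * K \<le> inverse (\<epsilon> ^ N) * inverse (\<epsilon> ^ N') * K"
        using elim K(1) by (intro mult_right_mono mult_mono) auto
      then show "norm (bil (f \<epsilon> x) (g \<epsilon> x)) \<le> K * inverse (\<epsilon> ^ (N + N'))"
        using K(2)[of "f \<epsilon> x" "g \<epsilon> x"] by (simp add: power_add mult_ac)
    qed
  qed
  then show ?thesis unfolding unif_moderate_def unif_bigo_def by blast
qed

lemma unif_moderate_add:
  assumes "unif_moderate A f" "unif_moderate A g"
  shows "unif_moderate A (\<lambda>\<epsilon> x. f \<epsilon> x + g \<epsilon> x)"
proof -
  obtain N where N: "\<forall>\<^sub>F \<epsilon> in at_right 0. \<forall>x\<in>A \<epsilon>. norm (f \<epsilon> x) \<le> inverse (\<epsilon> ^ N)"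
    using assms(1) unif_moderate_iff by blast
  obtain N' where N': "\<forall>\<^sub>F \<epsilon> in at_right 0. \<forall>x\<in>A \<epsilon>. norm (g \<epsilon> x) \<le> inverse (\<epsilon> ^ N')"
    using assms(2) unif_moderate_iff by blast
  have "\<forall>\<^sub>F \<epsilon> in at_right 0. \<forall>x\<in>A \<epsilon>. norm (f \<epsilon> x + g \<epsilon> x) \<le> 2 * inverse (\<epsilon> ^ (N + N'))"
    using N N' eventually_I_eps
  proof eventually_elim
    case (elim \<epsilon>)
    have "inverse (\<epsilon> ^ N) \<le> inverse (\<epsilon> ^ (N + N'))" "inverse (\<epsilon> ^ N') \<le> inverse (\<epsilon> ^ (N + N'))"
      using elim(3) by (intro le_imp_inverse_le power_decreasing; simp)+
    then show ?case
      using elim(1,2) by (force intro: order_trans[OF norm_triangle_ineq])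
  qed
  then show ?thesis unfolding unif_moderate_def unif_bigo_def by blast
qed

lemma unif_moderate_sum:
  assumes "\<And>i. i \<in> I \<Longrightarrow> unif_moderate A (f i)"
  shows "unif_moderate A (\<lambda>\<epsilon> x. \<Sum>i\<in>I. f i \<epsilon> x)"
  using assms
proof (induction I rule: infinite_finite_induct)
  case (insert i I)
  then show ?case by (simp add: unif_moderate_add)
qed (auto intro: unif_moderate_const)

section \<open>Moderate nets of smooth maps\<close>

text \<open>Moderateness of derivatives up to a given order, by the same recursion as
  \<open>higher_differentiable_on\<close>. Allowing every direction v at each level makes the sum,
  product and chain rules provable by induction on the order, for maps into any Euclidean space;
  \<open>EM_iff\<close> and \<open>EMap_iff\<close> connect this notion with the definitions by
  differential operators and by test functions.\<close>

primrec moderate_upto ::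
  "'a::euclidean_space set \<Rightarrow> (real \<Rightarrow> 'a \<Rightarrow> 'b::euclidean_space) \<Rightarrow> nat \<Rightarrow> bool" where
  "moderate_upto M u 0 \<longleftrightarrow> (\<forall>\<epsilon>\<in>I_eps. continuous_on M (u \<epsilon>)) \<and>
     (\<forall>K. compact K \<and> K \<subseteq> M \<longrightarrow> unif_moderate (\<lambda>_. K) u)"
| "moderate_upto M u (Suc n) \<longleftrightarrow>
     (\<forall>K. compact K \<and> K \<subseteq> M \<longrightarrow> unif_moderate (\<lambda>_. K) u) \<and>
     (\<forall>\<epsilon>\<in>I_eps. \<forall>x\<in>M. u \<epsilon> differentiable (at x)) \<and>
     (\<forall>v. moderate_upto M (\<lambda>\<epsilon> x. frechet_derivative (u \<epsilon>) (at x) v) n)"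

definition moderate_net where "moderate_net M u \<longleftrightarrow> (\<forall>n. moderate_upto M u n)"

lemma differentiable_imp_continuous_on_at:
  "(\<And>x. x \<in> M \<Longrightarrow> f differentiable (at x)) \<Longrightarrow> continuous_on M f"
  by (meson continuous_at_imp_continuous_on differentiable_imp_continuous_within)

lemma moderate_upto_Suc_imp: "moderate_upto M u (Suc n) \<Longrightarrow> moderate_upto M u n"
proof (induction n arbitrary: u)
  case 0
  then show ?case by (auto intro!: differentiable_imp_continuous_on_at)
next
  case (Suc n)
  show ?case
    unfolding moderate_upto.simps(2)[of M u n]
    using Suc.prems Suc.IH unfolding moderate_upto.simps(2)[of M u "Suc n"] by blast
qed

lemma moderate_upto_unif: "moderate_upto M u n \<Longrightarrow> compact K \<Longrightarrow> K \<subseteq> M \<Longrightarrow> unif_moderate (\<lambda>_. K) u"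
  by (cases n) auto

lemma moderate_net_unif: "moderate_net M u \<Longrightarrow> compact K \<Longrightarrow> K \<subseteq> M \<Longrightarrow> unif_moderate (\<lambda>_. K) u"
  unfolding moderate_net_def using moderate_upto_unif by blast

lemma moderate_net_differentiable:
  "moderate_net M u \<Longrightarrow> \<epsilon> \<in> I_eps \<Longrightarrow> x \<in> M \<Longrightarrow> u \<epsilon> differentiable (at x)"
  unfolding moderate_net_def using moderate_upto.simps(2)[of M u 0] by blast

lemma moderate_net_continuous_on:
  "moderate_net M u \<Longrightarrow> \<epsilon> \<in> I_eps \<Longrightarrow> continuous_on M (u \<epsilon>)"
  unfolding moderate_net_def using moderate_upto.simps(1)[of M u] by blast

lemma moderate_net_deriv:
  "moderate_net M u \<Longrightarrow> moderate_net M (\<lambda>\<epsilon> x. frechet_derivative (u \<epsilon>) (at x) v)"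
  unfolding moderate_net_def using moderate_upto.simps(2)[of M u] by blast

lemma frechet_derivative_cong_open:
  assumes "open M" "x \<in> M" "\<And>y. y \<in> M \<Longrightarrow> f y = g y"
  shows "frechet_derivative f (at x) = frechet_derivative g (at x)"
proof -
  have "(f has_derivative D) (at x) \<longleftrightarrow> (g has_derivative D) (at x)" for D
    using has_derivative_transform_within_open[OF _ assms(1,2), of f D UNIV g]
      has_derivative_transform_within_open[OF _ assms(1,2), of g D UNIV f] assms(3) by auto
  then show ?thesis unfolding frechet_derivative_def by simp
qed

lemma differentiable_cong_open:
  assumes "open M" "x \<in> M" "\<And>y. y \<in> M \<Longrightarrow> f y = g y" "f differentiable (at x)"
  shows "g differentiable (at x)"
  using has_derivative_transform_within_open[OF _ assms(1,2), of f _ UNIV g] assms(3,4)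
  unfolding differentiable_def by blast

text \<open>Openness of M makes derivatives comparable: agreement on M is agreement near each of its
  points.\<close>

lemma moderate_upto_cong:
  assumes "open M" "moderate_upto M f n" "\<And>\<epsilon> x. \<epsilon> \<in> I_eps \<Longrightarrow> x \<in> M \<Longrightarrow> f \<epsilon> x = g \<epsilon> x"
  shows "moderate_upto M g n"
  using assms(2,3)
proof (induction n arbitrary: f g)
  case 0
  have "unif_moderate (\<lambda>_. K) g" if "compact K" "K \<subseteq> M" for K
  proof -
    have "unif_moderate (\<lambda>_. K) f" using 0(1) that by simp
    moreover have "\<forall>\<^sub>F \<epsilon> in at_right 0. \<forall>x\<in>K. f \<epsilon> x = g \<epsilon> x"
      using eventually_I_eps by eventually_elim (use 0(2) that in auto)
    ultimately show ?thesis by (simp add: unif_moderate_cong)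
  qed
  then show ?case using 0 continuous_on_cong[of M M] by (metis moderate_upto.simps(1))
next
  case (Suc n)
  have "unif_moderate (\<lambda>_. K) g" if "compact K" "K \<subseteq> M" for K
  proof -
    have "unif_moderate (\<lambda>_. K) f" using Suc(2) that by simp
    moreover have "\<forall>\<^sub>F \<epsilon> in at_right 0. \<forall>x\<in>K. f \<epsilon> x = g \<epsilon> x"
      using eventually_I_eps by eventually_elim (use Suc(3) that in auto)
    ultimately show ?thesis by (simp add: unif_moderate_cong)
  qed
  moreover have "g \<epsilon> differentiable (at x)" if "\<epsilon> \<in> I_eps" "x \<in> M" for \<epsilon> x
    by (rule differentiable_cong_open[OF assms(1) that(2), of "f \<epsilon>"]) (use Suc that in auto)
  moreover have "moderate_upto M (\<lambda>\<epsilon> x. frechet_derivative (g \<epsilon>) (at x) v) n" for v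
  proof (rule Suc.IH)
    show "moderate_upto M (\<lambda>\<epsilon> x. frechet_derivative (f \<epsilon>) (at x) v) n" using Suc(2) by simp
    show "frechet_derivative (f \<epsilon>) (at x) v = frechet_derivative (g \<epsilon>) (at x) v"
      if "\<epsilon> \<in> I_eps" "x \<in> M" for \<epsilon> x
      using frechet_derivative_cong_open[OF assms(1) that(2), of "f \<epsilon>" "g \<epsilon>"] Suc(3) that by auto
  qed
  ultimately show ?case by simp
qed

lemma moderate_net_cong:
  assumes "open M" "moderate_net M f" "\<And>\<epsilon> x. \<epsilon> \<in> I_eps \<Longrightarrow> x \<in> M \<Longrightarrow> f \<epsilon> x = g \<epsilon> x"
  shows "moderate_net M g"
  using moderate_upto_cong[OF assms(1)] assms(2,3) unfolding moderate_net_def by blast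

text \<open>The value is constant in x but may vary with \<epsilon>: generalized points enter
  compositions as such maps.\<close>

lemma moderate_upto_const_net:
  fixes c :: "real \<Rightarrow> 'b::euclidean_space"
  shows "(\<And>K. compact K \<Longrightarrow> K \<subseteq> M \<Longrightarrow> unif_moderate (\<lambda>_. K) (\<lambda>\<epsilon> (_::'a::euclidean_space). c \<epsilon>)) \<Longrightarrow>
    moderate_upto M (\<lambda>\<epsilon> _. c \<epsilon>) n"
proof (induction n arbitrary: c)
  case (Suc n)
  have "moderate_upto M (\<lambda>\<epsilon> _. 0 :: 'b) n"
    by (rule Suc.IH) (rule unif_moderate_const)
  with Suc.prems show ?case by simp
qed auto

section \<open>Closure of moderate nets under the operations of calculus\<close>

lemma moderate_net_const: "moderate_net M (\<lambda>_ _. c)"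
  unfolding moderate_net_def by (auto intro!: moderate_upto_const_net unif_moderate_const)

lemma frechet_derivative_eqI: "(f has_derivative D) (at x) \<Longrightarrow> frechet_derivative f (at x) = D"
  using frechet_derivative_at by blast

lemma moderate_upto_add:
  assumes "open M" "moderate_upto M f n" "moderate_upto M g n"
  shows "moderate_upto M (\<lambda>\<epsilon> x. f \<epsilon> x + g \<epsilon> x) n"
  using assms(2,3)
proof (induction n arbitrary: f g)
  case 0
  then show ?case by (auto intro!: continuous_intros unif_moderate_add)
next
  case (Suc n)
  have "moderate_upto M (\<lambda>\<epsilon> x. frechet_derivative (\<lambda>x. f \<epsilon> x + g \<epsilon> x) (at x) v) n" for v
  proof (rule moderate_upto_cong[OF assms(1)])
    show "moderate_upto M (\<lambda>\<epsilon> x. frechet_derivative (f \<epsilon>) (at x) v + frechet_derivative (g \<epsilon>) (at x) v) n"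
      by (rule Suc.IH) (use Suc.prems in auto)
    fix \<epsilon> x assume "\<epsilon> \<in> I_eps" "x \<in> M"
    then have "f \<epsilon> differentiable (at x)" "g \<epsilon> differentiable (at x)" using Suc.prems by auto
    then show "frechet_derivative (f \<epsilon>) (at x) v + frechet_derivative (g \<epsilon>) (at x) v =
        frechet_derivative (\<lambda>x. f \<epsilon> x + g \<epsilon> x) (at x) v"
      by (subst frechet_derivative_eqI[OF has_derivative_add])
         (auto simp: frechet_derivative_works[symmetric])
  qed
  with Suc.prems show ?case by (auto intro!: unif_moderate_add)
qed

lemma moderate_net_add:
  "open M \<Longrightarrow> moderate_net M f \<Longrightarrow> moderate_net M g \<Longrightarrow> moderate_net M (\<lambda>\<epsilon> x. f \<epsilon> x + g \<epsilon> x)"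
  unfolding moderate_net_def by (blast intro: moderate_upto_add)

lemma moderate_upto_bilinear:
  assumes "open M" "bounded_bilinear bil" "moderate_upto M f n" "moderate_upto M g n"
  shows "moderate_upto M (\<lambda>\<epsilon> x. bil (f \<epsilon> x) (g \<epsilon> x)) n"
  using assms(3,4)
proof (induction n arbitrary: f g)
  case 0
  then show ?case
    by (auto intro!: bounded_bilinear.continuous_on[OF assms(2)] unif_moderate_bilinear[OF assms(2)])
next
  case (Suc n)
  have "moderate_upto M (\<lambda>\<epsilon> x. frechet_derivative (\<lambda>x. bil (f \<epsilon> x) (g \<epsilon> x)) (at x) v) n" for v
  proof (rule moderate_upto_cong[OF assms(1)])
    show "moderate_upto M (\<lambda>\<epsilon> x. bil (f \<epsilon> x) (frechet_derivative (g \<epsilon>) (at x) v) +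
        bil (frechet_derivative (f \<epsilon>) (at x) v) (g \<epsilon> x)) n"
      by (intro moderate_upto_add[OF assms(1)] Suc.IH)
         (use Suc.prems in \<open>auto simp: moderate_upto_Suc_imp\<close>)
    fix \<epsilon> x assume "\<epsilon> \<in> I_eps" "x \<in> M"
    then have "f \<epsilon> differentiable (at x)" "g \<epsilon> differentiable (at x)" using Suc.prems by auto
    then show "bil (f \<epsilon> x) (frechet_derivative (g \<epsilon>) (at x) v) +
        bil (frechet_derivative (f \<epsilon>) (at x) v) (g \<epsilon> x) =
        frechet_derivative (\<lambda>x. bil (f \<epsilon> x) (g \<epsilon> x)) (at x) v"
      by (subst frechet_derivative_eqI[OF bounded_bilinear.FDERIV[OF assms(2)]])
         (auto simp: frechet_derivative_works[symmetric])
  qed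
  moreover have "(\<lambda>x. bil (f \<epsilon> x) (g \<epsilon> x)) differentiable (at x)" if "\<epsilon> \<in> I_eps" "x \<in> M" for \<epsilon> x
    using bounded_bilinear.FDERIV[OF assms(2), of "f \<epsilon>" _ x UNIV "g \<epsilon>"] Suc.prems that
    unfolding differentiable_def by (meson moderate_upto.simps(2) differentiable_def)
  ultimately show ?case using Suc.prems by (auto intro!: unif_moderate_bilinear[OF assms(2)])
qed

lemma moderate_net_bilinear:
  "open M \<Longrightarrow> bounded_bilinear bil \<Longrightarrow> moderate_net M f \<Longrightarrow> moderate_net M g \<Longrightarrow>
    moderate_net M (\<lambda>\<epsilon> x. bil (f \<epsilon> x) (g \<epsilon> x))"
  unfolding moderate_net_def by (blast intro: moderate_upto_bilinear)

lemma moderate_upto_linear: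
  assumes "open M" "bounded_linear L" "moderate_upto M f n"
  shows "moderate_upto M (\<lambda>\<epsilon> x. L (f \<epsilon> x)) n"
proof -
  interpret L: bounded_linear L by fact
  \<comment> \<open>With the constant 1 as first factor this bilinear map is L itself, so the
    product rule covers linear maps.\<close>
  have "bounded_bilinear (\<lambda>(r::real) y. r *\<^sub>R L y)"
    by (rule bounded_bilinear.comp[OF bounded_bilinear_scaleR bounded_linear_ident assms(2)])
  from moderate_upto_bilinear[OF assms(1) this moderate_upto_const_net[of M "\<lambda>_. 1"] assms(3)]
  show ?thesis by (simp add: unif_moderate_const)
qed

lemma moderate_net_linear:
  "open M \<Longrightarrow> bounded_linear L \<Longrightarrow> moderate_net M f \<Longrightarrow> moderate_net M (\<lambda>\<epsilon> x. L (f \<epsilon> x))"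
  unfolding moderate_net_def by (blast intro: moderate_upto_linear)

lemma moderate_upto_sum:
  assumes "open M" "\<And>i. i \<in> I \<Longrightarrow> moderate_upto M (f i) n"
  shows "moderate_upto M (\<lambda>\<epsilon> x. \<Sum>i\<in>I. f i \<epsilon> x) n"
  using assms(2)
proof (induction I rule: infinite_finite_induct)
  case (insert i I)
  then show ?case by (simp add: moderate_upto_add[OF assms(1)])
qed (auto intro: moderate_upto_const_net unif_moderate_const)

lemma moderate_net_sum:
  "open M \<Longrightarrow> (\<And>i. i \<in> I \<Longrightarrow> moderate_net M (f i)) \<Longrightarrow> moderate_net M (\<lambda>\<epsilon> x. \<Sum>i\<in>I. f i \<epsilon> x)"
  unfolding moderate_net_def by (blast intro: moderate_upto_sum)

text \<open>Reducing a derivative to basis directions keeps every induction on the level of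
  directional derivatives: the chain rule becomes a finite sum of products of moderate nets, and
  nets of linear operators never appear.\<close>

lemma frechet_derivative_Basis_sum:
  fixes f :: "'a::euclidean_space \<Rightarrow> 'b::real_normed_vector"
  assumes "f differentiable (at x)"
  shows "frechet_derivative f (at x) v = (\<Sum>b\<in>Basis. (v \<bullet> b) *\<^sub>R frechet_derivative f (at x) b)"
proof -
  have "linear (frechet_derivative f (at x))"
    using assms frechet_derivative_works has_derivative_linear by blast
  then have "(\<Sum>b\<in>Basis. (v \<bullet> b) *\<^sub>R frechet_derivative f (at x) b) =
      frechet_derivative f (at x) (\<Sum>b\<in>Basis. (v \<bullet> b) *\<^sub>R b)"
    by (simp add: linear_sum linear_scale)
  then show ?thesis by (simp add: euclidean_representation)
qed

lemma c_boundedD: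
  assumes "c_bounded M N u" "compact K" "K \<subseteq> M"
  obtains K' where "compact K'" "K' \<subseteq> N" "\<forall>\<^sub>F \<epsilon> in at_right 0. u \<epsilon> ` K \<subseteq> K'"
  using assms unfolding c_bounded_def by blast

text \<open>By the chain rule the derivative of the composition along v is the sum over basis
  vectors b of (D_v f . b) times (D_b F) composed with f. The induction hypothesis is applied to D_b
  F, hence F is generalized; c-boundedness supplies the compact set on which bounds for F are
  taken.\<close>

lemma moderate_net_compose:
  assumes "open M" "open N" "moderate_net N F" "moderate_net M f" "c_bounded M N f"
    "\<And>\<epsilon> x. \<epsilon> \<in> I_eps \<Longrightarrow> x \<in> M \<Longrightarrow> f \<epsilon> x \<in> N"
  shows "moderate_net M (\<lambda>\<epsilon> x. F \<epsilon> (f \<epsilon> x))"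
proof -
  have mod0: "unif_moderate (\<lambda>_. K) (\<lambda>\<epsilon> x. F \<epsilon> (f \<epsilon> x))"
    if K: "compact K" "K \<subseteq> M" and F: "moderate_net N F" for K and F :: "real \<Rightarrow> 'b \<Rightarrow> 'c"
  proof -
    obtain K' where K': "compact K'" "K' \<subseteq> N" "\<forall>\<^sub>F \<epsilon> in at_right 0. f \<epsilon> ` K \<subseteq> K'"
      using c_boundedD[OF assms(5) K] by blast
    show ?thesis
      by (rule unif_moderate_mono[OF moderate_net_unif[OF F K'(1,2)], where j="\<lambda>\<epsilon> x. f \<epsilon> x"])
         (use K'(3) in \<open>auto elim!: eventually_mono\<close>)
  qed
  have "moderate_upto M (\<lambda>\<epsilon> x. F \<epsilon> (f \<epsilon> x)) n" for n
    using assms(3)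
  proof (induction n arbitrary: F)
    case 0
    have "continuous_on M (\<lambda>x. F \<epsilon> (f \<epsilon> x))" if e: "\<epsilon> \<in> I_eps" for \<epsilon>
      using continuous_on_compose2[OF moderate_net_continuous_on[OF 0 e]
            moderate_net_continuous_on[OF assms(4) e]] assms(6) e by blast
    then show ?case using mod0[OF _ _ 0] by simp
  next
    case (Suc n)
    have hd: "((\<lambda>x. F \<epsilon> (f \<epsilon> x)) has_derivative
        (\<lambda>v. frechet_derivative (F \<epsilon>) (at (f \<epsilon> x)) (frechet_derivative (f \<epsilon>) (at x) v))) (at x)"
      if "\<epsilon> \<in> I_eps" "x \<in> M" for \<epsilon> x
    proof (rule has_derivative_compose[of "f \<epsilon>" _ x UNIV "F \<epsilon>"])
      show "(f \<epsilon> has_derivative frechet_derivative (f \<epsilon>) (at x)) (at x)"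
        using moderate_net_differentiable[OF assms(4) that] frechet_derivative_works by blast
      show "(F \<epsilon> has_derivative frechet_derivative (F \<epsilon>) (at (f \<epsilon> x))) (at (f \<epsilon> x))"
        using moderate_net_differentiable[OF Suc.prems that(1) assms(6)[OF that]]
          frechet_derivative_works by blast
    qed
    have "moderate_upto M (\<lambda>\<epsilon> x. frechet_derivative (\<lambda>x. F \<epsilon> (f \<epsilon> x)) (at x) v) n" for v
    proof (rule moderate_upto_cong[OF assms(1)])
      have "moderate_upto M (\<lambda>\<epsilon> x. frechet_derivative (f \<epsilon>) (at x) v \<bullet> b) n" for b
        using moderate_net_linear[OF assms(1) bounded_linear_inner_left moderate_net_deriv[OF assms(4)]]
        unfolding moderate_net_def by blast
      then show "moderate_upto M (\<lambda>\<epsilon> x. \<Sum>b\<in>Basis. (frechet_derivative (f \<epsilon>) (at x) v \<bullet> b) *\<^sub>R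
          frechet_derivative (F \<epsilon>) (at (f \<epsilon> x)) b) n"
        by (intro moderate_upto_sum[OF assms(1)]
              moderate_upto_bilinear[OF assms(1) bounded_bilinear_scaleR] Suc.IH
              moderate_net_deriv[OF Suc.prems])
      fix \<epsilon> x assume *: "\<epsilon> \<in> I_eps" "x \<in> M"
      have "F \<epsilon> differentiable (at (f \<epsilon> x))"
        using moderate_net_differentiable[OF Suc.prems *(1) assms(6)[OF *]] .
      then show "(\<Sum>b\<in>Basis. (frechet_derivative (f \<epsilon>) (at x) v \<bullet> b) *\<^sub>R
          frechet_derivative (F \<epsilon>) (at (f \<epsilon> x)) b) =
          frechet_derivative (\<lambda>x. F \<epsilon> (f \<epsilon> x)) (at x) v"
        by (subst frechet_derivative_eqI[OF hd[OF *]])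
           (rule frechet_derivative_Basis_sum[symmetric])
    qed
    moreover have "(\<lambda>x. F \<epsilon> (f \<epsilon> x)) differentiable (at x)" if "\<epsilon> \<in> I_eps" "x \<in> M" for \<epsilon> x
      using hd[OF that] unfolding differentiable_def by blast
    ultimately show ?case using mod0[OF _ _ Suc.prems] by simp
  qed
  then show ?thesis unfolding moderate_net_def by blast
qed

lemma moderate_net_Pair:
  assumes "open M" "moderate_net M f" "moderate_net M g"
  shows "moderate_net M (\<lambda>\<epsilon> x. (f \<epsilon> x, g \<epsilon> x))"
proof -
  have 1: "bounded_linear (\<lambda>a::'b. (a, 0::'c))" "bounded_linear (\<lambda>b::'c. (0::'b, b))"
    by (intro bounded_linear_Pair bounded_linear_zero bounded_linear_ident)+
  show ?thesis
    using moderate_net_add[OF assms(1) moderate_net_linear[OF assms(1) 1(1) assms(2)]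
        moderate_net_linear[OF assms(1) 1(2) assms(3)]] by simp
qed

lemma moderate_net_smooth:
  assumes "smooth_on M f"
  shows "moderate_net M (\<lambda>_. f)"
proof -
  have mod: "unif_moderate (\<lambda>_. K) (\<lambda>_. f)"
    if "continuous_on M f" "compact K" "K \<subseteq> M" for f :: "'a \<Rightarrow> 'b" and K
  proof -
    have "bounded (f ` K)"
      using that by (meson compact_continuous_image compact_imp_bounded continuous_on_subset)
    then obtain C where "\<And>x. x \<in> K \<Longrightarrow> norm (f x) \<le> C" by (auto simp: bounded_iff)
    then show ?thesis unfolding unif_moderate_def unif_bigo_def
      by (intro exI[of _ 0] exI[of _ C]) auto
  qed
  have "moderate_upto M (\<lambda>_. f) n" if "higher_differentiable_on M f n" for n
    using that
  proof (induction n arbitrary: f)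
    case (Suc n)
    then have "continuous_on M f" by (auto intro!: differentiable_imp_continuous_on_at)
    with Suc mod show ?case by auto
  qed (use mod in auto)
  then show ?thesis using assms unfolding smooth_on_def moderate_net_def by blast
qed

lemma moderate_net_imp_smooth: "moderate_net M u \<Longrightarrow> \<epsilon> \<in> I_eps \<Longrightarrow> smooth_on M (u \<epsilon>)"
proof -
  assume *: "moderate_net M u" "\<epsilon> \<in> I_eps"
  have "higher_differentiable_on M (u \<epsilon>) n" if "moderate_upto M u n" for n
    using that *(2)
  proof (induction n arbitrary: u)
    case (Suc n)
    have "higher_differentiable_on M (\<lambda>x. frechet_derivative (u \<epsilon>) (at x) v) n" for v
      by (rule Suc.IH) (use Suc.prems in auto)
    then show ?case using Suc.prems by auto
  qed auto
  then show ?thesis using * unfolding smooth_on_def moderate_net_def by blast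
qed

text \<open>Seen as a net constant in \<epsilon> (any index, here 1, recovers the map), a smooth map
  is moderate because continuous functions are bounded on compact sets. Every closure rule for
  moderate nets is thereby also one for smooth maps.\<close>

lemma smooth_on_iff: "smooth_on M f \<longleftrightarrow> moderate_net M (\<lambda>_. f)"
  using moderate_net_smooth moderate_net_imp_smooth[of M "\<lambda>_. f" 1] by auto

lemma smooth_on_linear: "bounded_linear L \<Longrightarrow> smooth_on M L"
proof -
  assume L: "bounded_linear L"
  have c: "higher_differentiable_on M (\<lambda>_. c) n" for n and c :: 'b
    by (induction n arbitrary: c) auto
  have "higher_differentiable_on M L n" for n
  proof (cases n)
    case (Suc m)
    have "frechet_derivative L (at x) = L" for x
      using L by (intro frechet_derivative_eqI bounded_linear_imp_has_derivative)
    then show ?thesis using Suc c L bounded_linear_imp_differentiable by auto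
  qed (use L linear_continuous_on in auto)
  then show ?thesis unfolding smooth_on_def by blast
qed

section \<open>Iterated partial derivatives, and the Colombeau spaces in terms of moderate
  nets\<close>

lemma partials_Nil [simp]: "partials [] f = f"
  by (simp add: partials_def)

lemma partials_Cons: "partials (v # vs) f = (\<lambda>x. frechet_derivative (partials vs f) (at x) v)"
  by (simp add: partials_def)

text \<open>The last entry of the list is the derivative taken first, so inductions that peel off
  the innermost derivative split lists at the end.\<close>

lemma partials_snoc: "partials (vs @ [v]) f = partials vs (\<lambda>x. frechet_derivative f (at x) v)"
  by (simp add: partials_def)

lemma moderate_net_partials: "moderate_net M u \<Longrightarrow> moderate_net M (\<lambda>\<epsilon>. partials vs (u \<epsilon>))"
  by (induction vs) (simp_all add: partials_Cons moderate_net_deriv)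

text \<open>A derivative along v is a fixed linear combination of those along basis vectors, so
  basis directions control all of them; appending b to a list turns the bounds for u into bounds for
  its derivative along b.\<close>

lemma moderate_netI_partials:
  fixes u :: "real \<Rightarrow> 'a::euclidean_space \<Rightarrow> 'b::euclidean_space"
  assumes "open M" "\<And>\<epsilon>. \<epsilon> \<in> I_eps \<Longrightarrow> smooth_on M (u \<epsilon>)"
    "\<And>K vs. compact K \<Longrightarrow> K \<subseteq> M \<Longrightarrow> set vs \<subseteq> Basis \<Longrightarrow> unif_moderate (\<lambda>_. K) (\<lambda>\<epsilon>. partials vs (u \<epsilon>))"
  shows "moderate_net M u"
proof -
  have "moderate_upto M u n"
    if "\<And>\<epsilon>. \<epsilon> \<in> I_eps \<Longrightarrow> higher_differentiable_on M (u \<epsilon>) n"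
      "\<And>K vs. compact K \<Longrightarrow> K \<subseteq> M \<Longrightarrow> set vs \<subseteq> Basis \<Longrightarrow> unif_moderate (\<lambda>_. K) (\<lambda>\<epsilon>. partials vs (u \<epsilon>))"
    for n
    using that
  proof (induction n arbitrary: u)
    case 0
    show ?case using 0(1) 0(2)[where vs="[]"] by simp
  next
    case (Suc n)
    have diff: "u \<epsilon> differentiable (at x)" if "\<epsilon> \<in> I_eps" "x \<in> M" for \<epsilon> x
      using Suc.prems(1) that by simp
    have "moderate_upto M (\<lambda>\<epsilon> x. frechet_derivative (u \<epsilon>) (at x) b) n" if "b \<in> Basis" for b
    proof (rule Suc.IH)
      show "higher_differentiable_on M (\<lambda>x. frechet_derivative (u \<epsilon>) (at x) b) n" if "\<epsilon> \<in> I_eps" for \<epsilon>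
        using Suc.prems(1) that by simp
      show "unif_moderate (\<lambda>_. K) (\<lambda>\<epsilon>. partials vs (\<lambda>x. frechet_derivative (u \<epsilon>) (at x) b))"
        if "compact K" "K \<subseteq> M" "set vs \<subseteq> Basis" for K vs
        using Suc.prems(2)[OF that(1,2), of "vs @ [b]"] that(3) \<open>b \<in> Basis\<close> by (simp add: partials_snoc)
    qed
    then have "moderate_upto M (\<lambda>\<epsilon> x. \<Sum>b\<in>Basis. (v \<bullet> b) *\<^sub>R frechet_derivative (u \<epsilon>) (at x) b) n" for v
      by (intro moderate_upto_sum moderate_upto_linear[OF _ bounded_linear_scaleR_right] assms(1))
    then have "moderate_upto M (\<lambda>\<epsilon> x. frechet_derivative (u \<epsilon>) (at x) v) n" for v
      by (rule moderate_upto_cong[OF assms(1)])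
         (use diff in \<open>auto simp: frechet_derivative_Basis_sum[symmetric]\<close>)
    with diff Suc.prems(2)[where vs="[]"] show ?case by simp
  qed
  then show ?thesis using assms(2,3) unfolding moderate_net_def smooth_on_def by blast
qed

text \<open>One direction tests with the operator that is a single partial derivative with
  coefficient 1. In the other, the smooth coefficients of an operator are themselves moderate nets,
  constant in \<epsilon>.\<close>

lemma EM_iff:
  fixes u :: "real \<Rightarrow> 'a::euclidean_space \<Rightarrow> real"
  assumes "open M"
  shows "u \<in> EM M \<longleftrightarrow> moderate_net M u"
proof
  assume u: "u \<in> EM M"
  show "moderate_net M u"
  proof (rule moderate_netI_partials[OF assms])
    show "smooth_on M (u \<epsilon>)" if "\<epsilon> \<in> I_eps" for \<epsilon> using u that by (simp add: EM_def)
    fix K and vs :: "'a list" assume K: "compact K" "K \<subseteq> M" "set vs \<subseteq> Basis"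
    have "lin_diff_op M (\<lambda>u x. \<Sum>\<beta>\<in>{vs}. 1 * partials \<beta> u x)"
      unfolding lin_diff_op_def
      by (intro exI[of _ "{vs}"] exI[of _ "\<lambda>_ _. 1"]) (use K in \<open>auto simp: smooth_on_iff moderate_net_const\<close>)
    then have "unif_moderate (\<lambda>_. K) (\<lambda>\<epsilon> x. \<Sum>\<beta>\<in>{vs}. 1 * partials \<beta> (u \<epsilon>) x)"
      using u K unfolding EM_def by blast
    then show "unif_moderate (\<lambda>_. K) (\<lambda>\<epsilon>. partials vs (u \<epsilon>))" by simp
  qed
next
  assume u: "moderate_net M u"
  have "unif_moderate (\<lambda>_. K) (\<lambda>\<epsilon>. P (u \<epsilon>))" if "compact K" "K \<subseteq> M" "lin_diff_op M P" for K P
  proof -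
    from that(3) obtain A a where A: "\<forall>\<beta>\<in>A. smooth_on M (a \<beta>)" "P = (\<lambda>u x. \<Sum>\<beta>\<in>A. a \<beta> x * partials \<beta> u x)" unfolding lin_diff_op_def by blast
    show ?thesis unfolding A(2)
      by (intro unif_moderate_sum unif_moderate_bilinear[OF bounded_bilinear_mult]
          moderate_net_unif[OF moderate_net_smooth] moderate_net_unif[OF moderate_net_partials[OF u]])
         (use A that in auto)
  qed
  then show "u \<in> EM M" unfolding EM_def using moderate_net_imp_smooth[OF u] by blast
qed

text \<open>The coordinate functions y . b are admissible test functions, and u is recovered from
  them; conversely, a smooth test function composed with u is covered by the chain rule for moderate
  nets.\<close>

lemma EMap_iff:
  fixes u :: "real \<Rightarrow> 'a::euclidean_space \<Rightarrow> 'b::euclidean_space"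
  assumes "open M" "open N"
  shows "u \<in> EMap M N \<longleftrightarrow>
    moderate_net M u \<and> c_bounded M N u \<and> (\<forall>\<epsilon>\<in>I_eps. \<forall>x\<in>M. u \<epsilon> x \<in> N)"
proof
  assume u: "u \<in> EMap M N"
  have "moderate_net M (\<lambda>\<epsilon> x. u \<epsilon> x \<bullet> b)" for b
  proof -
    have "smooth_on N (\<lambda>y. y \<bullet> b)" by (rule smooth_on_linear[OF bounded_linear_inner_left])
    then have "(\<lambda>\<epsilon>. (\<lambda>y. y \<bullet> b) \<circ> u \<epsilon>) \<in> EM M" using u unfolding EMap_def by blast
    then show ?thesis using EM_iff[OF assms(1)] by (simp add: o_def)
  qed
  then have "moderate_net M (\<lambda>\<epsilon> x. \<Sum>b\<in>Basis. (u \<epsilon> x \<bullet> b) *\<^sub>R b)"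
    by (intro moderate_net_sum moderate_net_linear[OF _ bounded_linear_scaleR_left] assms(1))
  then show "moderate_net M u \<and> c_bounded M N u \<and> (\<forall>\<epsilon>\<in>I_eps. \<forall>x\<in>M. u \<epsilon> x \<in> N)"
    using u by (auto simp: euclidean_representation EMap_def image_subset_iff)
next
  assume u: "moderate_net M u \<and> c_bounded M N u \<and> (\<forall>\<epsilon>\<in>I_eps. \<forall>x\<in>M. u \<epsilon> x \<in> N)"
  have "(\<lambda>\<epsilon>. f \<circ> u \<epsilon>) \<in> EM M" if "smooth_on N f" for f :: "'b \<Rightarrow> real"
    unfolding EM_iff[OF assms(1)] o_def
    by (rule moderate_net_compose[OF assms moderate_net_smooth[OF that]]) (use u in auto)
  then show "u \<in> EMap M N" using u moderate_net_imp_smooth unfolding EMap_def by blast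
qed

section \<open>Negligible nets, c-bounded nets and generalized points\<close>

lemma Negl_iff:
  "open M \<Longrightarrow> u \<in> Negl M \<longleftrightarrow>
    moderate_net M u \<and> (\<forall>K. compact K \<and> K \<subseteq> M \<longrightarrow> unif_negligible (\<lambda>_. K) u)"
  unfolding Negl_def by (auto simp: EM_iff)

lemma unif_negligible_mono:
  assumes "unif_negligible A f"
    "\<forall>\<^sub>F \<epsilon> in at_right 0. \<forall>x\<in>B \<epsilon>. j \<epsilon> x \<in> A \<epsilon> \<and> norm (g \<epsilon> x) \<le> norm (f \<epsilon> (j \<epsilon> x))"
  shows "unif_negligible B g"
  unfolding unif_negligible_iff
proof
  fix k
  have "\<forall>\<^sub>F \<epsilon> in at_right 0. \<forall>x\<in>A \<epsilon>. norm (f \<epsilon> x) \<le> \<epsilon> ^ k"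
    using assms(1) unif_negligible_iff by blast
  then show "\<forall>\<^sub>F \<epsilon> in at_right 0. \<forall>x\<in>B \<epsilon>. norm (g \<epsilon> x) \<le> \<epsilon> ^ k"
    using assms(2) by eventually_elim (meson order_trans)
qed

lemma unif_negligible_add:
  assumes "unif_negligible A f" "unif_negligible A g"
  shows "unif_negligible A (\<lambda>\<epsilon> x. f \<epsilon> x + g \<epsilon> x)"
  unfolding unif_negligible_def unif_bigo_def
proof
  fix k
  have "\<forall>\<^sub>F \<epsilon> in at_right 0. \<forall>x\<in>A \<epsilon>. norm (f \<epsilon> x) \<le> \<epsilon> ^ k"
    "\<forall>\<^sub>F \<epsilon> in at_right 0. \<forall>x\<in>A \<epsilon>. norm (g \<epsilon> x) \<le> \<epsilon> ^ k"
    using assms unif_negligible_iff by blast+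
  then have "\<forall>\<^sub>F \<epsilon> in at_right 0. \<forall>x\<in>A \<epsilon>. norm (f \<epsilon> x + g \<epsilon> x) \<le> 2 * \<epsilon> ^ k"
    by eventually_elim (force intro: order_trans[OF norm_triangle_ineq])
  then show "\<exists>C. \<forall>\<^sub>F \<epsilon> in at_right 0. \<forall>x\<in>A \<epsilon>. norm (f \<epsilon> x + g \<epsilon> x) \<le> C * \<epsilon> ^ k" by blast
qed

lemma unif_negligible_zero: "unif_negligible A (\<lambda>_ _. 0)"
  unfolding unif_negligible_def unif_bigo_def by (intro allI exI[of _ 0]) simp

lemma unif_negligible_sum:
  assumes "\<And>i. i \<in> I \<Longrightarrow> unif_negligible A (f i)"
  shows "unif_negligible A (\<lambda>\<epsilon> x. \<Sum>i\<in>I. f i \<epsilon> x)"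
  using assms
proof (induction I rule: infinite_finite_induct)
  case (insert i I)
  then show ?case by (simp add: unif_negligible_add)
qed (auto intro: unif_negligible_zero)

text \<open>Tested against the coordinate functions, equality in G[M,N] gives negligible coordinate
  differences, and the sum of their absolute values dominates the norm.\<close>

lemma GMap_eq_negligible:
  fixes u :: "real \<Rightarrow> 'a::euclidean_space \<Rightarrow> 'b::euclidean_space"
  assumes "GMap_eq M N u v" "compact K" "K \<subseteq> M"
  shows "unif_negligible (\<lambda>_. K) (\<lambda>\<epsilon> x. u \<epsilon> x - v \<epsilon> x)"
proof -
  have "unif_negligible (\<lambda>_. K) (\<lambda>\<epsilon> x. u \<epsilon> x \<bullet> b - v \<epsilon> x \<bullet> b)" for b
  proof -
    have "smooth_on N (\<lambda>y. y \<bullet> b)" by (rule smooth_on_linear[OF bounded_linear_inner_left])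
    then have "(\<lambda>\<epsilon> x. u \<epsilon> x \<bullet> b - v \<epsilon> x \<bullet> b) \<in> Negl M"
      using assms(1) unfolding GMap_eq_def by blast
    then show ?thesis using assms(2,3) unfolding Negl_def by blast
  qed
  then have "unif_negligible (\<lambda>_. K) (\<lambda>\<epsilon> x. \<bar>u \<epsilon> x \<bullet> b - v \<epsilon> x \<bullet> b\<bar>)" for b
    unfolding unif_negligible_iff by simp
  then have "unif_negligible (\<lambda>_. K) (\<lambda>\<epsilon> x. \<Sum>b\<in>Basis. \<bar>u \<epsilon> x \<bullet> b - v \<epsilon> x \<bullet> b\<bar>)"
    by (intro unif_negligible_sum)
  moreover have "\<forall>\<^sub>F \<epsilon> in at_right 0. \<forall>x\<in>K. x \<in> K \<and> norm (u \<epsilon> x - v \<epsilon> x) \<le> norm (\<Sum>b\<in>Basis. \<bar>u \<epsilon> x \<bullet> b - v \<epsilon> x \<bullet> b\<bar>)"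
  proof (intro always_eventually allI ballI conjI)
    fix \<epsilon> x
    have "norm (u \<epsilon> x - v \<epsilon> x) \<le> (\<Sum>b\<in>Basis. \<bar>u \<epsilon> x \<bullet> b - v \<epsilon> x \<bullet> b\<bar>)"
      using norm_le_l1[of "u \<epsilon> x - v \<epsilon> x"] unfolding inner_diff_left .
    also have "\<dots> \<le> norm \<dots>" by (rule order_trans[OF abs_ge_self]) simp
    finally show "norm (u \<epsilon> x - v \<epsilon> x) \<le> norm (\<Sum>b\<in>Basis. \<bar>u \<epsilon> x \<bullet> b - v \<epsilon> x \<bullet> b\<bar>)" .
  qed
  ultimately show ?thesis
    by (rule unif_negligible_mono[where j="\<lambda>_ x. x"])
qed

lemma c_bounded_compose:
  "c_bounded N P F \<Longrightarrow> c_bounded M N f \<Longrightarrow> c_bounded M P (\<lambda>\<epsilon> x. F \<epsilon> (f \<epsilon> x))"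
  unfolding c_bounded_def
proof (intro allI impI)
  fix K assume F: "\<forall>K. compact K \<and> K \<subseteq> N \<longrightarrow> (\<exists>K'. compact K' \<and> K' \<subseteq> P \<and> (\<forall>\<^sub>F \<epsilon> in at_right 0. F \<epsilon> ` K \<subseteq> K'))"
    and f: "\<forall>K. compact K \<and> K \<subseteq> M \<longrightarrow> (\<exists>K'. compact K' \<and> K' \<subseteq> N \<and> (\<forall>\<^sub>F \<epsilon> in at_right 0. f \<epsilon> ` K \<subseteq> K'))"
    and K: "compact K \<and> K \<subseteq> M"
  obtain K1 where 1: "compact K1" "K1 \<subseteq> N" "\<forall>\<^sub>F \<epsilon> in at_right 0. f \<epsilon> ` K \<subseteq> K1" using f K by blast
  obtain K2 where 2: "compact K2" "K2 \<subseteq> P" "\<forall>\<^sub>F \<epsilon> in at_right 0. F \<epsilon> ` K1 \<subseteq> K2" using F 1 by blast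
  have "\<forall>\<^sub>F \<epsilon> in at_right 0. (\<lambda>x. F \<epsilon> (f \<epsilon> x)) ` K \<subseteq> K2" using 1(3) 2(3) by eventually_elim auto
  then show "\<exists>K'. compact K' \<and> K' \<subseteq> P \<and> (\<forall>\<^sub>F \<epsilon> in at_right 0. (\<lambda>x. F \<epsilon> (f \<epsilon> x)) ` K \<subseteq> K')"
    using 2 by blast
qed

lemma c_bounded_Pair:
  "c_bounded M N f \<Longrightarrow> c_bounded M N' g \<Longrightarrow> c_bounded M (N \<times> N') (\<lambda>\<epsilon> x. (f \<epsilon> x, g \<epsilon> x))"
  unfolding c_bounded_def
proof (intro allI impI)
  fix K assume f: "\<forall>K. compact K \<and> K \<subseteq> M \<longrightarrow> (\<exists>K'. compact K' \<and> K' \<subseteq> N \<and> (\<forall>\<^sub>F \<epsilon> in at_right 0. f \<epsilon> ` K \<subseteq> K'))"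
    and g: "\<forall>K. compact K \<and> K \<subseteq> M \<longrightarrow> (\<exists>K'. compact K' \<and> K' \<subseteq> N' \<and> (\<forall>\<^sub>F \<epsilon> in at_right 0. g \<epsilon> ` K \<subseteq> K'))"
    and K: "compact K \<and> K \<subseteq> M"
  obtain K1 where 1: "compact K1" "K1 \<subseteq> N" "\<forall>\<^sub>F \<epsilon> in at_right 0. f \<epsilon> ` K \<subseteq> K1" using f K by blast
  obtain K2 where 2: "compact K2" "K2 \<subseteq> N'" "\<forall>\<^sub>F \<epsilon> in at_right 0. g \<epsilon> ` K \<subseteq> K2" using g K by blast
  have "\<forall>\<^sub>F \<epsilon> in at_right 0. (\<lambda>x. (f \<epsilon> x, g \<epsilon> x)) ` K \<subseteq> K1 \<times> K2" using 1(3) 2(3) by eventually_elim auto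
  moreover have "compact (K1 \<times> K2)" "K1 \<times> K2 \<subseteq> N \<times> N'" using 1 2 by (auto intro: compact_Times)
  ultimately show "\<exists>K'. compact K' \<and> K' \<subseteq> N \<times> N' \<and> (\<forall>\<^sub>F \<epsilon> in at_right 0. (\<lambda>x. (f \<epsilon> x, g \<epsilon> x)) ` K \<subseteq> K')"
    by blast
qed

lemma c_bounded_continuous:
  "continuous_on M f \<Longrightarrow> f ` M \<subseteq> N \<Longrightarrow> c_bounded M N (\<lambda>_. f)"
  unfolding c_bounded_def
  by (metis (no_types, lifting) compact_continuous_image continuous_on_subset eventually_mono
      always_eventually image_mono order_refl order_trans)

lemma c_bounded_gen_pt: "gen_pt N c \<Longrightarrow> c_bounded M N (\<lambda>\<epsilon> _. c \<epsilon>)"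
  unfolding c_bounded_def gen_pt_def by (auto elim!: eventually_mono)

lemma moderate_net_gen_pt: "gen_pt N c \<Longrightarrow> moderate_net M (\<lambda>\<epsilon> _. c \<epsilon>)"
proof -
  assume "gen_pt N c"
  then obtain K where K: "compact K" "\<forall>\<^sub>F \<epsilon> in at_right 0. c \<epsilon> \<in> K" unfolding gen_pt_def by blast
  obtain C where "\<And>x. x \<in> K \<Longrightarrow> norm x \<le> C" using compact_imp_bounded[OF K(1)] by (auto simp: bounded_iff)
  with K(2) have "\<forall>\<^sub>F \<epsilon> in at_right 0. norm (c \<epsilon>) \<le> C" by (auto elim!: eventually_mono)
  then have "unif_moderate (\<lambda>_. A) (\<lambda>\<epsilon> _. c \<epsilon>)" for A
    unfolding unif_moderate_def unif_bigo_def by (intro exI[of _ 0] exI[of _ C]) (auto elim: eventually_mono)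
  then show ?thesis unfolding moderate_net_def by (blast intro: moderate_upto_const_net)
qed

section \<open>Quantitative differential calculus for moderate nets\<close>

text \<open>Moderateness bounds derivatives one direction at a time; this inequality turns bounds on
  the finitely many basis directions into one for the whole linear map.\<close>

lemma norm_linear_le_Basis:
  fixes L :: "'a::euclidean_space \<Rightarrow> 'b::real_normed_vector"
  assumes "linear L"
  shows "norm (L v) \<le> norm v * (\<Sum>b\<in>Basis. norm (L b))"
proof -
  have "L v = L (\<Sum>b\<in>Basis. (v \<bullet> b) *\<^sub>R b)" by (simp add: euclidean_representation)
  also have "\<dots> = (\<Sum>b\<in>Basis. (v \<bullet> b) *\<^sub>R L b)" using assms by (simp add: linear_sum linear_scale)
  also have "norm \<dots> \<le> (\<Sum>b\<in>Basis. norm v * norm (L b))"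
    by (rule order_trans[OF norm_sum], rule sum_mono) (simp add: Basis_le_norm mult_right_mono)
  finally show ?thesis by (simp add: sum_distrib_left)
qed

lemma unif_moderate_norm: "unif_moderate A f \<Longrightarrow> unif_moderate A (\<lambda>\<epsilon> x. norm (f \<epsilon> x))"
  by (rule unif_moderate_mono[where j="\<lambda>_ x. x"]) auto

lemma moderate_net_frechet:
  fixes u :: "real \<Rightarrow> 'a::euclidean_space \<Rightarrow> 'b::euclidean_space"
  assumes "moderate_net M u" "compact K" "K \<subseteq> M"
  obtains N where "\<forall>\<^sub>F \<epsilon> in at_right 0. \<forall>x\<in>K. \<forall>v. norm (frechet_derivative (u \<epsilon>) (at x) v) \<le> norm v * inverse (\<epsilon> ^ N)"
proof -
  have "unif_moderate (\<lambda>_. K) (\<lambda>\<epsilon> x. \<Sum>b\<in>Basis. norm (frechet_derivative (u \<epsilon>) (at x) b))"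
    by (intro unif_moderate_sum unif_moderate_norm moderate_net_unif[OF moderate_net_deriv[OF assms(1)]] assms)
  then obtain N where N: "\<forall>\<^sub>F \<epsilon> in at_right 0. \<forall>x\<in>K.
      norm (\<Sum>b\<in>Basis. norm (frechet_derivative (u \<epsilon>) (at x) b)) \<le> inverse (\<epsilon> ^ N)"
    unfolding unif_moderate_iff by blast
  have "\<forall>\<^sub>F \<epsilon> in at_right 0. \<forall>x\<in>K. \<forall>v. norm (frechet_derivative (u \<epsilon>) (at x) v) \<le> norm v * inverse (\<epsilon> ^ N)"
    using N eventually_I_eps
  proof eventually_elim
    case (elim \<epsilon>)
    show ?case
    proof (intro ballI allI)
      fix x v assume "x \<in> K"
      then have "linear (frechet_derivative (u \<epsilon>) (at x))"
        using moderate_net_differentiable[OF assms(1) elim(2)] assms(3) frechet_derivative_works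
          has_derivative_linear by blast
      from norm_linear_le_Basis[OF this, of v]
      show "norm (frechet_derivative (u \<epsilon>) (at x) v) \<le> norm v * inverse (\<epsilon> ^ N)"
      proof (rule order_trans, intro mult_left_mono)
        show "(\<Sum>b\<in>Basis. norm (frechet_derivative (u \<epsilon>) (at x) b)) \<le> inverse (\<epsilon> ^ N)"
          using elim(1) \<open>x \<in> K\<close> abs_ge_self order_trans unfolding real_norm_def by blast
      qed simp
    qed
  qed
  then show thesis by (rule that)
qed

lemma norm_divideR_le_iff: "0 < r \<Longrightarrow> norm (a /\<^sub>R r) \<le> c \<longleftrightarrow> norm a \<le> c * r"
  by (simp add: pos_divide_le_eq divide_inverse_commute[symmetric])

text \<open>The mean value inequality on the segment. Writing the bound as moderateness of
  difference quotients on pairs lets the Taylor estimate sum finitely many of them; for x = y the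
  quotient is 0.\<close>

lemma moderate_net_lipschitz:
  fixes u :: "real \<Rightarrow> 'a::euclidean_space \<Rightarrow> 'b::euclidean_space"
  assumes "moderate_net M u" "compact K" "K \<subseteq> M"
  shows "unif_moderate (\<lambda>_. {(x, y). closed_segment x y \<subseteq> K})
    (\<lambda>\<epsilon> (x, y). (u \<epsilon> x - u \<epsilon> y) /\<^sub>R norm (x - y))"
proof -
  obtain N where "\<forall>\<^sub>F \<epsilon> in at_right 0. \<forall>x\<in>K. \<forall>v.
      norm (frechet_derivative (u \<epsilon>) (at x) v) \<le> norm v * inverse (\<epsilon> ^ N)"
    using moderate_net_frechet[OF assms] by blast
  then have "\<forall>\<^sub>F \<epsilon> in at_right 0. \<forall>z\<in>{(x, y). closed_segment x y \<subseteq> K}.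
      norm (case z of (x, y) \<Rightarrow> (u \<epsilon> x - u \<epsilon> y) /\<^sub>R norm (x - y)) \<le> inverse (\<epsilon> ^ N)"
    using eventually_I_eps
  proof eventually_elim
    case (elim \<epsilon>)
    have "norm ((u \<epsilon> x - u \<epsilon> y) /\<^sub>R norm (x - y)) \<le> inverse (\<epsilon> ^ N)" if "closed_segment x y \<subseteq> K" for x y
    proof -
      have "norm (u \<epsilon> x - u \<epsilon> y) \<le> inverse (\<epsilon> ^ N) * norm (x - y)"
      proof (rule differentiable_bound[where S="closed_segment x y"])
        show "(u \<epsilon> has_derivative frechet_derivative (u \<epsilon>) (at z)) (at z within closed_segment x y)"
          if "z \<in> closed_segment x y" for z
          using that \<open>closed_segment x y \<subseteq> K\<close> moderate_net_differentiable[OF assms(1) elim(2)] assms(3)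
          by (meson frechet_derivative_works has_derivative_at_withinI subsetD)
        show "onorm (frechet_derivative (u \<epsilon>) (at z)) \<le> inverse (\<epsilon> ^ N)"
          if "z \<in> closed_segment x y" for z
          by (rule onorm_bound) (use elim that \<open>closed_segment x y \<subseteq> K\<close> in \<open>auto simp: mult.commute\<close>)
      qed auto
      then show ?thesis
        using elim(2) norm_divideR_le_iff[of "norm (x - y)" "u \<epsilon> x - u \<epsilon> y"] by (cases "x = y") (simp, force)
    qed
    then show ?case by auto
  qed
  then show ?thesis unfolding unif_moderate_iff by (rule exI)
qed

lemma moderate_net_lipschitzE:
  fixes u :: "real \<Rightarrow> 'a::euclidean_space \<Rightarrow> 'b::euclidean_space"
  assumes "moderate_net M u" "compact K" "K \<subseteq> M"
  obtains N where "\<forall>\<^sub>F \<epsilon> in at_right 0. \<forall>x y. closed_segment x y \<subseteq> K \<longrightarrow>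
    norm (u \<epsilon> x - u \<epsilon> y) \<le> inverse (\<epsilon> ^ N) * norm (x - y)"
proof -
  obtain N where N: "\<forall>\<^sub>F \<epsilon> in at_right 0. \<forall>z\<in>{(x, y). closed_segment x y \<subseteq> K}.
      norm (case z of (x, y) \<Rightarrow> (u \<epsilon> x - u \<epsilon> y) /\<^sub>R norm (x - y)) \<le> inverse (\<epsilon> ^ N)"
    using moderate_net_lipschitz[OF assms] unfolding unif_moderate_iff by blast
  have "\<forall>\<^sub>F \<epsilon> in at_right 0. \<forall>x y. closed_segment x y \<subseteq> K \<longrightarrow>
      norm (u \<epsilon> x - u \<epsilon> y) \<le> inverse (\<epsilon> ^ N) * norm (x - y)"
    using N
  proof eventually_elim
    case (elim \<epsilon>)
    show ?case
    proof (intro allI impI)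
      fix x y assume "closed_segment x y \<subseteq> K"
      then have "norm ((u \<epsilon> x - u \<epsilon> y) /\<^sub>R norm (x - y)) \<le> inverse (\<epsilon> ^ N)"
        using elim by (auto dest!: bspec[of _ _ "(x, y)"])
      then show "norm (u \<epsilon> x - u \<epsilon> y) \<le> inverse (\<epsilon> ^ N) * norm (x - y)"
        using norm_divideR_le_iff[of "norm (x - y)" "u \<epsilon> x - u \<epsilon> y"] by (cases "x = y") (simp, force)
    qed
  qed
  then show thesis by (rule that)
qed

text \<open>The quadratic remainder comes from the Lipschitz bound for the first derivatives: along
  the segment the derivative changes by at most \<epsilon>^-N |v|, and the mean value inequality for
  u minus its linear part adds the second factor |v|.\<close>

lemma moderate_net_taylor:
  fixes u :: "real \<Rightarrow> 'a::euclidean_space \<Rightarrow> 'b::euclidean_space"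
  assumes "moderate_net M u" "compact K" "K \<subseteq> M"
  obtains N where "\<forall>\<^sub>F \<epsilon> in at_right 0. \<forall>x v. closed_segment x (x + v) \<subseteq> K \<longrightarrow>
    norm (u \<epsilon> (x + v) - u \<epsilon> x - frechet_derivative (u \<epsilon>) (at x) v) \<le> inverse (\<epsilon> ^ N) * (norm v)\<^sup>2"
proof -
  let ?S = "{(x, y). closed_segment x y \<subseteq> K}"
  let ?d = "\<lambda>\<epsilon> b x. frechet_derivative (u \<epsilon>) (at x) b"
  have "unif_moderate (\<lambda>_. ?S) (\<lambda>\<epsilon> z. \<Sum>b\<in>Basis. norm (case z of (x, y) \<Rightarrow> (?d \<epsilon> b x - ?d \<epsilon> b y) /\<^sub>R norm (x - y)))"
    by (intro unif_moderate_sum unif_moderate_norm moderate_net_lipschitz[OF moderate_net_deriv[OF assms(1)]] assms)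
  then obtain N where N: "\<forall>\<^sub>F \<epsilon> in at_right 0. \<forall>z\<in>?S.
      norm (\<Sum>b\<in>Basis. norm (case z of (x, y) \<Rightarrow> (?d \<epsilon> b x - ?d \<epsilon> b y) /\<^sub>R norm (x - y))) \<le> inverse (\<epsilon> ^ N)"
    unfolding unif_moderate_iff by blast
  have "\<forall>\<^sub>F \<epsilon> in at_right 0. \<forall>x v. closed_segment x (x + v) \<subseteq> K \<longrightarrow>
    norm (u \<epsilon> (x + v) - u \<epsilon> x - frechet_derivative (u \<epsilon>) (at x) v) \<le> inverse (\<epsilon> ^ N) * (norm v)\<^sup>2"
    using N eventually_I_eps
  proof eventually_elim
    case (elim \<epsilon>)
    show ?case
    proof (intro allI impI)
      fix x v assume K: "closed_segment x (x + v) \<subseteq> K"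
      have hd: "(u \<epsilon> has_derivative frechet_derivative (u \<epsilon>) (at z)) (at z)" if "z \<in> closed_segment x (x + v)" for z
        using that K moderate_net_differentiable[OF assms(1) elim(2)] assms(3)
        by (meson frechet_derivative_works subsetD)
      have lin: "linear (\<lambda>w. ?d \<epsilon> w z - ?d \<epsilon> w x)" if "z \<in> closed_segment x (x + v)" for z
        by (intro linear_compose_sub has_derivative_linear[OF hd] that ends_in_segment)
      have *: "norm (?d \<epsilon> w z - ?d \<epsilon> w x) \<le> (norm v * inverse (\<epsilon> ^ N)) * norm w"
        if z: "z \<in> closed_segment x (x + v)" for z w
      proof -
        have "closed_segment z x \<subseteq> K"
          using z K by (metis closed_segment_commute ends_in_segment(1) subset_closed_segment subset_trans)
        then have "norm (\<Sum>b\<in>Basis. norm ((?d \<epsilon> b z - ?d \<epsilon> b x) /\<^sub>R norm (z - x))) \<le> inverse (\<epsilon> ^ N)"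
          using bspec[OF elim(1), of "(z, x)"] by simp
        then have "(\<Sum>b\<in>Basis. norm (?d \<epsilon> b z - ?d \<epsilon> b x)) / norm (z - x) \<le> inverse (\<epsilon> ^ N)"
          by (simp add: sum_nonneg sum_distrib_left[symmetric] divide_inverse mult.commute)
        then have "(\<Sum>b\<in>Basis. norm (?d \<epsilon> b z - ?d \<epsilon> b x)) \<le> norm (z - x) * inverse (\<epsilon> ^ N)"
          by (cases "z = x") (auto simp: divide_simps mult.commute)
        also have "\<dots> \<le> norm v * inverse (\<epsilon> ^ N)"
          using segment_bound(1)[OF z] elim(2) by (intro mult_right_mono) auto
        finally have "(\<Sum>b\<in>Basis. norm (?d \<epsilon> b z - ?d \<epsilon> b x)) \<le> norm v * inverse (\<epsilon> ^ N)" .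
        from order_trans[OF norm_linear_le_Basis[OF lin[OF z], of w] mult_left_mono[OF this norm_ge_zero]]
        show ?thesis by (simp add: mult_ac)
      qed
      have "norm (u \<epsilon> (x + v) - u \<epsilon> x - frechet_derivative (u \<epsilon>) (at x) (x + v - x))
          \<le> norm (x + v - x) * (norm v * inverse (\<epsilon> ^ N))"
      proof (rule differentiable_bound_linearization[where S="closed_segment x (x + v)"])
        show "x + t *\<^sub>R (x + v - x) \<in> closed_segment x (x + v)" if "t \<in> {0..1}" for t
          using that by (auto simp: in_segment algebra_simps intro!: exI[of _ t])
        show "(u \<epsilon> has_derivative frechet_derivative (u \<epsilon>) (at z)) (at z within closed_segment x (x + v))"
          if "z \<in> closed_segment x (x + v)" for z
          using hd[OF that] has_derivative_at_withinI by blast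
        show "onorm (frechet_derivative (u \<epsilon>) (at z) - frechet_derivative (u \<epsilon>) (at x)) \<le> norm v * inverse (\<epsilon> ^ N)"
          if "z \<in> closed_segment x (x + v)" for z
          by (rule onorm_bound) (use * that elim(2) in auto)
      qed auto
      then show "norm (u \<epsilon> (x + v) - u \<epsilon> x - frechet_derivative (u \<epsilon>) (at x) v) \<le> inverse (\<epsilon> ^ N) * (norm v)\<^sup>2"
        by (simp add: power2_eq_square mult_ac)
    qed
  qed
  then show thesis by (rule that)
qed

section \<open>Symmetry of second derivatives\<close>

lemma has_real_derivative_along_line:
  fixes F :: "'a::euclidean_space \<Rightarrow> real"
  assumes "F differentiable (at (a + s *\<^sub>R v))"
  shows "((\<lambda>s. F (a + s *\<^sub>R v)) has_real_derivative frechet_derivative F (at (a + s *\<^sub>R v)) v) (at s)"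
proof -
  have "((\<lambda>s. a + s *\<^sub>R v) has_derivative (\<lambda>h. h *\<^sub>R v)) (at s)"
    by (auto intro!: derivative_eq_intros)
  moreover have "(F has_derivative frechet_derivative F (at (a + s *\<^sub>R v))) (at (a + s *\<^sub>R v))"
    using assms frechet_derivative_works by blast
  ultimately have "((\<lambda>s. F (a + s *\<^sub>R v)) has_derivative
      (\<lambda>h. frechet_derivative F (at (a + s *\<^sub>R v)) (h *\<^sub>R v))) (at s)"
    by (rule has_derivative_compose)
  moreover have lin: "linear (frechet_derivative F (at (a + s *\<^sub>R v)))"
    using assms frechet_derivative_works has_derivative_linear by blast
  have "(\<lambda>h. frechet_derivative F (at (a + s *\<^sub>R v)) (h *\<^sub>R v)) =
      (*) (frechet_derivative F (at (a + s *\<^sub>R v)) v)"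
    by (rule ext) (simp only: linear_scale[OF lin] real_scaleR_def mult.commute)
  ultimately show ?thesis
    unfolding has_field_derivative_def by simp
qed

text \<open>Two mean value theorems: first along v, for the difference of F at x + h w + s v and at
  x + s v, then along w for the resulting difference of derivatives. The left side is symmetric in v
  and w while the right side is not, which is what the next results exploit.\<close>

lemma second_difference:
  fixes F :: "'a::euclidean_space \<Rightarrow> real"
  assumes F: "\<And>x. F differentiable (at x)" "\<And>x. (\<lambda>x. frechet_derivative F (at x) v) differentiable (at x)"
    and h: "h > 0"
  obtains p where "dist p x \<le> h * (norm v + norm w)"
    "F (x + h *\<^sub>R v + h *\<^sub>R w) - F (x + h *\<^sub>R v) - F (x + h *\<^sub>R w) + F x =
      h\<^sup>2 * frechet_derivative (\<lambda>x. frechet_derivative F (at x) v) (at p) w"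
proof -
  let ?G = "\<lambda>x. frechet_derivative F (at x) v"
  have "\<exists>s>0. s < h \<and> (F (x + h *\<^sub>R w + h *\<^sub>R v) - F (x + h *\<^sub>R v)) -
      (F (x + h *\<^sub>R w + 0 *\<^sub>R v) - F (x + 0 *\<^sub>R v)) =
      (h - 0) * (?G (x + h *\<^sub>R w + s *\<^sub>R v) - ?G (x + s *\<^sub>R v))"
    by (rule MVT2[OF h]) (intro DERIV_diff has_real_derivative_along_line F)
  then obtain s where s: "0 < s" "s < h" and eq: "F (x + h *\<^sub>R w + h *\<^sub>R v) - F (x + h *\<^sub>R v) -
      (F (x + h *\<^sub>R w) - F x) = h * (?G (x + s *\<^sub>R v + h *\<^sub>R w) - ?G (x + s *\<^sub>R v))"
    by (auto simp: ac_simps)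
  have "\<exists>r>0. r < h \<and> ?G (x + s *\<^sub>R v + h *\<^sub>R w) - ?G (x + s *\<^sub>R v + 0 *\<^sub>R w) =
      (h - 0) * frechet_derivative ?G (at (x + s *\<^sub>R v + r *\<^sub>R w)) w"
    by (rule MVT2[OF h]) (intro has_real_derivative_along_line F)
  then obtain r where r: "0 < r" "r < h" "?G (x + s *\<^sub>R v + h *\<^sub>R w) - ?G (x + s *\<^sub>R v) =
      h * frechet_derivative ?G (at (x + s *\<^sub>R v + r *\<^sub>R w)) w"
    by auto
  have "norm (s *\<^sub>R v + r *\<^sub>R w) \<le> s * norm v + r * norm w"
    using norm_triangle_ineq[of "s *\<^sub>R v" "r *\<^sub>R w"] s r by simp
  also have "\<dots> \<le> h * norm v + h * norm w"
    using s r by (intro add_mono mult_right_mono) auto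
  finally have "dist (x + s *\<^sub>R v + r *\<^sub>R w) x \<le> h * (norm v + norm w)"
    by (simp add: dist_norm algebra_simps)
  moreover have "F (x + h *\<^sub>R v + h *\<^sub>R w) - F (x + h *\<^sub>R v) - F (x + h *\<^sub>R w) + F x =
      h\<^sup>2 * frechet_derivative ?G (at (x + s *\<^sub>R v + r *\<^sub>R w)) w"
    using eq unfolding r(3) by (simp add: algebra_simps power2_eq_square)
  ultimately show thesis using that by blast
qed

lemma smooth_on_deriv: "smooth_on M f \<Longrightarrow> smooth_on M (\<lambda>x. frechet_derivative f (at x) v)"
  unfolding smooth_on_def using higher_differentiable_on.simps(2) by blast

lemma smooth_on_differentiable: "smooth_on M f \<Longrightarrow> x \<in> M \<Longrightarrow> f differentiable (at x)"
  unfolding smooth_on_def using higher_differentiable_on.simps(2) by blast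

lemma smooth_on_continuous_on: "smooth_on M f \<Longrightarrow> continuous_on M f"
  unfolding smooth_on_def using higher_differentiable_on.simps(1) by blast

text \<open>The second difference is symmetric in v and w, and divided by h^2 it equals each of the
  mixed derivatives at some point within O(h) of x; continuity of both derivatives closes the gap as
  h shrinks.\<close>

lemma symmetric_second_derivative_real:
  fixes F :: "'a::euclidean_space \<Rightarrow> real"
  assumes "smooth_on UNIV F"
  shows "frechet_derivative (\<lambda>x. frechet_derivative F (at x) v) (at x) w =
    frechet_derivative (\<lambda>x. frechet_derivative F (at x) w) (at x) v"
proof -
  define G where "G = (\<lambda>y. frechet_derivative (\<lambda>x. frechet_derivative F (at x) v) (at y) w)"
  define H where "H = (\<lambda>y. frechet_derivative (\<lambda>x. frechet_derivative F (at x) w) (at y) v)"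
  note diff = smooth_on_differentiable[OF assms UNIV_I]
    smooth_on_differentiable[OF smooth_on_deriv[OF assms] UNIV_I]
  have cont: "continuous_on UNIV G" "continuous_on UNIV H"
    unfolding G_def H_def by (intro smooth_on_continuous_on smooth_on_deriv assms)+
  have close: "\<bar>G x - H x\<bar> < e" if "e > 0" for e
  proof -
    obtain d1 where d1: "d1 > 0" "\<And>y. dist y x < d1 \<Longrightarrow> dist (G y) (G x) < e / 2"
      using cont(1)[unfolded continuous_on_iff, rule_format, of x "e / 2"] \<open>e > 0\<close> by auto
    obtain d2 where d2: "d2 > 0" "\<And>y. dist y x < d2 \<Longrightarrow> dist (H y) (H x) < e / 2"
      using cont(2)[unfolded continuous_on_iff, rule_format, of x "e / 2"] \<open>e > 0\<close> by auto
    \<comment> \<open>The summand 1 keeps the denominator positive and makes h (|v| + |w|) strictly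
      smaller than both radii.\<close>
    define h where "h = min d1 d2 / (norm v + norm w + 1)"
    have h: "h > 0" "h * (norm v + norm w) < min d1 d2"
    proof -
      have "norm v + norm w + 1 > 0" by (intro add_nonneg_pos add_nonneg_nonneg) auto
      then show "h > 0" using d1(1) d2(1) unfolding h_def by simp
      moreover have "h * (norm v + norm w + 1) = min d1 d2"
        using \<open>norm v + norm w + 1 > 0\<close> unfolding h_def by simp
      ultimately show "h * (norm v + norm w) < min d1 d2" by (simp only: distrib_left)
    qed
    obtain p where p: "dist p x \<le> h * (norm v + norm w)"
      "F (x + h *\<^sub>R v + h *\<^sub>R w) - F (x + h *\<^sub>R v) - F (x + h *\<^sub>R w) + F x = h\<^sup>2 * G p"
      using second_difference[OF diff h(1), of x v w] unfolding G_def by blast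
    obtain q where q: "dist q x \<le> h * (norm w + norm v)"
      "F (x + h *\<^sub>R w + h *\<^sub>R v) - F (x + h *\<^sub>R w) - F (x + h *\<^sub>R v) + F x = h\<^sup>2 * H q"
      using second_difference[OF diff h(1), of x w v] unfolding H_def by blast
    have "h\<^sup>2 * G p = h\<^sup>2 * H q" using p(2) q(2) by (simp add: algebra_simps)
    then have "G p = H q" using h(1) by simp
    moreover have "dist (G p) (G x) < e / 2" "dist (H q) (H x) < e / 2"
      using d1(2)[of p] d2(2)[of q] p(1) q(1) h(2) by (auto simp: add.commute)
    ultimately show ?thesis unfolding dist_real_def by linarith
  qed
  \<comment> \<open>If the values differed, the gap itself could be taken as e, giving e <
    e.\<close>
  have "G x = H x" using close[of "\<bar>G x - H x\<bar>"] by (cases "G x = H x") auto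
  then show ?thesis by (simp add: G_def H_def)
qed

lemma frechet_derivative_linear_compose:
  assumes "bounded_linear L" "f differentiable (at x)"
  shows "frechet_derivative (\<lambda>x. L (f x)) (at x) v = L (frechet_derivative f (at x) v)"
  using frechet_derivative_eqI[OF bounded_linear.has_derivative[OF assms(1)
        assms(2)[unfolded frechet_derivative_works]]] by simp

lemma symmetric_second_derivative:
  fixes f :: "'a::euclidean_space \<Rightarrow> 'b::euclidean_space"
  assumes "smooth_on UNIV f"
  shows "frechet_derivative (\<lambda>x. frechet_derivative f (at x) v) (at x) w =
    frechet_derivative (\<lambda>x. frechet_derivative f (at x) w) (at x) v"
proof (rule euclidean_eqI)
  fix b :: 'b
  let ?F = "\<lambda>x. f x \<bullet> b"
  have "smooth_on UNIV ?F"
    unfolding smooth_on_iff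
    by (rule moderate_net_linear[OF open_UNIV bounded_linear_inner_left moderate_net_smooth[OF assms]])
  moreover have 1: "frechet_derivative ?F (at x) v = frechet_derivative f (at x) v \<bullet> b" for x v
    using frechet_derivative_linear_compose[OF bounded_linear_inner_left smooth_on_differentiable[OF assms UNIV_I]] .
  moreover have "frechet_derivative (\<lambda>x. frechet_derivative f (at x) v \<bullet> b) (at x) w =
      frechet_derivative (\<lambda>x. frechet_derivative f (at x) v) (at x) w \<bullet> b" for v w
    using frechet_derivative_linear_compose[OF bounded_linear_inner_left
        smooth_on_differentiable[OF smooth_on_deriv[OF assms] UNIV_I]] .
  ultimately show "frechet_derivative (\<lambda>x. frechet_derivative f (at x) v) (at x) w \<bullet> b =
    frechet_derivative (\<lambda>x. frechet_derivative f (at x) w) (at x) v \<bullet> b"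
    using symmetric_second_derivative_real[of ?F v x w] by simp
qed

section \<open>Discrete shadowing of a flow\<close>

text \<open>The argument at a fixed \<epsilon>. Here a bounds the defects of the identity and of the
  group law, b the distance from F(h,x) back to S, c that distance after transport by F, and r how
  near the true trajectory a point must lie for the next step to be possible.\<close>

lemma euler_shadowing:
  fixes F :: "real \<times> 'a::real_normed_vector \<Rightarrow> 'a" and n :: nat
  assumes zero: "\<And>x. x \<in> S \<Longrightarrow> norm (F (0, x) - x) \<le> a"
    and grp: "\<And>x i. x \<in> S \<Longrightarrow> i < n \<Longrightarrow> norm (F (real (Suc i) * h, x) - F (real i * h, F (h, x))) \<le> a"
    and lip: "\<And>x x' i. x \<in> S \<Longrightarrow> x' \<in> S \<Longrightarrow> i \<le> n \<Longrightarrow> norm (x' - F (h, x)) \<le> b \<Longrightarrow>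
      norm (F (real i * h, x') - F (real i * h, F (h, x))) \<le> c"
    and step: "\<And>x j. x \<in> S \<Longrightarrow> j \<le> n \<Longrightarrow> norm (x - F (real j * h, z)) \<le> r \<Longrightarrow>
      \<exists>x'\<in>S. norm (x' - F (h, x)) \<le> b"
    and x0: "x0 \<in> S" "\<And>j. j \<le> n \<Longrightarrow> norm (F (real j * h, x0) - F (real j * h, z)) \<le> a"
    and bound: "real n * (a + c) + 2 * a \<le> r" "0 \<le> a" "0 \<le> c"
  shows "\<exists>x\<in>S. norm (x - F (real n * h, z)) \<le> real n * (a + c) + 2 * a"
proof -
  \<comment> \<open>The invariant compares the whole remaining future of the two points, not just
    their present distance. A new error b is therefore transported to each later time by one
    application of F, at cost c, and is never carried through the intermediate steps; so the errors
    add.\<close>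
  have inv: "\<exists>x\<in>S. \<forall>i\<le>n - j. norm (F (real i * h, x) - F (real (i + j) * h, z)) \<le> a + real j * (a + c)"
    if "j \<le> n" for j
    using that
  proof (induction j)
    case 0
    then show ?case using x0 by auto
  next
    case (Suc j)
    then obtain x where x: "x \<in> S" and
      IH: "\<And>i. i \<le> n - j \<Longrightarrow> norm (F (real i * h, x) - F (real (i + j) * h, z)) \<le> a + real j * (a + c)"
      by auto
    \<comment> \<open>At i = 0 the invariant controls the present distance, up to the defect of
      F(0,x) = x; this accounts for the second a in the bound.\<close>
    have "norm (x - F (real j * h, z)) \<le> norm (F (0, x) - x) + norm (F (0, x) - F (real j * h, z))"
      using norm_triangle_ineq4[of "F (0, x) - F (real j * h, z)" "F (0, x) - x"] by simp
    also have "\<dots> \<le> a + (a + real j * (a + c))"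
      using zero[OF x] IH[of 0] by (intro add_mono) auto
    also have "\<dots> \<le> real n * (a + c) + 2 * a"
      using Suc.prems bound mult_right_mono[of "real j" "real n" "a + c"] by simp
    finally have "norm (x - F (real j * h, z)) \<le> r" using bound(1) by simp
    then obtain x' where x': "x' \<in> S" "norm (x' - F (h, x)) \<le> b"
      using step[OF x, of j] Suc.prems by auto
    have "norm (F (real i * h, x') - F (real (i + Suc j) * h, z)) \<le> a + real (Suc j) * (a + c)"
      if i: "i \<le> n - Suc j" for i
    proof -
      have "norm (F (real i * h, x') - F (real i * h, F (h, x))) \<le> c"
        by (rule lip[OF x x'(1) _ x'(2)]) (use i in simp)
      moreover have "norm (F (real i * h, F (h, x)) - F (real (Suc i) * h, x)) \<le> a"
        using grp[OF x, of i] i Suc.prems by (simp add: norm_minus_commute)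
      moreover have "norm (F (real (Suc i) * h, x) - F (real (Suc i + j) * h, z)) \<le> a + real j * (a + c)"
        using IH[of "Suc i"] i Suc.prems by simp
      moreover have "norm (F (real i * h, x') - F (real (Suc i + j) * h, z)) \<le>
          norm (F (real i * h, x') - F (real i * h, F (h, x))) +
          norm (F (real i * h, F (h, x)) - F (real (Suc i) * h, x)) +
          norm (F (real (Suc i) * h, x) - F (real (Suc i + j) * h, z))"
        by norm
      ultimately show ?thesis by (simp add: distrib_right)
    qed
    with x'(1) show ?case by blast
  qed
  from inv[of n] obtain x where x: "x \<in> S" "norm (F (0, x) - F (real n * h, z)) \<le> a + real n * (a + c)"
    by auto
  have "norm (x - F (real n * h, z)) \<le> norm (F (0, x) - x) + norm (F (0, x) - F (real n * h, z))"
    using norm_triangle_ineq4[of "F (0, x) - F (real n * h, z)" "F (0, x) - x"] by simp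
  with x zero[OF x(1)] show ?thesis by (intro bexI[of _ x]) auto
qed

section \<open>Generalized group actions\<close>

lemma gen_group_action_EMap: "gen_group_action UNIV F \<Longrightarrow> F \<in> EMap UNIV UNIV"
  by (simp add: gen_group_action_def)

lemma gen_group_action_moderate: "gen_group_action UNIV F \<Longrightarrow> moderate_net UNIV F"
  using gen_group_action_EMap EMap_iff[OF open_UNIV open_UNIV] by blast

lemma gen_group_action_c_bounded: "gen_group_action UNIV F \<Longrightarrow> c_bounded UNIV UNIV F"
  using gen_group_action_EMap EMap_iff[OF open_UNIV open_UNIV] by blast

lemma gen_group_action_zero:
  assumes "gen_group_action UNIV F" "compact K"
  shows "unif_negligible (\<lambda>_. K) (\<lambda>\<epsilon> x. F \<epsilon> (0, x) - x)"
  using assms GMap_eq_negligible[of UNIV UNIV "\<lambda>\<epsilon> x. F \<epsilon> (0, x)" "\<lambda>\<epsilon> x. x" K]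
  by (auto simp: gen_group_action_def)

lemma gen_group_action_add:
  assumes "gen_group_action UNIV F" "compact K"
  shows "unif_negligible (\<lambda>_. K)
    (\<lambda>\<epsilon> p. F \<epsilon> (fst (fst p) + snd (fst p), snd p) - F \<epsilon> (fst (fst p), F \<epsilon> (snd (fst p), snd p)))"
proof -
  let ?f = "\<lambda>\<epsilon> ((s, t), x). F \<epsilon> (s + t, x)" and ?g = "\<lambda>\<epsilon> ((s, t), x). F \<epsilon> (s, F \<epsilon> (t, x))"
  have "GMap_eq (UNIV \<times> UNIV) UNIV ?f ?g"
    using assms(1) by (simp add: gen_group_action_def)
  from GMap_eq_negligible[OF this assms(2)]
  have "unif_negligible (\<lambda>_. K) (\<lambda>\<epsilon> x. ?f \<epsilon> x - ?g \<epsilon> x)" by auto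
  moreover have "(\<lambda>\<epsilon> x. ?f \<epsilon> x - ?g \<epsilon> x) =
      (\<lambda>\<epsilon> p. F \<epsilon> (fst (fst p) + snd (fst p), snd p) - F \<epsilon> (fst (fst p), F \<epsilon> (snd (fst p), snd p)))"
    by (simp add: fun_eq_iff split_beta)
  ultimately show ?thesis by simp
qed

text \<open>In this form the generator, a time derivative, is a directional derivative of the net F
  on the product space, to which the estimates for moderate nets apply.\<close>

lemma vector_derivative_partial:
  fixes f :: "real \<times> 'a::real_normed_vector \<Rightarrow> 'b::real_normed_vector"
  assumes "f differentiable (at (t, x))"
  shows "vector_derivative (\<lambda>s. f (s, x)) (at t) = frechet_derivative f (at (t, x)) (1, 0)"
proof -
  have "((\<lambda>s. (s, x)) has_derivative (\<lambda>h. (h, 0))) (at t)"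
    by (auto intro!: derivative_eq_intros)
  moreover have "(f has_derivative frechet_derivative f (at (t, x))) (at (t, x))"
    using assms frechet_derivative_works by blast
  ultimately have "((\<lambda>s. f (s, x)) has_derivative (\<lambda>h. frechet_derivative f (at (t, x)) (h, 0))) (at t)"
    by (rule has_derivative_compose)
  moreover have lin: "linear (frechet_derivative f (at (t, x)))"
    using assms frechet_derivative_works has_derivative_linear by blast
  have "(\<lambda>h. frechet_derivative f (at (t, x)) (h, 0)) = (\<lambda>h. h *\<^sub>R frechet_derivative f (at (t, x)) (1, 0))"
    by (rule ext) (simp only: linear_scale[OF lin, symmetric], simp)
  ultimately show ?thesis
    by (intro vector_derivative_at) (simp add: has_vector_derivative_def)
qed

lemma compact_subset_cball:
  fixes K :: "'a::real_normed_vector set"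
  assumes "compact K"
  obtains R where "R > 0" "K \<subseteq> cball 0 R"
  using compact_imp_bounded[OF assms] unfolding bounded_pos by (auto simp: subset_iff)

text \<open>Taylor expansion of F in time at 0. The term \<epsilon>^q is the defect of F(0,x) = x,
  which is below every power; the second-order term costs a fixed N that does not depend on
  q.\<close>

lemma flow_first_order:
  fixes F :: "real \<Rightarrow> real \<times> 'a::euclidean_space \<Rightarrow> 'a"
  assumes F: "gen_group_action UNIV F" and K: "compact K"
  obtains N where "\<And>q. \<forall>\<^sub>F \<epsilon> in at_right 0. \<forall>x\<in>K. \<forall>h. \<bar>h\<bar> \<le> 1 \<longrightarrow>
    norm (F \<epsilon> (h, x) - x - h *\<^sub>R vector_derivative (\<lambda>t. F \<epsilon> (t, x)) (at 0)) \<le> \<epsilon> ^ q + inverse (\<epsilon> ^ N) * h\<^sup>2"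
proof -
  obtain R where R: "K \<subseteq> cball 0 R" using compact_subset_cball[OF K] by blast
  let ?C = "{-1..1::real} \<times> cball (0::'a) R"
  have C: "compact ?C" "convex ?C" by (auto intro: compact_Times convex_Times)
  obtain N where N: "\<forall>\<^sub>F \<epsilon> in at_right 0. \<forall>p v. closed_segment p (p + v) \<subseteq> ?C \<longrightarrow>
      norm (F \<epsilon> (p + v) - F \<epsilon> p - frechet_derivative (F \<epsilon>) (at p) v) \<le> inverse (\<epsilon> ^ N) * (norm v)\<^sup>2"
    using moderate_net_taylor[OF gen_group_action_moderate[OF F] C(1)] by blast
  have "\<forall>\<^sub>F \<epsilon> in at_right 0. \<forall>x\<in>K. \<forall>h. \<bar>h\<bar> \<le> 1 \<longrightarrow>
    norm (F \<epsilon> (h, x) - x - h *\<^sub>R vector_derivative (\<lambda>t. F \<epsilon> (t, x)) (at 0)) \<le> \<epsilon> ^ q + inverse (\<epsilon> ^ N) * h\<^sup>2" for q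
  proof -
    have "\<forall>\<^sub>F \<epsilon> in at_right 0. \<forall>x\<in>K. norm (F \<epsilon> (0, x) - x) \<le> \<epsilon> ^ q"
      using gen_group_action_zero[OF F K] unfolding unif_negligible_iff by blast
    then show ?thesis using N eventually_I_eps
    proof eventually_elim
      case (elim \<epsilon>)
      show ?case
      proof (intro ballI allI impI)
        fix x and h :: real assume x: "x \<in> K" and h: "\<bar>h\<bar> \<le> 1"
        have "F \<epsilon> differentiable (at (0, x))"
          using moderate_net_differentiable[OF gen_group_action_moderate[OF F] elim(3)] by simp
        moreover from this have lin: "linear (frechet_derivative (F \<epsilon>) (at (0, x)))"
          using frechet_derivative_works has_derivative_linear by blast
        ultimately have d: "frechet_derivative (F \<epsilon>) (at (0, x)) (h, 0) =
            h *\<^sub>R vector_derivative (\<lambda>t. F \<epsilon> (t, x)) (at 0)"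
          using linear_scale[OF lin, of h "(1, 0)"] by (simp add: vector_derivative_partial)
        have "closed_segment (0, x) ((0, x) + (h, 0)) \<subseteq> ?C"
          by (rule closed_segment_subset[OF _ _ C(2)]) (use x h R in auto)
        with elim(2) have "norm (F \<epsilon> ((0, x) + (h, 0)) - F \<epsilon> (0, x) -
            frechet_derivative (F \<epsilon>) (at (0, x)) (h, 0)) \<le> inverse (\<epsilon> ^ N) * (norm (h, 0::'a))\<^sup>2"
          by blast
        then have "norm (F \<epsilon> (h, x) - F \<epsilon> (0, x) - h *\<^sub>R vector_derivative (\<lambda>t. F \<epsilon> (t, x)) (at 0))
            \<le> inverse (\<epsilon> ^ N) * h\<^sup>2"
          by (simp add: d)
        moreover have "norm (F \<epsilon> (0, x) - x) \<le> \<epsilon> ^ q" using elim(1) x by blast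
        ultimately show "norm (F \<epsilon> (h, x) - x - h *\<^sub>R vector_derivative (\<lambda>t. F \<epsilon> (t, x)) (at 0))
            \<le> \<epsilon> ^ q + inverse (\<epsilon> ^ N) * h\<^sup>2"
          using norm_triangle_ineq[of "F \<epsilon> (h, x) - F \<epsilon> (0, x) - h *\<^sub>R vector_derivative (\<lambda>t. F \<epsilon> (t, x)) (at 0)"
              "F \<epsilon> (0, x) - x"] by (simp add: algebra_simps)
      qed
    qed
  qed
  then show thesis by (rule that)
qed

text \<open>For each \<epsilon> a point violating the bound \<epsilon>^k is selected if there is
  one; negligibility along this single net rules out violations for small \<epsilon>. This turns
  statements about one generalized point at a time into uniform estimates.\<close>

lemma unif_negligible_choice:
  assumes "\<And>x. (\<And>\<epsilon>. x \<epsilon> \<in> A \<epsilon> \<or> x \<epsilon> = d \<epsilon>) \<Longrightarrow> zero_num (\<lambda>\<epsilon>. norm (f \<epsilon> (x \<epsilon>)))"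
  shows "unif_negligible A f"
  unfolding unif_negligible_iff
proof
  fix k
  \<comment> \<open>The default d \<epsilon> is used where no point of A \<epsilon> violates the
    bound, in particular where A \<epsilon> is empty.\<close>
  define x where "x \<epsilon> = (if \<exists>y\<in>A \<epsilon>. \<not> norm (f \<epsilon> y) \<le> \<epsilon> ^ k then SOME y. y \<in> A \<epsilon> \<and> \<not> norm (f \<epsilon> y) \<le> \<epsilon> ^ k else d \<epsilon>)" for \<epsilon>
  have x: "x \<epsilon> \<in> A \<epsilon> \<and> \<not> norm (f \<epsilon> (x \<epsilon>)) \<le> \<epsilon> ^ k" if "\<exists>y\<in>A \<epsilon>. \<not> norm (f \<epsilon> y) \<le> \<epsilon> ^ k" for \<epsilon>
    using that someI_ex[of "\<lambda>y. y \<in> A \<epsilon> \<and> \<not> norm (f \<epsilon> y) \<le> \<epsilon> ^ k"] unfolding x_def by auto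
  have "zero_num (\<lambda>\<epsilon>. norm (f \<epsilon> (x \<epsilon>)))"
  proof (rule assms)
    show "x \<epsilon> \<in> A \<epsilon> \<or> x \<epsilon> = d \<epsilon>" for \<epsilon>
      using x[of \<epsilon>] by (cases "\<exists>y\<in>A \<epsilon>. \<not> norm (f \<epsilon> y) \<le> \<epsilon> ^ k") (auto simp: x_def)
  qed
  then have "\<forall>\<^sub>F \<epsilon> in at_right 0. \<bar>norm (f \<epsilon> (x \<epsilon>))\<bar> \<le> \<epsilon> ^ k" unfolding zero_num_iff by blast
  then show "\<forall>\<^sub>F \<epsilon> in at_right 0. \<forall>y\<in>A \<epsilon>. norm (f \<epsilon> y) \<le> \<epsilon> ^ k"
    by eventually_elim (use x in force)
qed

lemma gen_pt_norm_bounded: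
  assumes "gen_pt M z"
  obtains R where "R > 0" "\<forall>\<^sub>F \<epsilon> in at_right 0. z \<epsilon> \<in> cball 0 R"
proof -
  obtain K where K: "compact K" "\<forall>\<^sub>F \<epsilon> in at_right 0. z \<epsilon> \<in> K"
    using assms unfolding gen_pt_def by blast
  obtain R where R: "R > 0" "K \<subseteq> cball 0 R" using compact_subset_cball[OF K(1)] by blast
  show thesis by (rule that[OF R(1)]) (use K(2) R(2) in \<open>auto elim!: eventually_mono\<close>)
qed

text \<open>The hypothesis yields a compact set for each net of times separately. Applied to times
  at which the trajectory is closest to the complement of U, it bounds that distance from below at
  all times at once; c-boundedness of F supplies the compact set containing the trajectory.\<close>

lemma trajectory_in_compact:
  fixes F :: "real \<Rightarrow> real \<times> 'a::euclidean_space \<Rightarrow> 'a"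
  assumes F: "gen_group_action UNIV F" and z: "gen_pt UNIV z" and U: "open U"
    and t1: "0 \<le> t1" "t1 < t0"
    and inU: "\<And>\<eta>. gen_pt {-t0<..<t0} \<eta> \<Longrightarrow> \<exists>w. gen_pt U w \<and> gen_pt_eq w (\<lambda>\<epsilon>. F \<epsilon> (\<eta> \<epsilon>, z \<epsilon>))"
  obtains K where "compact K" "K \<subseteq> U" "\<forall>\<^sub>F \<epsilon> in at_right 0. \<forall>t. \<bar>t\<bar> \<le> t1 \<longrightarrow> F \<epsilon> (t, z \<epsilon>) \<in> K"
proof -
  obtain R where R: "R > 0" "\<forall>\<^sub>F \<epsilon> in at_right 0. z \<epsilon> \<in> cball 0 R"
    using gen_pt_norm_bounded[OF z] by blast
  have "compact ({-t1..t1} \<times> cball (0::'a) R)" by (intro compact_Times) auto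
  then obtain K' where K': "compact K'" "\<forall>\<^sub>F \<epsilon> in at_right 0. F \<epsilon> ` ({-t1..t1} \<times> cball 0 R) \<subseteq> K'"
    using c_boundedD[OF gen_group_action_c_bounded[OF F]] by (metis subset_UNIV)
  have ev: "\<forall>\<^sub>F \<epsilon> in at_right 0. \<forall>t. \<bar>t\<bar> \<le> t1 \<longrightarrow> F \<epsilon> (t, z \<epsilon>) \<in> K'"
    using R(2) K'(2)
  proof eventually_elim
    case (elim \<epsilon>)
    show ?case
    proof (intro allI impI)
      fix t assume "\<bar>t\<bar> \<le> t1"
      then have "(t, z \<epsilon>) \<in> {-t1..t1} \<times> cball 0 R" using elim(1) by auto
      then show "F \<epsilon> (t, z \<epsilon>) \<in> K'" using elim(2) by blast
    qed
  qed
  show thesis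
  \<comment> \<open>The distance to an empty complement is 0 by convention and would carry no
    information.\<close>
  proof (cases "U = UNIV")
    case True
    then show ?thesis using that[OF K'(1)] ev by blast
  next
    case False
    let ?d = "\<lambda>x. infdist x (- U)"
    \<comment> \<open>Outside I the maps need not be continuous, so a minimiser is required only on
      I; elsewhere the time 0 is taken.\<close>
    have "\<exists>s. \<bar>s\<bar> \<le> t1 \<and> (\<epsilon> \<in> I_eps \<longrightarrow> (\<forall>t. \<bar>t\<bar> \<le> t1 \<longrightarrow> ?d (F \<epsilon> (s, z \<epsilon>)) \<le> ?d (F \<epsilon> (t, z \<epsilon>))))" for \<epsilon>
    proof (cases "\<epsilon> \<in> I_eps")
      case True
      have "continuous_on {-t1..t1} (\<lambda>t. ?d (F \<epsilon> (t, z \<epsilon>)))"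
      proof (intro continuous_intros)
        show "continuous_on {-t1..t1} (\<lambda>t. F \<epsilon> (t, z \<epsilon>))"
          by (rule continuous_on_compose2[OF moderate_net_continuous_on[OF gen_group_action_moderate[OF F] True]])
             (auto intro!: continuous_intros)
      qed
      from continuous_attains_inf[OF compact_Icc _ this] t1
      show ?thesis by (auto simp: abs_le_iff)
    next
      case False
      then show ?thesis using t1 by (intro exI[of _ 0]) auto
    qed
    then obtain s where s: "\<And>\<epsilon>. \<bar>s \<epsilon>\<bar> \<le> t1"
      "\<And>\<epsilon> t. \<epsilon> \<in> I_eps \<Longrightarrow> \<bar>t\<bar> \<le> t1 \<Longrightarrow> ?d (F \<epsilon> (s \<epsilon>, z \<epsilon>)) \<le> ?d (F \<epsilon> (t, z \<epsilon>))"
      by metis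
    have "gen_pt {-t0<..<t0} s"
      unfolding gen_pt_def
    proof (intro conjI ballI exI[of _ "{-t1..t1}"] always_eventually allI)
      show "s \<epsilon> \<in> {-t0<..<t0}" for \<epsilon> using s(1)[of \<epsilon>] t1 by auto
      show "s \<epsilon> \<in> {-t1..t1}" for \<epsilon> using s(1)[of \<epsilon>] by auto
    qed (use t1 in auto)
    then obtain w where w: "gen_pt U w" "gen_pt_eq w (\<lambda>\<epsilon>. F \<epsilon> (s \<epsilon>, z \<epsilon>))" using inU by blast
    then obtain L where L: "compact L" "L \<subseteq> U" "\<forall>\<^sub>F \<epsilon> in at_right 0. w \<epsilon> \<in> L" unfolding gen_pt_def by blast
    have "\<exists>c>0. \<forall>x\<in>L. c \<le> ?d x"
    proof (cases "L = {}")
      case False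
      have "continuous_on L ?d" by (intro continuous_intros)
      then obtain x where x: "x \<in> L" "\<And>y. y \<in> L \<Longrightarrow> ?d x \<le> ?d y"
        using continuous_attains_inf[OF L(1) False] by blast
      have "?d x > 0"
        using infdist_pos_not_in_closed[of "- U" x] x(1) L(2) U \<open>U \<noteq> UNIV\<close> by auto
      then show ?thesis using x by blast
    qed (auto intro: exI[of _ 1])
    then obtain c where c: "c > 0" "\<And>x. x \<in> L \<Longrightarrow> c \<le> ?d x" by blast
    \<comment> \<open>The trajectory is only negligibly close to the point w \<epsilon> of L, so
      half of the distance c is kept.\<close>
    let ?K = "K' \<inter> {x. c / 2 \<le> ?d x}"
    have "\<forall>\<^sub>F \<epsilon> in at_right 0. dist (w \<epsilon>) (F \<epsilon> (s \<epsilon>, z \<epsilon>)) \<le> \<epsilon> ^ 1"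
      using w(2) unfolding gen_pt_eq_iff by blast
    then have "\<forall>\<^sub>F \<epsilon> in at_right 0. \<forall>t. \<bar>t\<bar> \<le> t1 \<longrightarrow> F \<epsilon> (t, z \<epsilon>) \<in> ?K"
      using ev L(3) eventually_I_eps eventually_mult_less[of "2 / c"]
    proof eventually_elim
      case (elim \<epsilon>)
      have "c \<le> ?d (F \<epsilon> (s \<epsilon>, z \<epsilon>)) + dist (w \<epsilon>) (F \<epsilon> (s \<epsilon>, z \<epsilon>))"
        using c(2)[OF elim(3)] infdist_triangle[of "w \<epsilon>" "- U" "F \<epsilon> (s \<epsilon>, z \<epsilon>)"] by simp
      moreover have "\<epsilon> < c / 2" using elim(5) c(1) by (simp add: field_simps)
      ultimately have "c / 2 \<le> ?d (F \<epsilon> (s \<epsilon>, z \<epsilon>))" using elim(1) by simp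
      then show ?case using elim(2) s(2)[OF elim(4)] order_trans by blast
    qed
    moreover have "compact ?K"
    proof (rule compact_Int_closed[OF K'(1)])
      show "closed {x. c / 2 \<le> ?d x}" by (intro closed_Collect_le continuous_intros)
    qed
    moreover have "?K \<subseteq> U" using c(1) by (auto simp: infdist_zero intro: ccontr)
    ultimately show ?thesis using that by blast
  qed
qed

section \<open>Invariance of the zero set\<close>

lemma inverse_power_mult: "0 < \<epsilon> \<Longrightarrow> inverse (\<epsilon> ^ a) * \<epsilon> ^ (a + b) = (\<epsilon> ^ b :: real)"
  by (simp add: power_add)

lemma inverse_power_mono: "0 < \<epsilon> \<Longrightarrow> \<epsilon> \<le> 1 \<Longrightarrow> a \<le> b \<Longrightarrow> inverse (\<epsilon> ^ a) \<le> inverse (\<epsilon> ^ b :: real)"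
  by (simp add: le_imp_inverse_le power_decreasing)

text \<open>The retraction read in the chart: the orthogonal projection onto the model zero set. The
  shift \<nu> - 1 follows \<open>nth_coord\<close>, whose labels start at 1.\<close>

definition kill_coords :: "nat \<Rightarrow> 'd::{finite,linorder} rvec \<Rightarrow> 'd rvec" where
  "kill_coords k y =
    (\<chi> i. if i \<in> (\<lambda>\<nu>. sorted_list_of_set UNIV ! (\<nu> - 1)) ` {1..k} then 0 else y $ i)"

lemma nth_coord_kill_coords: "\<nu> \<in> {1..k} \<Longrightarrow> nth_coord \<nu> (kill_coords k y) = 0"
  unfolding nth_coord_def kill_coords_def by (simp only: vec_lambda_beta) (rule if_P, rule imageI)

lemma norm_kill_coords: "norm (kill_coords k y - y) \<le> (\<Sum>\<nu>\<in>{1..k}. \<bar>nth_coord \<nu> y\<bar>)"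
proof -
  let ?idx = "\<lambda>\<nu>. sorted_list_of_set (UNIV :: 'a set) ! (\<nu> - 1)"
  have "norm (kill_coords k y - y) \<le> (\<Sum>i\<in>UNIV. \<bar>(kill_coords k y - y) $ i\<bar>)"
    by (rule norm_le_l1_cart)
  also have "\<dots> = (\<Sum>i\<in>?idx ` {1..k}. \<bar>y $ i\<bar>)"
    by (rule sum.mono_neutral_cong_right) (auto simp: kill_coords_def)
  also have "\<dots> \<le> (\<Sum>\<nu>\<in>{1..k}. ((\<lambda>i. \<bar>y $ i\<bar>) \<circ> ?idx) \<nu>)"
    by (rule sum_image_le) auto
  finally show ?thesis by (simp add: nth_coord_def)
qed

text \<open>In the chart \<Delta> is a coordinate projection up to negligible nets: if |\<Delta>|
  \<le> e at x, the first k coordinates of \<psi>(x) are at most about e, and killing them moves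
  \<psi>(x) by at most about k e. The inverse chart carries this move back with its moderate
  Lipschitz constant. S is a compact piece of the model zero set, carried back by \<psi>', so
  \<Delta> is negligible on it rather than zero; N depends neither on q nor on e.\<close>

lemma max_rank_retraction:
  fixes \<Delta> :: "nat \<Rightarrow> real \<Rightarrow> 'a::euclidean_space \<Rightarrow> real" and V :: "'d::{finite,linorder} rvec set"
  assumes rank: "max_rank_via l \<Delta> U V \<psi> \<psi>'" and UV: "open U" "open V" and K: "compact K" "K \<subseteq> U"
  obtains S K' N where "compact K'" "\<forall>\<^sub>F \<epsilon> in at_right 0. S \<epsilon> \<subseteq> K'"
    "\<And>\<nu>. \<nu> \<in> {1..l} \<Longrightarrow> unif_negligible S (\<Delta> \<nu>)"
    "\<And>q. \<forall>\<^sub>F \<epsilon> in at_right 0. \<forall>x\<in>K. \<forall>e. 0 \<le> e \<longrightarrow> e \<le> \<epsilon> \<longrightarrow> (\<forall>\<nu>\<in>{1..l}. \<bar>\<Delta> \<nu> \<epsilon> x\<bar> \<le> e) \<longrightarrow>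
      (\<exists>x'\<in>S \<epsilon>. norm (x' - x) \<le> inverse (\<epsilon> ^ N) * (e + \<epsilon> ^ q))"
proof -
  define k where "k = min CARD('d) l"
  obtain \<epsilon>0 where e0: "\<epsilon>0 \<in> I_eps" "\<And>\<epsilon>. \<epsilon> \<in> {0<..\<epsilon>0} \<Longrightarrow> diffeo_pair U V (\<psi> \<epsilon>) (\<psi>' \<epsilon>)"
    using rank unfolding max_rank_via_def by blast
  have ev0: "\<forall>\<^sub>F \<epsilon> in at_right 0. \<epsilon> \<in> {0<..\<epsilon>0}"
    by (rule eventually_at_rightI[of 0 \<epsilon>0]) (use e0(1) in auto)
  have \<psi>: "c_bounded U V \<psi>" and \<psi>': "moderate_net V \<psi>'" "c_bounded V U \<psi>'"
    using rank unfolding max_rank_via_def EMap_iff[OF UV] EMap_iff[OF UV(2,1)] by blast+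
  obtain L where L: "compact L" "L \<subseteq> V" "\<forall>\<^sub>F \<epsilon> in at_right 0. \<psi> \<epsilon> ` K \<subseteq> L"
    using c_boundedD[OF \<psi> K] by blast
  \<comment> \<open>Room of fixed size around \<psi>(K): neither the projected point nor the segment
    leading to it may leave the compact set on which \<psi>' is controlled.\<close>
  obtain \<delta> where \<delta>: "\<delta> > 0" "(\<Union>x\<in>L. cball x \<delta>) \<subseteq> V"
    using compact_subset_open_imp_cball_epsilon_subset[OF L(1) UV(2) L(2)] by blast
  define L' where "L' = (\<Union>x\<in>L. cball x \<delta>)"
  have L': "compact L'" "L' \<subseteq> V"
    using compact_minkowski_sum_cball[OF L(1)] \<delta>(2) unfolding L'_def by auto
  obtain K' where K': "compact K'" "\<forall>\<^sub>F \<epsilon> in at_right 0. \<psi>' \<epsilon> ` L' \<subseteq> K'"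
    using c_boundedD[OF \<psi>'(2) L'] by blast
  define S where "S \<epsilon> = \<psi>' \<epsilon> ` {y\<in>L'. \<forall>\<nu>\<in>{1..k}. nth_coord \<nu> y = 0}" for \<epsilon>
  have coord: "\<forall>\<^sub>F \<epsilon> in at_right 0. \<forall>y\<in>L'.
      \<bar>\<Delta> \<nu> \<epsilon> (\<psi>' \<epsilon> y) - (if \<nu> \<le> k then nth_coord \<nu> y else 0)\<bar> \<le> \<epsilon> ^ q" if "\<nu> \<in> {1..l}" for \<nu> q
  proof -
    have "(\<lambda>\<epsilon> x. (\<Delta> \<nu> \<epsilon> \<circ> \<psi>' \<epsilon>) x - (if \<nu> \<le> k then nth_coord \<nu> x else 0)) \<in> Negl V"
      using rank that unfolding max_rank_via_def G_eq_def k_def by blast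
    then have "unif_negligible (\<lambda>_. L') (\<lambda>\<epsilon> x. (\<Delta> \<nu> \<epsilon> \<circ> \<psi>' \<epsilon>) x - (if \<nu> \<le> k then nth_coord \<nu> x else 0))"
      using L' unfolding Negl_def by blast
    then show ?thesis unfolding unif_negligible_iff o_def real_norm_def by blast
  qed
  obtain N where N: "\<forall>\<^sub>F \<epsilon> in at_right 0. \<forall>x y. closed_segment x y \<subseteq> L' \<longrightarrow>
      norm (\<psi>' \<epsilon> x - \<psi>' \<epsilon> y) \<le> inverse (\<epsilon> ^ N) * norm (x - y)"
    using moderate_net_lipschitzE[OF \<psi>'(1) L'] by blast
  show thesis
  proof (rule that[OF K'(1)])
    show "\<forall>\<^sub>F \<epsilon> in at_right 0. S \<epsilon> \<subseteq> K'"
      using K'(2) by eventually_elim (auto simp: S_def)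
    show "unif_negligible S (\<Delta> \<nu>)" if "\<nu> \<in> {1..l}" for \<nu>
      unfolding unif_negligible_iff
    proof
      fix q
      show "\<forall>\<^sub>F \<epsilon> in at_right 0. \<forall>x\<in>S \<epsilon>. norm (\<Delta> \<nu> \<epsilon> x) \<le> \<epsilon> ^ q"
        using coord[OF that, of q]
      proof eventually_elim
        case (elim \<epsilon>)
        have "(if \<nu> \<le> k then nth_coord \<nu> y else 0) = 0" if "\<forall>\<nu>\<in>{1..k}. nth_coord \<nu> y = 0" for y
          using that \<open>\<nu> \<in> {1..l}\<close> by auto
        then show ?case using elim unfolding S_def by fastforce
      qed
    qed
    fix q
    \<comment> \<open>The exponent \<open>Suc q\<close> keeps the error at most \<epsilon> even for
      q = 0; together with e \<le> \<epsilon> the projection then moves points by at most 2 k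
      \<epsilon>, below \<delta> for small \<epsilon>.\<close>
    have "\<forall>\<^sub>F \<epsilon> in at_right 0. \<forall>\<nu>\<in>{1..l}. \<forall>y\<in>L'.
        \<bar>\<Delta> \<nu> \<epsilon> (\<psi>' \<epsilon> y) - (if \<nu> \<le> k then nth_coord \<nu> y else 0)\<bar> \<le> \<epsilon> ^ Suc q"
      by (intro eventually_ball_finite finite_atLeastAtMost ballI coord)
    then show "\<forall>\<^sub>F \<epsilon> in at_right 0. \<forall>x\<in>K. \<forall>e. 0 \<le> e \<longrightarrow> e \<le> \<epsilon> \<longrightarrow> (\<forall>\<nu>\<in>{1..l}. \<bar>\<Delta> \<nu> \<epsilon> x\<bar> \<le> e) \<longrightarrow>
        (\<exists>x'\<in>S \<epsilon>. norm (x' - x) \<le> inverse (\<epsilon> ^ Suc N) * (e + \<epsilon> ^ q))"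
      using N L(3) ev0 eventually_I_eps eventually_mult_less[of "2 * real k / \<delta>"]
        eventually_mult_less[of "real k"]
    proof eventually_elim
      case (elim \<epsilon>)
      note coord = elim(1) and lip = elim(2) and \<psi>L = elim(3) and diffeo = e0(2)[OF elim(4)]
        and \<epsilon> = elim(5) and small = elim(6,7)
      have \<epsilon>q: "\<epsilon> ^ Suc q \<le> \<epsilon> ^ q" "\<epsilon> ^ Suc q \<le> \<epsilon>"
        using \<epsilon> by (auto simp: mult_left_le_one_le power_le_one mult_left_le)
      show ?case
      proof (intro ballI allI impI)
        fix x e assume x: "x \<in> K" and e: "0 \<le> e" "e \<le> \<epsilon>" and \<Delta>: "\<forall>\<nu>\<in>{1..l}. \<bar>\<Delta> \<nu> \<epsilon> x\<bar> \<le> e"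
        define y where "y = \<psi> \<epsilon> x"
        have y: "y \<in> L" "\<psi>' \<epsilon> y = x"
          using x \<psi>L diffeo K(2) unfolding y_def diffeo_pair_def by auto
        then have "y \<in> L'" using \<delta>(1) unfolding L'_def by force
        have "\<bar>nth_coord \<nu> y\<bar> \<le> e + \<epsilon> ^ Suc q" if "\<nu> \<in> {1..k}" for \<nu>
        proof -
          have \<nu>: "\<nu> \<in> {1..l}" "\<nu> \<le> k" using that unfolding k_def by auto
          have "\<bar>\<Delta> \<nu> \<epsilon> x - nth_coord \<nu> y\<bar> \<le> \<epsilon> ^ Suc q"
            using bspec[OF bspec[OF coord \<nu>(1)] \<open>y \<in> L'\<close>] \<nu>(2) y(2) by simp
          then show ?thesis using bspec[OF \<Delta> \<nu>(1)] by linarith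
        qed
        then have "(\<Sum>\<nu>\<in>{1..k}. \<bar>nth_coord \<nu> y\<bar>) \<le> (\<Sum>\<nu>\<in>{1..k}. e + \<epsilon> ^ Suc q)"
          by (rule sum_mono)
        then have P: "norm (kill_coords k y - y) \<le> real k * (e + \<epsilon> ^ Suc q)"
          using norm_kill_coords[of k y] by simp
        also have "\<dots> \<le> real k * (2 * \<epsilon>)"
          using e \<epsilon>q by (intro mult_left_mono) auto
        also have "\<dots> \<le> \<delta>" using small(1) \<delta>(1) by (simp add: field_simps)
        finally have near: "kill_coords k y \<in> cball y \<delta>" by (simp add: dist_norm norm_minus_commute)
        have "closed_segment (kill_coords k y) y \<subseteq> cball y \<delta>"
          by (rule closed_segment_subset[OF near]) (use \<delta>(1) in auto)
        also have "\<dots> \<subseteq> L'" using y(1) unfolding L'_def by blast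
        finally have seg: "closed_segment (kill_coords k y) y \<subseteq> L'" .
        then have "kill_coords k y \<in> L'" by auto
        then have "\<psi>' \<epsilon> (kill_coords k y) \<in> S \<epsilon>"
          unfolding S_def using nth_coord_kill_coords by blast
        moreover have "norm (\<psi>' \<epsilon> (kill_coords k y) - x) \<le> inverse (\<epsilon> ^ Suc N) * (e + \<epsilon> ^ q)"
        proof -
          have "norm (\<psi>' \<epsilon> (kill_coords k y) - x) \<le> inverse (\<epsilon> ^ N) * norm (kill_coords k y - y)"
            using lip seg y(2) by blast
          also have "\<dots> \<le> inverse (\<epsilon> ^ N) * (real k * (e + \<epsilon> ^ q))"
          proof (rule mult_left_mono[OF order_trans[OF P]])
            show "real k * (e + \<epsilon> ^ Suc q) \<le> real k * (e + \<epsilon> ^ q)"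
              using \<epsilon>q by (intro mult_left_mono) auto
          qed (use \<epsilon> in auto)
          \<comment> \<open>The factor k is traded for one power of 1/\<epsilon>, hence
            \<open>Suc N\<close>.\<close>
          also have "\<dots> \<le> inverse (\<epsilon> ^ N) * (inverse \<epsilon> * (e + \<epsilon> ^ q))"
            using small(2) \<epsilon> e by (intro mult_left_mono mult_right_mono) (auto simp: field_simps)
          finally show ?thesis by (simp add: mult_ac)
        qed
        ultimately show "\<exists>x'\<in>S \<epsilon>. norm (x' - x) \<le> inverse (\<epsilon> ^ Suc N) * (e + \<epsilon> ^ q)" by blast
      qed
    qed
  qed
qed

text \<open>Expand u(x + v + r) with v = h X(x) and r the second-order remainder of the flow. On S
  the terms u(x) and h X(u)(x) are negligible, so what survives is of order h^2 with a moderate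
  factor: the quadratic remainder of u at v, and the Lipschitz bound of u applied to r.\<close>

lemma one_step_single:
  fixes F :: "real \<Rightarrow> real \<times> 'a::euclidean_space \<Rightarrow> 'a" and u :: "real \<Rightarrow> 'a \<Rightarrow> real"
  defines "X \<equiv> \<lambda>\<epsilon> x. vector_derivative (\<lambda>t. F \<epsilon> (t, x)) (at 0)"
  assumes F: "gen_group_action UNIV F" and u: "u \<in> EM UNIV"
    and K: "compact K" "\<forall>\<^sub>F \<epsilon> in at_right 0. S \<epsilon> \<subseteq> K"
    and S: "unif_negligible S u" "unif_negligible S (field_deriv X u)"
  obtains N where "\<And>q. \<forall>\<^sub>F \<epsilon> in at_right 0. \<forall>x\<in>S \<epsilon>. \<forall>h. \<bar>h\<bar> \<le> \<epsilon> ^ N \<longrightarrow>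
    norm (F \<epsilon> (h, x) - x) \<le> \<epsilon> \<and> \<bar>u \<epsilon> (F \<epsilon> (h, x))\<bar> \<le> \<epsilon> ^ q + inverse (\<epsilon> ^ N) * h\<^sup>2"
proof -
  have Fm: "moderate_net UNIV F" by (rule gen_group_action_moderate[OF F])
  have um: "moderate_net UNIV u" using u EM_iff by blast
  obtain R where R: "R > 0" "K \<subseteq> cball 0 R" using compact_subset_cball[OF K(1)] by blast
  \<comment> \<open>Radius R + 1, because x + v and F(h,x) stay within \<epsilon> \<le> 1 of
    x.\<close>
  let ?B = "cball (0::'a) (R + 1)"
  obtain N1 where N1: "\<And>q. \<forall>\<^sub>F \<epsilon> in at_right 0. \<forall>x\<in>K. \<forall>h. \<bar>h\<bar> \<le> 1 \<longrightarrow>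
      norm (F \<epsilon> (h, x) - x - h *\<^sub>R X \<epsilon> x) \<le> \<epsilon> ^ q + inverse (\<epsilon> ^ N1) * h\<^sup>2"
    using flow_first_order[OF F K(1)] unfolding X_def by blast
  have "compact ({0::real} \<times> K)" using K(1) by (intro compact_Times) auto
  then obtain N2 where "\<forall>\<^sub>F \<epsilon> in at_right 0. \<forall>p\<in>{0} \<times> K. \<forall>v.
      norm (frechet_derivative (F \<epsilon>) (at p) v) \<le> norm v * inverse (\<epsilon> ^ N2)"
    using moderate_net_frechet[OF Fm] by blast
  then have N2: "\<forall>\<^sub>F \<epsilon> in at_right 0. \<forall>x\<in>K. norm (X \<epsilon> x) \<le> inverse (\<epsilon> ^ N2)"
    using eventually_I_eps
  proof eventually_elim
    case (elim \<epsilon>)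
    show ?case
    proof
      fix x assume "x \<in> K"
      then have "norm (frechet_derivative (F \<epsilon>) (at (0, x)) (1, 0)) \<le> norm (1::real, 0::'a) * inverse (\<epsilon> ^ N2)"
        using elim(1) by blast
      then show "norm (X \<epsilon> x) \<le> inverse (\<epsilon> ^ N2)"
        unfolding X_def by (simp add: vector_derivative_partial moderate_net_differentiable[OF Fm elim(2)])
    qed
  qed
  obtain N3 where N3: "\<forall>\<^sub>F \<epsilon> in at_right 0. \<forall>x y. closed_segment x y \<subseteq> ?B \<longrightarrow>
      norm (u \<epsilon> x - u \<epsilon> y) \<le> inverse (\<epsilon> ^ N3) * norm (x - y)"
    using moderate_net_lipschitzE[OF um compact_cball subset_UNIV] by blast
  obtain N4 where N4: "\<forall>\<^sub>F \<epsilon> in at_right 0. \<forall>x v. closed_segment x (x + v) \<subseteq> ?B \<longrightarrow>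
      norm (u \<epsilon> (x + v) - u \<epsilon> x - frechet_derivative (u \<epsilon>) (at x) v) \<le> inverse (\<epsilon> ^ N4) * (norm v)\<^sup>2"
    using moderate_net_taylor[OF um compact_cball subset_UNIV] by blast
  \<comment> \<open>The h^2 terms carry \<epsilon>^-(N1 + N3) and \<epsilon>^-(2 N2 + N4). The
    summand 2 leaves a spare power to absorb their sum, and also makes |v| and the h^2 part of |r|
    at most \<epsilon>^2 when |h| \<le> \<epsilon>^N.\<close>
  define N where "N = N1 + 2 * N2 + N3 + N4 + 2"
  have "\<forall>\<^sub>F \<epsilon> in at_right 0. \<forall>x\<in>S \<epsilon>. \<forall>h. \<bar>h\<bar> \<le> \<epsilon> ^ N \<longrightarrow>
    norm (F \<epsilon> (h, x) - x) \<le> \<epsilon> \<and> \<bar>u \<epsilon> (F \<epsilon> (h, x))\<bar> \<le> \<epsilon> ^ q + inverse (\<epsilon> ^ N) * h\<^sup>2" for q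
  proof -
    \<comment> \<open>With exponent q + 2 the three negligible contributions add up to at most
      \<epsilon>^q. In the flow remainder the exponent is raised further by N3, to compensate the
      Lipschitz factor of u.\<close>
    have "\<forall>\<^sub>F \<epsilon> in at_right 0. \<forall>x\<in>S \<epsilon>. norm (u \<epsilon> x) \<le> \<epsilon> ^ (q + 2)"
      "\<forall>\<^sub>F \<epsilon> in at_right 0. \<forall>x\<in>S \<epsilon>. norm (field_deriv X u \<epsilon> x) \<le> \<epsilon> ^ (q + 2)"
      using S unfolding unif_negligible_iff by blast+
    then show ?thesis
      using N1[of "N3 + (q + 2)"] N2 N3 N4 K(2) eventually_I_eps eventually_mult_less[of 3]
    proof eventually_elim
      case (elim \<epsilon>)
      have \<epsilon>: "0 < \<epsilon>" "\<epsilon> \<le> 1" "3 * \<epsilon> < 1" using elim(8,9) by auto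
      define w where "w a = inverse (\<epsilon> ^ a)" for a
      have w: "0 < w a" for a using \<epsilon> by (simp add: w_def)
      have w_mono: "w a \<le> w b" if "a \<le> b" for a b
        using inverse_power_mono[of \<epsilon> a b] \<epsilon> that by (simp add: w_def)
      have w_add: "w (a + b) = w a * w b" for a b by (simp add: w_def power_add)
      have w_pow: "w a * \<epsilon> ^ b \<le> \<epsilon> ^ c" if "a + c \<le> b" for a b c
      proof -
        have "w a * \<epsilon> ^ b \<le> w a * \<epsilon> ^ (a + c)"
          using w[of a] \<epsilon> that by (intro mult_left_mono power_decreasing) auto
        then show ?thesis using \<epsilon>(1) by (simp add: w_def inverse_power_mult)
      qed
      have sq: "3 * \<epsilon> ^ 2 \<le> \<epsilon>" using \<epsilon> by (simp add: power2_eq_square mult_left_le_one_le)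
      show ?case
      proof (intro ballI allI impI)
        fix x and h :: real assume x: "x \<in> S \<epsilon>" and h: "\<bar>h\<bar> \<le> \<epsilon> ^ N"
        have xK: "x \<in> K" using x elim(7) by blast
        have h1: "\<bar>h\<bar> \<le> 1" using h \<epsilon> power_le_one[of \<epsilon> N] by linarith
        have h2: "h\<^sup>2 \<le> \<epsilon> ^ N"
        proof -
          have "h\<^sup>2 = \<bar>h\<bar> * \<bar>h\<bar>" by (simp add: power2_eq_square)
          also have "\<dots> \<le> 1 * \<epsilon> ^ N" using h h1 by (intro mult_mono) auto
          finally show ?thesis by simp
        qed
        define v where "v = h *\<^sub>R X \<epsilon> x"
        define r where "r = F \<epsilon> (h, x) - x - v"
        have v: "norm v \<le> \<bar>h\<bar> * w N2"
          unfolding v_def w_def using elim(4) xK by (auto intro!: mult_left_mono)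
        have v2: "norm v \<le> \<epsilon> ^ 2"
        proof -
          have "norm v \<le> \<epsilon> ^ N * w N2"
            using v h w[of N2] by (meson less_imp_le mult_right_mono order_trans)
          also have "\<dots> \<le> \<epsilon> ^ 2" using w_pow[of N2 2 N] by (simp add: N_def mult.commute)
          finally show ?thesis .
        qed
        have r: "norm r \<le> \<epsilon> ^ (N3 + (q + 2)) + w N1 * h\<^sup>2"
          using elim(3) xK h1 unfolding r_def v_def w_def by blast
        have r2: "norm r \<le> 2 * \<epsilon> ^ 2"
        proof -
          have "w N1 * h\<^sup>2 \<le> w N1 * \<epsilon> ^ N" using h2 w[of N1] by (simp add: mult_left_mono)
          also have "\<dots> \<le> \<epsilon> ^ 2" by (rule w_pow) (simp add: N_def)
          finally have "w N1 * h\<^sup>2 \<le> \<epsilon> ^ 2" .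
          moreover have "\<epsilon> ^ (N3 + (q + 2)) \<le> \<epsilon> ^ 2" using \<epsilon> by (intro power_decreasing) auto
          ultimately show ?thesis using r by linarith
        qed
        have Fx: "F \<epsilon> (h, x) = x + v + r" by (simp add: r_def)
        have near: "norm (v + r) \<le> \<epsilon>"
          using norm_triangle_ineq[of v r] v2 r2 sq by linarith
        have xR: "norm x \<le> R" using xK R(2) by auto
        have in_B: "x \<in> ?B" "x + v \<in> ?B" "x + v + r \<in> ?B"
          using xR norm_triangle_ineq[of x v] norm_triangle_ineq[of x "v + r"] near v2 sq \<epsilon>
          by (auto simp: add.assoc)
        have seg: "closed_segment x (x + v) \<subseteq> ?B" "closed_segment (x + v + r) (x + v) \<subseteq> ?B"
          by (intro closed_segment_subset in_B convex_cball)+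
        have "norm (u \<epsilon> (x + v + r) - u \<epsilon> (x + v)) \<le> w N3 * norm (x + v + r - (x + v))"
          using elim(5) seg(2) unfolding w_def by blast
        then have "norm (u \<epsilon> (x + v + r) - u \<epsilon> (x + v)) \<le> w N3 * norm r" by simp
        also have "\<dots> \<le> w N3 * (\<epsilon> ^ (N3 + (q + 2)) + w N1 * h\<^sup>2)"
          using r w[of N3] by (simp add: mult_left_mono)
        also have "\<dots> \<le> \<epsilon> ^ (q + 2) + w (N3 + N1) * h\<^sup>2"
          using w_pow[of N3 "q + 2" "N3 + (q + 2)"] by (simp add: distrib_left w_add)
        finally have 1: "norm (u \<epsilon> (x + v + r) - u \<epsilon> (x + v)) \<le> \<epsilon> ^ (q + 2) + w (N3 + N1) * h\<^sup>2" .
        have lin: "linear (frechet_derivative (u \<epsilon>) (at x))"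
          using moderate_net_differentiable[OF um elim(8), of x] frechet_derivative_works
            has_derivative_linear by blast
        have "norm (u \<epsilon> (x + v) - u \<epsilon> x - frechet_derivative (u \<epsilon>) (at x) v) \<le> w N4 * (norm v)\<^sup>2"
          using elim(6) seg(1) unfolding w_def by blast
        also have "\<dots> \<le> w N4 * (\<bar>h\<bar> * w N2)\<^sup>2"
          using v w[of N4] by (intro mult_left_mono power_mono) auto
        also have "\<dots> = w (N4 + 2 * N2) * h\<^sup>2"
          by (simp only: w_add mult_2 power_mult_distrib power2_abs) (simp add: power2_eq_square)
        finally have 2: "norm (u \<epsilon> (x + v) - u \<epsilon> x - frechet_derivative (u \<epsilon>) (at x) v)
          \<le> w (N4 + 2 * N2) * h\<^sup>2" .
        have "frechet_derivative (u \<epsilon>) (at x) v = h * field_deriv X u \<epsilon> x"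
          unfolding v_def field_deriv_def using linear_scale[OF lin] by simp
        moreover have "\<bar>h\<bar> * \<bar>field_deriv X u \<epsilon> x\<bar> \<le> 1 * \<epsilon> ^ (q + 2)"
          using h1 elim(2) x by (intro mult_mono) auto
        ultimately have 3: "\<bar>frechet_derivative (u \<epsilon>) (at x) v\<bar> \<le> \<epsilon> ^ (q + 2)" by (simp add: abs_mult)
        have 4: "\<bar>u \<epsilon> x\<bar> \<le> \<epsilon> ^ (q + 2)" using elim(1) x by auto
        have "\<bar>u \<epsilon> (F \<epsilon> (h, x))\<bar> \<le> 3 * \<epsilon> ^ (q + 2) + (w (N3 + N1) + w (N4 + 2 * N2)) * h\<^sup>2"
          using 1 2 3 4 unfolding Fx real_norm_def distrib_right by linarith
        also have "3 * \<epsilon> ^ (q + 2) \<le> \<epsilon> ^ q"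
        proof -
          have "3 * \<epsilon> ^ (q + 2) = \<epsilon> ^ q * (3 * \<epsilon> ^ 2)" by (simp only: power_add mult_ac)
          also have "\<dots> \<le> \<epsilon> ^ q * 1" using sq \<epsilon> by (intro mult_left_mono) auto
          finally show ?thesis by simp
        qed
        also have "(w (N3 + N1) + w (N4 + 2 * N2)) * h\<^sup>2 \<le> w N * h\<^sup>2"
        proof (rule mult_right_mono)
          have "w (N3 + N1) + w (N4 + 2 * N2) \<le> 2 * w (N - 1)"
            using w_mono[of "N3 + N1" "N - 1"] w_mono[of "N4 + 2 * N2" "N - 1"] by (simp add: N_def)
          also have "\<dots> \<le> w 1 * w (N - 1)"
            using \<epsilon> w[of "N - 1"] by (intro mult_right_mono) (auto simp: w_def field_simps)
          also have "\<dots> = w N" by (simp add: w_add[symmetric] N_def)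
          finally show "w (N3 + N1) + w (N4 + 2 * N2) \<le> w N" .
        qed simp
        finally have "\<bar>u \<epsilon> (F \<epsilon> (h, x))\<bar> \<le> \<epsilon> ^ q + w N * h\<^sup>2" by simp
        moreover have "norm (F \<epsilon> (h, x) - x) \<le> \<epsilon>" using near by (simp add: Fx add.assoc)
        ultimately show "norm (F \<epsilon> (h, x) - x) \<le> \<epsilon> \<and> \<bar>u \<epsilon> (F \<epsilon> (h, x))\<bar> \<le> \<epsilon> ^ q + inverse (\<epsilon> ^ N) * h\<^sup>2"
          unfolding w_def by blast
      qed
    qed
  qed
  then show thesis by (rule that)
qed

lemma one_step:
  fixes F :: "real \<Rightarrow> real \<times> 'a::euclidean_space \<Rightarrow> 'a" and \<Delta> :: "nat \<Rightarrow> real \<Rightarrow> 'a \<Rightarrow> real"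
  defines "X \<equiv> \<lambda>\<epsilon> x. vector_derivative (\<lambda>t. F \<epsilon> (t, x)) (at 0)"
  assumes F: "gen_group_action UNIV F" and \<Delta>: "\<And>\<nu>. \<nu> \<in> {1..l} \<Longrightarrow> \<Delta> \<nu> \<in> EM UNIV"
    and K: "compact K" "\<forall>\<^sub>F \<epsilon> in at_right 0. S \<epsilon> \<subseteq> K"
    and S: "\<And>\<nu>. \<nu> \<in> {1..l} \<Longrightarrow> unif_negligible S (\<Delta> \<nu>)"
      "\<And>\<nu>. \<nu> \<in> {1..l} \<Longrightarrow> unif_negligible S (field_deriv X (\<Delta> \<nu>))"
  obtains N where "\<And>q. \<forall>\<^sub>F \<epsilon> in at_right 0. \<forall>x\<in>S \<epsilon>. \<forall>h. \<bar>h\<bar> \<le> \<epsilon> ^ N \<longrightarrow>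
    norm (F \<epsilon> (h, x) - x) \<le> \<epsilon> \<and> (\<forall>\<nu>\<in>{1..l}. \<bar>\<Delta> \<nu> \<epsilon> (F \<epsilon> (h, x))\<bar> \<le> \<epsilon> ^ q + inverse (\<epsilon> ^ N) * h\<^sup>2)"
proof -
  \<comment> \<open>Label 0 carries the zero function. The family over {0..l} is then nonempty for
    every l, so the displacement bound is available for l = 0 as well.\<close>
  define \<Delta>' where "\<Delta>' \<nu> = (if \<nu> \<in> {1..l} then \<Delta> \<nu> else (\<lambda>_ _. 0))" for \<nu>
  have zero: "(\<lambda>_ _. 0) \<in> EM (UNIV::'a set)" by (simp add: EM_iff moderate_net_const)
  have "\<exists>N. \<forall>q. \<forall>\<^sub>F \<epsilon> in at_right 0. \<forall>x\<in>S \<epsilon>. \<forall>h. \<bar>h\<bar> \<le> \<epsilon> ^ N \<longrightarrow>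
      norm (F \<epsilon> (h, x) - x) \<le> \<epsilon> \<and> \<bar>\<Delta>' \<nu> \<epsilon> (F \<epsilon> (h, x))\<bar> \<le> \<epsilon> ^ q + inverse (\<epsilon> ^ N) * h\<^sup>2" for \<nu>
  proof -
    have *: "\<Delta>' \<nu> \<in> EM UNIV \<and> unif_negligible S (\<Delta>' \<nu>) \<and> unif_negligible S (field_deriv X (\<Delta>' \<nu>))"
    proof (cases "\<nu> \<in> {1..l}")
      case True
      then have "\<Delta>' \<nu> = \<Delta> \<nu>" by (simp add: \<Delta>'_def)
      then show ?thesis
        using \<Delta>[OF True] S[OF True] by simp
    next
      case False
      then have "\<Delta>' \<nu> = (\<lambda>_ _. 0)" "field_deriv X (\<Delta>' \<nu>) = (\<lambda>_ _. 0)"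
        unfolding \<Delta>'_def field_deriv_def by (auto simp: fun_eq_iff)
      then show ?thesis
        using zero by (simp add: unif_negligible_zero)
    qed
    obtain N where "\<And>q. \<forall>\<^sub>F \<epsilon> in at_right 0. \<forall>x\<in>S \<epsilon>. \<forall>h. \<bar>h\<bar> \<le> \<epsilon> ^ N \<longrightarrow>
        norm (F \<epsilon> (h, x) - x) \<le> \<epsilon> \<and> \<bar>\<Delta>' \<nu> \<epsilon> (F \<epsilon> (h, x))\<bar> \<le> \<epsilon> ^ q + inverse (\<epsilon> ^ N) * h\<^sup>2"
      by (rule one_step_single[OF F conjunct1[OF *] K conjunct1[OF conjunct2[OF *]]
            conjunct2[OF conjunct2[OF *], unfolded X_def]], rule that)
    then show ?thesis by (intro exI allI)
  qed
  from choice[OF allI[OF this]]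
  obtain N where "\<forall>\<nu> q. \<forall>\<^sub>F \<epsilon> in at_right 0. \<forall>x\<in>S \<epsilon>. \<forall>h. \<bar>h\<bar> \<le> \<epsilon> ^ N \<nu> \<longrightarrow>
      norm (F \<epsilon> (h, x) - x) \<le> \<epsilon> \<and> \<bar>\<Delta>' \<nu> \<epsilon> (F \<epsilon> (h, x))\<bar> \<le> \<epsilon> ^ q + inverse (\<epsilon> ^ N \<nu>) * h\<^sup>2"
    by (rule exE)
  then have N: "\<forall>\<^sub>F \<epsilon> in at_right 0. \<forall>x\<in>S \<epsilon>. \<forall>h. \<bar>h\<bar> \<le> \<epsilon> ^ N \<nu> \<longrightarrow>
      norm (F \<epsilon> (h, x) - x) \<le> \<epsilon> \<and> \<bar>\<Delta>' \<nu> \<epsilon> (F \<epsilon> (h, x))\<bar> \<le> \<epsilon> ^ q + inverse (\<epsilon> ^ N \<nu>) * h\<^sup>2" for \<nu> q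
    by (elim allE)
  \<comment> \<open>A larger exponent restricts h further and weakens the bound, so the sum of the
    exponents serves all equations.\<close>
  define N' where "N' = (\<Sum>\<nu>\<in>{0..l}. N \<nu>)"
  have N': "N \<nu> \<le> N'" if "\<nu> \<in> {0..l}" for \<nu>
    unfolding N'_def using that by (intro member_le_sum) auto
  have "\<forall>\<^sub>F \<epsilon> in at_right 0. \<forall>x\<in>S \<epsilon>. \<forall>h. \<bar>h\<bar> \<le> \<epsilon> ^ N' \<longrightarrow>
    norm (F \<epsilon> (h, x) - x) \<le> \<epsilon> \<and> (\<forall>\<nu>\<in>{1..l}. \<bar>\<Delta> \<nu> \<epsilon> (F \<epsilon> (h, x))\<bar> \<le> \<epsilon> ^ q + inverse (\<epsilon> ^ N') * h\<^sup>2)" for q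
  proof -
    have "\<forall>\<^sub>F \<epsilon> in at_right 0. \<forall>\<nu>\<in>{0..l}. \<forall>x\<in>S \<epsilon>. \<forall>h. \<bar>h\<bar> \<le> \<epsilon> ^ N \<nu> \<longrightarrow>
      norm (F \<epsilon> (h, x) - x) \<le> \<epsilon> \<and> \<bar>\<Delta>' \<nu> \<epsilon> (F \<epsilon> (h, x))\<bar> \<le> \<epsilon> ^ q + inverse (\<epsilon> ^ N \<nu>) * h\<^sup>2"
      by (intro eventually_ball_finite finite_atLeastAtMost ballI N)
    then show ?thesis using eventually_I_eps
    proof eventually_elim
      case (elim \<epsilon>)
      show ?case
      proof (intro ballI allI impI)
        fix x and h :: real assume x: "x \<in> S \<epsilon>" and h: "\<bar>h\<bar> \<le> \<epsilon> ^ N'"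
        have h': "\<bar>h\<bar> \<le> \<epsilon> ^ N \<nu>" if "\<nu> \<in> {0..l}" for \<nu>
          using h power_decreasing[OF N'[OF that], of \<epsilon>] elim(2) by auto
        have "\<bar>\<Delta> \<nu> \<epsilon> (F \<epsilon> (h, x))\<bar> \<le> \<epsilon> ^ q + inverse (\<epsilon> ^ N') * h\<^sup>2" if \<nu>: "\<nu> \<in> {1..l}" for \<nu>
        proof -
          have \<nu>0: "\<nu> \<in> {0..l}" using \<nu> by auto
          have "\<bar>\<Delta>' \<nu> \<epsilon> (F \<epsilon> (h, x))\<bar> \<le> \<epsilon> ^ q + inverse (\<epsilon> ^ N \<nu>) * h\<^sup>2"
            using elim(1) \<nu>0 x h'[OF \<nu>0] by blast
          also have "\<dots> \<le> \<epsilon> ^ q + inverse (\<epsilon> ^ N') * h\<^sup>2"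
            using inverse_power_mono[OF _ _ N'[OF \<nu>0], of \<epsilon>] elim(2)
            by (intro add_left_mono mult_right_mono) auto
          finally show ?thesis using \<nu> by (simp add: \<Delta>'_def)
        qed
        moreover have "norm (F \<epsilon> (h, x) - x) \<le> \<epsilon>"
        proof -
          have "0 \<in> {0..l}" by simp
          then show ?thesis using elim(1) x h'[of 0] by blast
        qed
        ultimately show "norm (F \<epsilon> (h, x) - x) \<le> \<epsilon> \<and>
            (\<forall>\<nu>\<in>{1..l}. \<bar>\<Delta> \<nu> \<epsilon> (F \<epsilon> (h, x))\<bar> \<le> \<epsilon> ^ q + inverse (\<epsilon> ^ N') * h\<^sup>2)"
          by blast
      qed
    qed
  qed
  then show thesis by (rule that)
qed

text \<open>Here the exponents are balanced: a step of size at most \<epsilon>^M leaves |\<Delta>|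
  of order \<epsilon>^(2M - N2), the retraction costs \<epsilon>^-N1, the transport \<epsilon>^-N3,
  and the summation over all steps \<epsilon>^-(M+1).\<close>

lemma zero_points_shadow:
  fixes F :: "real \<Rightarrow> real \<times> 'a::euclidean_space \<Rightarrow> 'a" and \<Delta> :: "nat \<Rightarrow> real \<Rightarrow> 'a \<Rightarrow> real"
  assumes F: "gen_group_action UNIV F"
    and S: "compact K2" "\<forall>\<^sub>F \<epsilon> in at_right 0. S \<epsilon> \<subseteq> K2"
    and step: "\<And>q. \<forall>\<^sub>F \<epsilon> in at_right 0. \<forall>x\<in>S \<epsilon>. \<forall>h. \<bar>h\<bar> \<le> \<epsilon> ^ N2 \<longrightarrow>
      norm (F \<epsilon> (h, x) - x) \<le> \<epsilon> \<and> (\<forall>\<nu>\<in>{1..l}. \<bar>\<Delta> \<nu> \<epsilon> (F \<epsilon> (h, x))\<bar> \<le> \<epsilon> ^ q + inverse (\<epsilon> ^ N2) * h\<^sup>2)"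
    and retract: "\<And>q. \<forall>\<^sub>F \<epsilon> in at_right 0. \<forall>x\<in>K1. \<forall>e. 0 \<le> e \<longrightarrow> e \<le> \<epsilon> \<longrightarrow>
      (\<forall>\<nu>\<in>{1..l}. \<bar>\<Delta> \<nu> \<epsilon> x\<bar> \<le> e) \<longrightarrow> (\<exists>x'\<in>S \<epsilon>. norm (x' - x) \<le> inverse (\<epsilon> ^ N1) * (e + \<epsilon> ^ q))"
    and K0: "\<delta> > 0" "(\<Union>x\<in>K0. cball x \<delta>) \<subseteq> K1"
      "\<forall>\<^sub>F \<epsilon> in at_right 0. \<forall>t. \<bar>t\<bar> \<le> t1 \<longrightarrow> F \<epsilon> (t, z \<epsilon>) \<in> K0"
    and z: "z \<in> zero_points l \<Delta>" and \<eta>: "0 \<le> t1" "\<forall>\<^sub>F \<epsilon> in at_right 0. \<bar>\<eta> \<epsilon>\<bar> \<le> t1"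
  shows "\<forall>\<^sub>F \<epsilon> in at_right 0. \<exists>x\<in>S \<epsilon>. norm (x - F \<epsilon> (\<eta> \<epsilon>, z \<epsilon>)) \<le> \<epsilon> ^ Suc m"
proof -
  obtain Rz where Rz: "Rz > 0" "\<forall>\<^sub>F \<epsilon> in at_right 0. z \<epsilon> \<in> cball 0 Rz"
    using gen_pt_norm_bounded[of UNIV z] z unfolding zero_points_def by blast
  obtain R2 where R2: "R2 > 0" "K2 \<subseteq> cball 0 R2" using compact_subset_cball[OF S(1)] by blast
  \<comment> \<open>The ball must contain z \<epsilon> as well as F(h,x) for x in S, which lies
    within 1 of K2.\<close>
  define R where "R = max Rz (R2 + 1)"
  let ?C = "{-t1..t1} \<times> cball (0::'a) R"
  have C: "compact ?C" "convex ?C" by (auto intro: compact_Times convex_Times)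
  obtain N3 where N3: "\<forall>\<^sub>F \<epsilon> in at_right 0. \<forall>p q. closed_segment p q \<subseteq> ?C \<longrightarrow>
      norm (F \<epsilon> p - F \<epsilon> q) \<le> inverse (\<epsilon> ^ N3) * norm (p - q)"
    using moderate_net_lipschitzE[OF gen_group_action_moderate[OF F] C(1)] by blast
  \<comment> \<open>M is such that 2M - N2 = E, and E - N1 - N3 = M + m + 5 is the exponent of an
    error after retraction and transport. Over at most \<epsilon>^-(M+1) steps the sum is of order
    \<epsilon>^(m+4); the powers beyond m + 1 absorb the numerical factor.\<close>
  define M where "M = N1 + N2 + N3 + m + 5"
  define E where "E = M + N1 + N3 + m + 5"
  \<comment> \<open>One power more than E, so that the error of the starting point, doubled and
    transported, still fits under a.\<close>
  have ev_\<Delta>z: "\<forall>\<^sub>F \<epsilon> in at_right 0. \<forall>\<nu>\<in>{1..l}. \<bar>\<Delta> \<nu> \<epsilon> (z \<epsilon>)\<bar> \<le> \<epsilon> ^ Suc E"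
  proof (intro eventually_ball_finite finite_atLeastAtMost ballI)
    fix \<nu> assume "\<nu> \<in> {1..l}"
    with z have "zero_num (\<lambda>\<epsilon>. \<Delta> \<nu> \<epsilon> (z \<epsilon>))" unfolding zero_points_def by blast
    then show "\<forall>\<^sub>F \<epsilon> in at_right 0. \<bar>\<Delta> \<nu> \<epsilon> (z \<epsilon>)\<bar> \<le> \<epsilon> ^ Suc E" unfolding zero_num_iff by blast
  qed
  have ev_z0: "\<forall>\<^sub>F \<epsilon> in at_right 0. \<forall>x\<in>cball 0 Rz. norm (F \<epsilon> (0, x) - x) \<le> \<epsilon> ^ 1"
    using gen_group_action_zero[OF F compact_cball, of 0 Rz] unfolding unif_negligible_iff by blast
  have ev_0: "\<forall>\<^sub>F \<epsilon> in at_right 0. \<forall>x\<in>K2. norm (F \<epsilon> (0, x) - x) \<le> \<epsilon> ^ (M + m + 5)"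
    using gen_group_action_zero[OF F S(1)] unfolding unif_negligible_iff by blast
  have "compact (({-t1..t1} \<times> {-1..1::real}) \<times> K2)" using S(1) by (intro compact_Times) auto
  from gen_group_action_add[OF F this]
  have ev_add: "\<forall>\<^sub>F \<epsilon> in at_right 0. \<forall>p\<in>({-t1..t1} \<times> {-1..1}) \<times> K2.
      norm (F \<epsilon> (fst (fst p) + snd (fst p), snd p) - F \<epsilon> (fst (fst p), F \<epsilon> (snd (fst p), snd p))) \<le> \<epsilon> ^ (M + m + 5)"
    unfolding unif_negligible_iff by (rule spec)
  show ?thesis
    using step[of E] retract[of E] retract[of "Suc E"] N3 ev_\<Delta>z ev_z0 ev_0 ev_add S(2) K0(3) Rz(2) \<eta>(2)
      eventually_I_eps eventually_mult_less[of 6] eventually_mult_less[of "t1 + 2"]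
      eventually_mult_less[of "2 / \<delta>"]
  proof eventually_elim
    case (elim \<epsilon>)
    note step = elim(1) and retract = elim(2) and retract' = elim(3) and N3 = elim(4) and \<Delta>z = elim(5)
      and z0 = elim(6) and F0 = elim(7) and add = elim(8) and SK = elim(9) and traj = elim(10)
      and zR = elim(11) and \<eta>' = elim(12)
    have \<epsilon>: "0 < \<epsilon>" "\<epsilon> \<le> 1" "6 * \<epsilon> < 1" "(t1 + 2) * \<epsilon> < 1" using elim(13-15) by auto
    have \<epsilon>\<delta>: "2 * \<epsilon> \<le> \<delta>" using elim(16) K0(1) by (simp add: field_simps)
    define w where "w a = inverse (\<epsilon> ^ a)" for a
    have w: "0 < w a" for a using \<epsilon> by (simp add: w_def)
    have w_add: "w (a + b) = w a * w b" for a b by (simp add: w_def power_add)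
    have pow_mono: "\<epsilon> ^ b \<le> \<epsilon> ^ a" if "a \<le> b" for a b using that \<epsilon> by (intro power_decreasing) auto
    have w_pow: "w a * \<epsilon> ^ b \<le> \<epsilon> ^ c" if "a + c \<le> b" for a b c
    proof -
      have "w a * \<epsilon> ^ b \<le> w a * \<epsilon> ^ (a + c)"
        using w[of a] that pow_mono by (intro mult_left_mono) auto
      then show ?thesis using \<epsilon>(1) by (simp add: w_def inverse_power_mult)
    qed
    have small: "6 * \<epsilon> ^ Suc a \<le> \<epsilon> ^ a" for a
      using \<epsilon> mult_right_mono[of "6 * \<epsilon>" 1 "\<epsilon> ^ a"] by (simp add: mult.assoc)
    \<comment> \<open>The ceiling gives |\<eta>| / n \<le> \<epsilon>^M; adding 1 keeps n positive
      when t1 = 0.\<close>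
    define n where "n = nat \<lceil>t1 * w M\<rceil> + 1"
    define h where "h = \<eta> \<epsilon> / real n"
    have n: "n > 0" "t1 * w M \<le> real n" "real n \<le> w (Suc M)"
    proof -
      have t1w: "0 \<le> t1 * w M" using \<eta>(1) w[of M] by simp
      show "n > 0" by (simp add: n_def)
      show "t1 * w M \<le> real n" unfolding n_def using real_nat_ceiling_ge[of "t1 * w M"] by simp
      have "real n \<le> t1 * w M + 2" unfolding n_def using t1w by (simp add: of_nat_nat) linarith
      also have "\<dots> \<le> (t1 + 2) * w M"
      proof -
        have "1 \<le> w M" using \<epsilon> by (simp add: w_def one_le_inverse power_le_one)
        then show ?thesis by (simp add: distrib_right)
      qed
      also have "\<dots> \<le> w 1 * w M"
        using \<epsilon> w[of M] by (intro mult_right_mono) (auto simp: w_def field_simps)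
      finally show "real n \<le> w (Suc M)" by (simp add: w_add[symmetric])
    qed
    have nh: "real n * h = \<eta> \<epsilon>" using n(1) by (simp add: h_def)
    have h: "\<bar>h\<bar> \<le> \<epsilon> ^ M"
    proof -
      have "\<bar>\<eta> \<epsilon>\<bar> \<le> t1 * (w M * \<epsilon> ^ M)" using \<eta>' \<epsilon>(1) by (simp add: w_def)
      also have "\<dots> \<le> real n * \<epsilon> ^ M"
        using n(2) \<epsilon>(1) by (simp add: mult.assoc[symmetric] mult_right_mono)
      finally show ?thesis using n(1) by (simp add: h_def pos_divide_le_eq mult.commute)
    qed
    have h1: "\<bar>h\<bar> \<le> 1" using h pow_mono[of 0 M] by simp
    have hN2: "\<bar>h\<bar> \<le> \<epsilon> ^ N2" using h pow_mono[of N2 M] by (simp add: M_def)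
    have ih: "\<bar>real i * h\<bar> \<le> t1" if "i \<le> n" for i
    proof -
      have "\<bar>real i * h\<bar> \<le> real n * \<bar>h\<bar>" using that by (simp add: abs_mult mult_right_mono)
      also have "\<dots> = \<bar>\<eta> \<epsilon>\<bar>" unfolding nh[symmetric] by (simp add: abs_mult)
      finally show ?thesis using \<eta>' by simp
    qed
    \<comment> \<open>One Lipschitz constant for all times |t| \<le> t1: this uniformity keeps the
      transported errors from compounding.\<close>
    have lip: "norm (F \<epsilon> (t, x) - F \<epsilon> (t, y)) \<le> w N3 * norm (x - y)"
      if "\<bar>t\<bar> \<le> t1" "x \<in> cball 0 R" "y \<in> cball 0 R" for t x y
    proof -
      have "closed_segment (t, x) (t, y) \<subseteq> ?C"
        by (rule closed_segment_subset[OF _ _ C(2)]) (use that in auto)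
      then have "norm (F \<epsilon> (t, x) - F \<epsilon> (t, y)) \<le> inverse (\<epsilon> ^ N3) * norm ((t, x) - (t, y))"
        using N3 by blast
      then show ?thesis by (simp add: w_def)
    qed
    have SR: "x \<in> cball 0 R" if "x \<in> S \<epsilon>" for x
    proof -
      have "norm x \<le> R2" using that SK R2 by auto
      then show ?thesis unfolding R_def by simp
    qed
    have FhR: "F \<epsilon> (h, x) \<in> cball 0 R" if "x \<in> S \<epsilon>" for x
    proof -
      have "norm (F \<epsilon> (h, x) - x) \<le> \<epsilon>" using step that hN2 by blast
      then have "norm (F \<epsilon> (h, x) - x) \<le> 1" using \<epsilon>(2) by simp
      moreover have "norm x \<le> R2" using that SK R2 by auto
      ultimately show ?thesis
        using norm_triangle_ineq[of "F \<epsilon> (h, x) - x" x] unfolding R_def by simp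
    qed
    define a where "a = \<epsilon> ^ (M + m + 5)"
    \<comment> \<open>2 \<epsilon>^E bounds |\<Delta>| after one step; the last \<epsilon>^E is the
      negligible error of the retraction itself.\<close>
    define b where "b = w N1 * (2 * \<epsilon> ^ E + \<epsilon> ^ E)"
    define c where "c = w N3 * b"
    have c: "0 \<le> c" "c \<le> 3 * a"
    proof -
      show "0 \<le> c" unfolding c_def b_def using w[of N1] w[of N3] \<epsilon> by simp
      have "c = 3 * (w (N3 + N1) * \<epsilon> ^ E)" unfolding c_def b_def by (simp add: w_add)
      also have "\<dots> \<le> 3 * a" unfolding a_def by (intro mult_left_mono w_pow) (simp_all add: E_def)
      finally show "c \<le> 3 * a" .
    qed
    have a: "0 \<le> a" using \<epsilon> by (simp add: a_def)
    have total: "real n * (a + c) + 2 * a \<le> \<epsilon> ^ Suc m"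
    proof -
      have "real n * (a + c) \<le> w (Suc M) * (4 * a)"
        using n(3) c a w[of "Suc M"] by (intro mult_mono) auto
      also have "\<dots> = 4 * (w (Suc M) * \<epsilon> ^ (M + m + 5))" by (simp add: a_def)
      also have "\<dots> \<le> 4 * \<epsilon> ^ (m + 4)" by (intro mult_left_mono w_pow) auto
      finally have "real n * (a + c) \<le> 4 * \<epsilon> ^ (m + 4)" .
      moreover have "a \<le> \<epsilon> ^ (m + 4)" unfolding a_def by (rule pow_mono) simp
      moreover have "6 * \<epsilon> ^ (m + 4) \<le> \<epsilon> ^ Suc m"
      proof -
        have "6 * \<epsilon> ^ Suc (m + 3) \<le> \<epsilon> ^ Suc m"
          by (rule order_trans[OF small pow_mono]) simp
        moreover have "m + 4 = Suc (m + 3)" by simp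
        ultimately show ?thesis by (simp only:)
      qed
      ultimately show ?thesis by linarith
    qed
    \<comment> \<open>Only F(0,z) is known to lie in K0. The point z is negligibly close to it,
      hence in the enlarged set K1, where the retraction provides the starting point x0.\<close>
    have zK1: "z \<epsilon> \<in> K1"
    proof -
      have "F \<epsilon> (0, z \<epsilon>) \<in> K0" using traj \<eta>(1) by simp
      moreover have "dist (F \<epsilon> (0, z \<epsilon>)) (z \<epsilon>) \<le> \<delta>" 
        using bspec[OF z0 zR] \<epsilon>\<delta> \<epsilon>(1) by (simp add: dist_norm)
      ultimately have "z \<epsilon> \<in> (\<Union>x\<in>K0. cball x \<delta>)" unfolding UN_iff mem_cball by (rule bexI[rotated])
      then show ?thesis using K0(2) by blast
    qed
    have "0 \<le> \<epsilon> ^ Suc E" "\<epsilon> ^ Suc E \<le> \<epsilon>" using \<epsilon>(1) pow_mono[of 1 "Suc E"] by auto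
    then obtain x0 where x0: "x0 \<in> S \<epsilon>" "norm (x0 - z \<epsilon>) \<le> w N1 * (\<epsilon> ^ Suc E + \<epsilon> ^ Suc E)"
      using retract' zK1 \<Delta>z unfolding w_def by blast
    have "\<exists>x\<in>S \<epsilon>. norm (x - F \<epsilon> (real n * h, z \<epsilon>)) \<le> real n * (a + c) + 2 * a"
    proof (rule euler_shadowing[where r=\<epsilon> and b=b])
      show "norm (F \<epsilon> (0, x) - x) \<le> a" if "x \<in> S \<epsilon>" for x
        using that F0 SK unfolding a_def by blast
      show "norm (F \<epsilon> (real (Suc i) * h, x) - F \<epsilon> (real i * h, F \<epsilon> (h, x))) \<le> a"
        if "x \<in> S \<epsilon>" "i < n" for x i
      proof -
        have "((real i * h, h), x) \<in> ({-t1..t1} \<times> {-1..1}) \<times> K2"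
          using that SK ih[of i] h1 by auto
        from bspec[OF add this]
        have "norm (F \<epsilon> (real i * h + h, x) - F \<epsilon> (real i * h, F \<epsilon> (h, x))) \<le> a" by (simp add: a_def)
        then show ?thesis by (simp add: distrib_right add.commute)
      qed
      show "norm (F \<epsilon> (real i * h, x') - F \<epsilon> (real i * h, F \<epsilon> (h, x))) \<le> c"
        if "x \<in> S \<epsilon>" "x' \<in> S \<epsilon>" "i \<le> n" "norm (x' - F \<epsilon> (h, x)) \<le> b" for x x' i
      proof -
        have "norm (F \<epsilon> (real i * h, x') - F \<epsilon> (real i * h, F \<epsilon> (h, x))) \<le> w N3 * norm (x' - F \<epsilon> (h, x))"
          by (intro lip ih SR FhR that)
        also have "\<dots> \<le> c" unfolding c_def using that(4) w[of N3] by simp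
        finally show ?thesis .
      qed
      \<comment> \<open>If a point of S is \<epsilon>-close to the true trajectory, its image F(h,x)
        is within 2 \<epsilon> \<le> \<delta> of K0, hence in K1, where the retraction is
        available.\<close>
      show "\<exists>x'\<in>S \<epsilon>. norm (x' - F \<epsilon> (h, x)) \<le> b"
        if x: "x \<in> S \<epsilon>" and j: "j \<le> n" and near: "norm (x - F \<epsilon> (real j * h, z \<epsilon>)) \<le> \<epsilon>" for x j
      proof -
        have Fx: "norm (F \<epsilon> (h, x) - x) \<le> \<epsilon>"
          "\<And>\<nu>. \<nu> \<in> {1..l} \<Longrightarrow> \<bar>\<Delta> \<nu> \<epsilon> (F \<epsilon> (h, x))\<bar> \<le> \<epsilon> ^ E + w N2 * h\<^sup>2"
          using step x hN2 unfolding w_def by blast+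
        have "norm (F \<epsilon> (real j * h, z \<epsilon>) - F \<epsilon> (h, x)) \<le> 2 * \<epsilon>"
          using norm_triangle_ineq[of "F \<epsilon> (h, x) - x" "x - F \<epsilon> (real j * h, z \<epsilon>)"] Fx(1) near
          by (simp add: norm_minus_commute)
        then have "F \<epsilon> (h, x) \<in> cball (F \<epsilon> (real j * h, z \<epsilon>)) \<delta>" using \<epsilon>\<delta> by (simp add: dist_norm)
        moreover have "F \<epsilon> (real j * h, z \<epsilon>) \<in> K0" using traj ih[OF j] by blast
        ultimately have K1: "F \<epsilon> (h, x) \<in> K1" using K0(2) by blast
        have "w N2 * h\<^sup>2 \<le> w N2 * (\<epsilon> ^ M)\<^sup>2"
          using h w[of N2] by (intro mult_left_mono) (auto simp: abs_le_square_iff[symmetric])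
        also have "\<dots> \<le> \<epsilon> ^ E" unfolding power_mult[symmetric]
          by (rule w_pow) (simp add: E_def M_def)
        finally have "\<forall>\<nu>\<in>{1..l}. \<bar>\<Delta> \<nu> \<epsilon> (F \<epsilon> (h, x))\<bar> \<le> 2 * \<epsilon> ^ E"
          using Fx(2) by fastforce
        moreover have "2 * \<epsilon> ^ E \<le> \<epsilon>"
        proof -
          have "Suc (E - 1) = E" by (simp add: E_def)
          with small[of "E - 1"] have "6 * \<epsilon> ^ E \<le> \<epsilon> ^ (E - 1)" by (simp only:)
          also have "\<dots> \<le> \<epsilon> ^ 1" by (rule pow_mono) (simp add: E_def)
          finally have "6 * \<epsilon> ^ E \<le> \<epsilon>" by simp
          moreover have "0 \<le> \<epsilon> ^ E" using \<epsilon>(1) by simp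
          ultimately show ?thesis by simp
        qed
        moreover have "0 \<le> 2 * \<epsilon> ^ E" using \<epsilon>(1) by simp
        ultimately show ?thesis
          using retract K1 unfolding b_def w_def by blast
      qed
      show "norm (F \<epsilon> (real j * h, x0) - F \<epsilon> (real j * h, z \<epsilon>)) \<le> a" if "j \<le> n" for j
      proof -
        have "norm (F \<epsilon> (real j * h, x0) - F \<epsilon> (real j * h, z \<epsilon>)) \<le> w N3 * norm (x0 - z \<epsilon>)"
          by (rule lip[OF ih[OF that] SR[OF x0(1)]]) (use zR in \<open>auto simp: R_def\<close>)
        also have "\<dots> \<le> w N3 * (w N1 * (\<epsilon> ^ Suc E + \<epsilon> ^ Suc E))"
          using x0(2) w[of N3] by simp
        also have "\<dots> = 2 * (w (N3 + N1) * \<epsilon> ^ Suc E)" by (simp add: w_add)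
        also have "\<dots> \<le> 2 * \<epsilon> ^ Suc (M + m + 5)" by (intro mult_left_mono w_pow) (simp_all add: E_def)
        also have "\<dots> \<le> 6 * \<epsilon> ^ Suc (M + m + 5)" using \<epsilon>(1) by (intro mult_right_mono) auto
        also have "\<dots> \<le> a" unfolding a_def by (rule small)
        finally show ?thesis .
      qed
      show "real n * (a + c) + 2 * a \<le> \<epsilon>" using total pow_mono[of 1 "Suc m"] by simp
    qed (use x0(1) a c(1) in simp_all)
    then obtain x where "x \<in> S \<epsilon>" "norm (x - F \<epsilon> (\<eta> \<epsilon>, z \<epsilon>)) \<le> real n * (a + c) + 2 * a"
      unfolding nh by (rule bexE)
    with total show ?case by (intro bexI[of _ x]) simp_all
  qed
qed

text \<open>The Lipschitz factor \<epsilon>^-N is beaten by asking for closeness of order N + k; so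
  point values are well defined on classes.\<close>

lemma moderate_net_point_eq:
  fixes u :: "real \<Rightarrow> 'a::euclidean_space \<Rightarrow> 'b::euclidean_space"
  assumes u: "moderate_net UNIV u" and x: "gen_pt UNIV x" and y: "gen_pt UNIV y" and xy: "gen_pt_eq x y"
  shows "gen_pt_eq (\<lambda>\<epsilon>. u \<epsilon> (x \<epsilon>)) (\<lambda>\<epsilon>. u \<epsilon> (y \<epsilon>))"
  unfolding gen_pt_eq_iff
proof
  fix k
  obtain R1 where R1: "\<forall>\<^sub>F \<epsilon> in at_right 0. x \<epsilon> \<in> cball 0 R1" using gen_pt_norm_bounded[OF x] by blast
  obtain R2 where R2: "\<forall>\<^sub>F \<epsilon> in at_right 0. y \<epsilon> \<in> cball 0 R2" using gen_pt_norm_bounded[OF y] by blast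
  define B where "B = cball (0::'a) (max R1 R2)"
  have "compact B" unfolding B_def by simp
  then obtain N where N: "\<forall>\<^sub>F \<epsilon> in at_right 0. \<forall>x y. closed_segment x y \<subseteq> B \<longrightarrow>
      norm (u \<epsilon> x - u \<epsilon> y) \<le> inverse (\<epsilon> ^ N) * norm (x - y)"
    using moderate_net_lipschitzE[OF u _ subset_UNIV] by blast
  have "\<forall>\<^sub>F \<epsilon> in at_right 0. dist (x \<epsilon>) (y \<epsilon>) \<le> \<epsilon> ^ (N + k)" using xy unfolding gen_pt_eq_iff by blast
  then show "\<forall>\<^sub>F \<epsilon> in at_right 0. dist (u \<epsilon> (x \<epsilon>)) (u \<epsilon> (y \<epsilon>)) \<le> \<epsilon> ^ k"
    using R1 R2 N eventually_I_eps
  proof eventually_elim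
    case (elim \<epsilon>)
    have "closed_segment (x \<epsilon>) (y \<epsilon>) \<subseteq> B"
      unfolding B_def by (rule closed_segment_subset) (use elim(2,3) in auto)
    then have "norm (u \<epsilon> (x \<epsilon>) - u \<epsilon> (y \<epsilon>)) \<le> inverse (\<epsilon> ^ N) * norm (x \<epsilon> - y \<epsilon>)" using elim(4) by blast
    also have "\<dots> \<le> inverse (\<epsilon> ^ N) * \<epsilon> ^ (N + k)"
      using elim(1,5) by (intro mult_left_mono) (auto simp: dist_norm)
    also have "\<dots> = \<epsilon> ^ k" using elim(5) by (intro inverse_power_mult) auto
    finally show ?case by (simp add: dist_norm)
  qed
qed

lemma zero_num_gen_pt_eq:
  assumes "zero_num r" "gen_pt_eq s r"
  shows "zero_num s"
  unfolding zero_num_iff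
proof
  fix k
  have "\<forall>\<^sub>F \<epsilon> in at_right 0. \<bar>r \<epsilon>\<bar> \<le> \<epsilon> ^ Suc k" "\<forall>\<^sub>F \<epsilon> in at_right 0. dist (s \<epsilon>) (r \<epsilon>) \<le> \<epsilon> ^ Suc k"
    using assms unfolding zero_num_iff gen_pt_eq_iff by blast+
  then show "\<forall>\<^sub>F \<epsilon> in at_right 0. \<bar>s \<epsilon>\<bar> \<le> \<epsilon> ^ k"
    using eventually_I_eps eventually_mult_less[of 2]
  proof eventually_elim
    case (elim \<epsilon>)
    have "\<bar>s \<epsilon>\<bar> \<le> 2 * \<epsilon> * \<epsilon> ^ k" using elim(1,2) by (simp add: dist_real_def)
    also have "\<dots> \<le> 1 * \<epsilon> ^ k" using elim(3,4) by (intro mult_right_mono) auto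
    finally show ?case by simp
  qed
qed

text \<open>The zero set is a union of classes of nets, so identities of the action that hold only
  up to negligible nets may be used to move points within it.\<close>

lemma zero_points_gen_pt_eq:
  assumes \<Delta>: "\<And>\<nu>. \<nu> \<in> {1..l} \<Longrightarrow> \<Delta> \<nu> \<in> EM UNIV"
    and z: "z \<in> zero_points l \<Delta>" and w: "gen_pt UNIV w" "gen_pt_eq w z"
  shows "w \<in> zero_points l \<Delta>"
proof -
  have "zero_num (\<lambda>\<epsilon>. \<Delta> \<nu> \<epsilon> (w \<epsilon>))" if \<nu>: "\<nu> \<in> {1..l}" for \<nu>
  proof (rule zero_num_gen_pt_eq)
    show "zero_num (\<lambda>\<epsilon>. \<Delta> \<nu> \<epsilon> (z \<epsilon>))" using z \<nu> unfolding zero_points_def by blast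
    show "gen_pt_eq (\<lambda>\<epsilon>. \<Delta> \<nu> \<epsilon> (w \<epsilon>)) (\<lambda>\<epsilon>. \<Delta> \<nu> \<epsilon> (z \<epsilon>))"
      by (rule moderate_net_point_eq[OF \<Delta>[OF \<nu>, unfolded EM_iff[OF open_UNIV]] w(1) _ w(2)])
         (use z in \<open>simp add: zero_points_def\<close>)
  qed
  with w(1) show ?thesis unfolding zero_points_def by blast
qed

lemma gen_pt_UNIV_I: "compact K \<Longrightarrow> \<forall>\<^sub>F \<epsilon> in at_right 0. x \<epsilon> \<in> K \<Longrightarrow> gen_pt UNIV x"
  unfolding gen_pt_def by auto

lemma gen_pt_action:
  assumes F: "gen_group_action UNIV F" and z: "gen_pt UNIV z" and \<eta>: "gen_pt UNIV \<eta>"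
  shows "gen_pt UNIV (\<lambda>\<epsilon>. F \<epsilon> (\<eta> \<epsilon>, z \<epsilon>))"
proof -
  obtain K where K: "compact K" "\<forall>\<^sub>F \<epsilon> in at_right 0. z \<epsilon> \<in> K" using z unfolding gen_pt_def by blast
  obtain T where T: "compact T" "\<forall>\<^sub>F \<epsilon> in at_right 0. \<eta> \<epsilon> \<in> T" using \<eta> unfolding gen_pt_def by blast
  obtain K' where K': "compact K'" "\<forall>\<^sub>F \<epsilon> in at_right 0. F \<epsilon> ` (T \<times> K) \<subseteq> K'"
    using c_boundedD[OF gen_group_action_c_bounded[OF F] compact_Times[OF T(1) K(1)] subset_UNIV] by blast
  have "\<forall>\<^sub>F \<epsilon> in at_right 0. F \<epsilon> (\<eta> \<epsilon>, z \<epsilon>) \<in> K'"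
    using K(2) T(2) K'(2) by eventually_elim blast
  then show ?thesis by (rule gen_pt_UNIV_I[OF K'(1)])
qed

lemma gen_pt_interval_bound:
  assumes "gen_pt {-t0<..<t0::real} \<eta>" "0 < t0"
  obtains t1 where "0 \<le> t1" "t1 < t0" "\<forall>\<^sub>F \<epsilon> in at_right 0. \<bar>\<eta> \<epsilon>\<bar> \<le> t1"
proof -
  obtain T where T: "compact T" "T \<subseteq> {-t0<..<t0}" "\<forall>\<^sub>F \<epsilon> in at_right 0. \<eta> \<epsilon> \<in> T"
    using assms(1) unfolding gen_pt_def by blast
  \<comment> \<open>Inserting 0 makes the set nonempty, so the absolute value attains a maximum on
    it, and this maximum is still below t0.\<close>
  let ?T = "insert 0 T"
  have "continuous_on ?T (\<lambda>t. \<bar>t\<bar>)" by (intro continuous_intros)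
  from continuous_attains_sup[OF compact_insert[OF T(1)] insert_not_empty this]
  obtain s where s: "s \<in> ?T" "\<forall>t\<in>?T. \<bar>t\<bar> \<le> \<bar>s\<bar>"
    by (rule bexE)
  show thesis
  proof (rule that)
    have "s \<in> {-t0<..<t0}" using s(1) T(2) assms(2) by auto
    then show "\<bar>s\<bar> < t0" by auto
    show "\<forall>\<^sub>F \<epsilon> in at_right 0. \<bar>\<eta> \<epsilon>\<bar> \<le> \<bar>s\<bar>" using T(3) by eventually_elim (use s(2) in auto)
  qed simp
qed

text \<open>The retraction lives on a neighbourhood K1 of the trajectory of z. Shadowing by points
  of S holds to every order, and \<Delta> is negligible on S and moderately Lipschitz; hence
  \<Delta> is negligible along the trajectory.\<close>

lemma zero_points_invariant_local:
  fixes F :: "real \<Rightarrow> real \<times> 'a::euclidean_space \<Rightarrow> 'a" and \<Delta> :: "nat \<Rightarrow> real \<Rightarrow> 'a \<Rightarrow> real"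
    and V :: "'d::{finite,linorder} rvec set"
  defines "X \<equiv> \<lambda>\<epsilon> x. vector_derivative (\<lambda>t. F \<epsilon> (t, x)) (at 0)"
  assumes F: "gen_group_action UNIV F" and \<Delta>: "\<And>\<nu>. \<nu> \<in> {1..l} \<Longrightarrow> \<Delta> \<nu> \<in> EM UNIV"
    and t0: "0 < t0" and UV: "open U" "open V"
    and inU: "\<And>\<eta> z. gen_pt {-t0<..<t0} \<eta> \<Longrightarrow> z \<in> zero_points l \<Delta> \<Longrightarrow>
      \<exists>w. gen_pt U w \<and> gen_pt_eq w (\<lambda>\<epsilon>. F \<epsilon> (\<eta> \<epsilon>, z \<epsilon>))"
    and rank: "max_rank_via l \<Delta> U V \<psi> \<psi>'"
    and criterion: "\<And>z \<nu>. z \<in> zero_points l \<Delta> \<Longrightarrow> \<nu> \<in> {1..l} \<Longrightarrow>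
      zero_num (\<lambda>\<epsilon>. field_deriv X (\<Delta> \<nu>) \<epsilon> (z \<epsilon>))"
    and z: "z \<in> zero_points l \<Delta>" and \<eta>: "gen_pt {-t0<..<t0} \<eta>"
  shows "(\<lambda>\<epsilon>. F \<epsilon> (\<eta> \<epsilon>, z \<epsilon>)) \<in> zero_points l \<Delta>"
proof -
  have gz: "gen_pt UNIV z" using z unfolding zero_points_def by blast
  have g\<eta>: "gen_pt UNIV \<eta>" using \<eta> unfolding gen_pt_def by blast
  obtain t1 where t1: "0 \<le> t1" "t1 < t0" "\<forall>\<^sub>F \<epsilon> in at_right 0. \<bar>\<eta> \<epsilon>\<bar> \<le> t1"
    using gen_pt_interval_bound[OF \<eta> t0] by blast
  obtain K0 where K0: "compact K0" "K0 \<subseteq> U" "\<forall>\<^sub>F \<epsilon> in at_right 0. \<forall>t. \<bar>t\<bar> \<le> t1 \<longrightarrow> F \<epsilon> (t, z \<epsilon>) \<in> K0"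
    using trajectory_in_compact[OF F gz UV(1) t1(1,2) inU[OF _ z]] by blast
  obtain \<delta> where \<delta>: "\<delta> > 0" "(\<Union>x\<in>K0. cball x \<delta>) \<subseteq> U"
    using compact_subset_open_imp_cball_epsilon_subset[OF K0(1) UV(1) K0(2)] by blast
  define K1 where "K1 = (\<Union>x\<in>K0. cball x \<delta>)"
  have K1: "compact K1" "K1 \<subseteq> U"
    using compact_minkowski_sum_cball[OF K0(1)] \<delta>(2) unfolding K1_def by auto
  obtain S K2 N1 where S: "compact K2" "\<forall>\<^sub>F \<epsilon> in at_right 0. S \<epsilon> \<subseteq> K2"
    "\<And>\<nu>. \<nu> \<in> {1..l} \<Longrightarrow> unif_negligible S (\<Delta> \<nu>)"
    and retract: "\<And>q. \<forall>\<^sub>F \<epsilon> in at_right 0. \<forall>x\<in>K1. \<forall>e. 0 \<le> e \<longrightarrow> e \<le> \<epsilon> \<longrightarrow> (\<forall>\<nu>\<in>{1..l}. \<bar>\<Delta> \<nu> \<epsilon> x\<bar> \<le> e) \<longrightarrow>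
      (\<exists>x'\<in>S \<epsilon>. norm (x' - x) \<le> inverse (\<epsilon> ^ N1) * (e + \<epsilon> ^ q))"
    by (rule max_rank_retraction[OF rank UV K1], rule that)
  obtain Kz where Kz: "compact Kz" "\<forall>\<^sub>F \<epsilon> in at_right 0. z \<epsilon> \<in> Kz" using gz unfolding gen_pt_def by blast
  \<comment> \<open>The criterion speaks of generalized zeros only. Any selection from S, completed
    by values of z, is one, because \<Delta> is uniformly negligible on S.\<close>
  have S_zero: "x \<in> zero_points l \<Delta>" if x: "\<And>\<epsilon>. x \<epsilon> \<in> S \<epsilon> \<or> x \<epsilon> = z \<epsilon>" for x
  proof -
    have "\<forall>\<^sub>F \<epsilon> in at_right 0. x \<epsilon> \<in> K2 \<union> Kz" using S(2) Kz(2)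
    proof eventually_elim
      case (elim \<epsilon>)
      then show ?case using x[of \<epsilon>] by auto
    qed
    then have "gen_pt UNIV x" by (rule gen_pt_UNIV_I[OF compact_Un[OF S(1) Kz(1)]])
    moreover have "zero_num (\<lambda>\<epsilon>. \<Delta> \<nu> \<epsilon> (x \<epsilon>))" if \<nu>: "\<nu> \<in> {1..l}" for \<nu>
      unfolding zero_num_iff
    proof
      fix k
      have "\<forall>\<^sub>F \<epsilon> in at_right 0. \<forall>x\<in>S \<epsilon>. norm (\<Delta> \<nu> \<epsilon> x) \<le> \<epsilon> ^ k"
        using S(3)[OF \<nu>] unfolding unif_negligible_iff by blast
      moreover have "\<forall>\<^sub>F \<epsilon> in at_right 0. \<bar>\<Delta> \<nu> \<epsilon> (z \<epsilon>)\<bar> \<le> \<epsilon> ^ k"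
        using z \<nu> unfolding zero_points_def zero_num_iff by blast
      ultimately show "\<forall>\<^sub>F \<epsilon> in at_right 0. \<bar>\<Delta> \<nu> \<epsilon> (x \<epsilon>)\<bar> \<le> \<epsilon> ^ k"
      proof eventually_elim
        case (elim \<epsilon>)
        then show ?case using x[of \<epsilon>] by auto
      qed
    qed
    ultimately show ?thesis unfolding zero_points_def by blast
  qed
  have X: "unif_negligible S (field_deriv X (\<Delta> \<nu>))" if \<nu>: "\<nu> \<in> {1..l}" for \<nu>
  proof (rule unif_negligible_choice)
    fix x assume "\<And>\<epsilon>. x \<epsilon> \<in> S \<epsilon> \<or> x \<epsilon> = z \<epsilon>"
    from criterion[OF S_zero[OF this] \<nu>]
    show "zero_num (\<lambda>\<epsilon>. norm (field_deriv X (\<Delta> \<nu>) \<epsilon> (x \<epsilon>)))" unfolding zero_num_iff by simp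
  qed
  obtain N2 where step: "\<And>q. \<forall>\<^sub>F \<epsilon> in at_right 0. \<forall>x\<in>S \<epsilon>. \<forall>h. \<bar>h\<bar> \<le> \<epsilon> ^ N2 \<longrightarrow>
      norm (F \<epsilon> (h, x) - x) \<le> \<epsilon> \<and> (\<forall>\<nu>\<in>{1..l}. \<bar>\<Delta> \<nu> \<epsilon> (F \<epsilon> (h, x))\<bar> \<le> \<epsilon> ^ q + inverse (\<epsilon> ^ N2) * h\<^sup>2)"
    by (rule one_step[where \<Delta>=\<Delta> and l=l, OF F \<Delta> S(1,2,3) X[unfolded X_def]], assumption+, rule that)
  have shadow: "\<forall>\<^sub>F \<epsilon> in at_right 0. \<exists>x\<in>S \<epsilon>. norm (x - F \<epsilon> (\<eta> \<epsilon>, z \<epsilon>)) \<le> \<epsilon> ^ Suc m" for m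
    by (rule zero_points_shadow[OF F S(1,2) step retract \<delta>(1) _ K0(3) z t1(1,3)]) (simp add: K1_def)
  obtain R where R: "R > 0" "K0 \<union> K2 \<subseteq> cball 0 R" using compact_subset_cball[OF compact_Un[OF K0(1) S(1)]] by blast
  have "zero_num (\<lambda>\<epsilon>. \<Delta> \<nu> \<epsilon> (F \<epsilon> (\<eta> \<epsilon>, z \<epsilon>)))" if \<nu>: "\<nu> \<in> {1..l}" for \<nu>
    unfolding zero_num_iff
  proof
    fix k
    \<comment> \<open>Passing from a point of S to the trajectory costs \<Delta> a factor
      \<epsilon>^-N, so shadowing is used with m = N + k.\<close>
    obtain N where N: "\<forall>\<^sub>F \<epsilon> in at_right 0. \<forall>x y. closed_segment x y \<subseteq> cball 0 R \<longrightarrow>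
        norm (\<Delta> \<nu> \<epsilon> x - \<Delta> \<nu> \<epsilon> y) \<le> inverse (\<epsilon> ^ N) * norm (x - y)"
      using moderate_net_lipschitzE[OF \<Delta>[OF \<nu>, unfolded EM_iff[OF open_UNIV]] compact_cball subset_UNIV] by blast
    have "\<forall>\<^sub>F \<epsilon> in at_right 0. \<forall>x\<in>S \<epsilon>. norm (\<Delta> \<nu> \<epsilon> x) \<le> \<epsilon> ^ Suc k"
      using S(3)[OF \<nu>] unfolding unif_negligible_iff by blast
    then show "\<forall>\<^sub>F \<epsilon> in at_right 0. \<bar>\<Delta> \<nu> \<epsilon> (F \<epsilon> (\<eta> \<epsilon>, z \<epsilon>))\<bar> \<le> \<epsilon> ^ k"
      using N shadow[of "N + k"] K0(3) t1(3) S(2) eventually_I_eps eventually_mult_less[of 2]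
    proof eventually_elim
      case (elim \<epsilon>)
      obtain x where x: "x \<in> S \<epsilon>" "norm (x - F \<epsilon> (\<eta> \<epsilon>, z \<epsilon>)) \<le> \<epsilon> ^ Suc (N + k)" using elim(3) by blast
      have "F \<epsilon> (\<eta> \<epsilon>, z \<epsilon>) \<in> cball 0 R" "x \<in> cball 0 R" using elim(4-6) x(1) R(2) by blast+
      then have "closed_segment x (F \<epsilon> (\<eta> \<epsilon>, z \<epsilon>)) \<subseteq> cball 0 R"
        by (intro closed_segment_subset convex_cball)
      then have "norm (\<Delta> \<nu> \<epsilon> x - \<Delta> \<nu> \<epsilon> (F \<epsilon> (\<eta> \<epsilon>, z \<epsilon>))) \<le> inverse (\<epsilon> ^ N) * norm (x - F \<epsilon> (\<eta> \<epsilon>, z \<epsilon>))"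
        using elim(2) by blast
      also have "\<dots> \<le> inverse (\<epsilon> ^ N) * \<epsilon> ^ (N + Suc k)"
        using x(2) elim(7) by (intro mult_left_mono) auto
      also have "\<dots> = \<epsilon> ^ Suc k" using elim(7) by (intro inverse_power_mult) auto
      finally have "\<bar>\<Delta> \<nu> \<epsilon> (F \<epsilon> (\<eta> \<epsilon>, z \<epsilon>))\<bar> \<le> \<epsilon> ^ Suc k + \<epsilon> ^ Suc k"
        using bspec[OF elim(1) x(1)] unfolding real_norm_def by linarith
      also have "\<dots> = (2 * \<epsilon>) * \<epsilon> ^ k" by simp
      also have "\<dots> \<le> 1 * \<epsilon> ^ k" using elim(7,8) by (intro mult_right_mono) auto
      finally show ?case by simp
    qed
  qed
  then show ?thesis using gen_pt_action[OF F gz g\<eta>] unfolding zero_points_def by blast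
qed

text \<open>The time is cut into n equal parts of size at most t0 / 2 and the local result is
  iterated by the group law. Since \<eta> is bounded for small \<epsilon>, n does not depend on
  \<epsilon>.\<close>

lemma zero_points_invariant:
  fixes F :: "real \<Rightarrow> real \<times> 'a::euclidean_space \<Rightarrow> 'a" and \<Delta> :: "nat \<Rightarrow> real \<Rightarrow> 'a \<Rightarrow> real"
  assumes F: "gen_group_action UNIV F" and \<Delta>: "\<And>\<nu>. \<nu> \<in> {1..l} \<Longrightarrow> \<Delta> \<nu> \<in> EM UNIV"
    and t0: "0 < t0"
    and loc: "\<And>\<eta> z. gen_pt {-t0<..<t0} \<eta> \<Longrightarrow> z \<in> zero_points l \<Delta> \<Longrightarrow>
      (\<lambda>\<epsilon>. F \<epsilon> (\<eta> \<epsilon>, z \<epsilon>)) \<in> zero_points l \<Delta>"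
    and z: "z \<in> zero_points l \<Delta>" and \<eta>: "gen_pt UNIV \<eta>"
  shows "(\<lambda>\<epsilon>. F \<epsilon> (\<eta> \<epsilon>, z \<epsilon>)) \<in> zero_points l \<Delta>"
proof -
  have gz: "gen_pt UNIV z" using z unfolding zero_points_def by blast
  obtain T where T: "T > 0" "\<forall>\<^sub>F \<epsilon> in at_right 0. \<eta> \<epsilon> \<in> cball 0 T" using gen_pt_norm_bounded[OF \<eta>] by blast
  obtain n :: nat where "2 * T / t0 < real n" using reals_Archimedean2 by blast
  moreover have "0 < 2 * T / t0" using T(1) t0 by simp
  ultimately have n: "n > 0" "2 * T / t0 < real n" by auto
  \<comment> \<open>\<eta> is bounded by T only for small \<epsilon>, while a generalized point of
    the interval must lie in it for every index in I; hence the value 0 elsewhere.\<close>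
  define \<theta> where "\<theta> \<epsilon> = (if \<bar>\<eta> \<epsilon>\<bar> \<le> T then \<eta> \<epsilon> / real n else 0)" for \<epsilon>
  have \<theta>_bound: "\<bar>\<theta> \<epsilon>\<bar> \<le> t0 / 2" for \<epsilon>
  proof (cases "\<bar>\<eta> \<epsilon>\<bar> \<le> T")
    case True
    have "\<bar>\<eta> \<epsilon>\<bar> / real n \<le> T / real n" using True n(1) by (simp add: divide_right_mono)
    also have "\<dots> \<le> t0 / 2" using n t0 by (simp add: field_simps)
    finally show ?thesis using True by (simp add: \<theta>_def)
  qed (use t0 in \<open>simp add: \<theta>_def\<close>)
  have \<theta>: "gen_pt {-t0<..<t0} \<theta>"
    unfolding gen_pt_def
  proof (intro conjI ballI exI[of _ "{-(t0/2)..t0/2}"] always_eventually allI)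
    show "\<theta> \<epsilon> \<in> {-t0<..<t0}" "\<theta> \<epsilon> \<in> {-(t0/2)..t0/2}" for \<epsilon> using \<theta>_bound[of \<epsilon>] t0 by auto
  qed (use t0 in auto)
  have g\<theta>: "gen_pt UNIV (\<lambda>\<epsilon>. real j * \<theta> \<epsilon>)" for j
  proof (rule gen_pt_UNIV_I[OF compact_cball[of 0 "real j * (t0 / 2)"]], intro always_eventually allI)
    show "real j * \<theta> \<epsilon> \<in> cball 0 (real j * (t0 / 2))" for \<epsilon>
      using mult_left_mono[OF \<theta>_bound[of \<epsilon>], of "real j"] by (simp add: abs_mult)
  qed
  have "(\<lambda>\<epsilon>. F \<epsilon> (real j * \<theta> \<epsilon>, z \<epsilon>)) \<in> zero_points l \<Delta>" for j
  proof (induction j)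
    case 0
    obtain K where K: "compact K" "\<forall>\<^sub>F \<epsilon> in at_right 0. z \<epsilon> \<in> K" using gz unfolding gen_pt_def by blast
    have eq: "gen_pt_eq (\<lambda>\<epsilon>. F \<epsilon> (real 0 * \<theta> \<epsilon>, z \<epsilon>)) z"
      unfolding gen_pt_eq_iff
    proof
      fix k
      have "\<forall>\<^sub>F \<epsilon> in at_right 0. \<forall>x\<in>K. norm (F \<epsilon> (0, x) - x) \<le> \<epsilon> ^ k"
        using gen_group_action_zero[OF F K(1)] unfolding unif_negligible_iff by blast
      then show "\<forall>\<^sub>F \<epsilon> in at_right 0. dist (F \<epsilon> (real 0 * \<theta> \<epsilon>, z \<epsilon>)) (z \<epsilon>) \<le> \<epsilon> ^ k"
        using K(2) by eventually_elim (simp add: dist_norm)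
    qed
    show ?case by (rule zero_points_gen_pt_eq[OF \<Delta> z gen_pt_action[OF F gz g\<theta>] eq])
  next
    case (Suc j)
    have eq: "gen_pt_eq (\<lambda>\<epsilon>. F \<epsilon> (real (Suc j) * \<theta> \<epsilon>, z \<epsilon>)) (\<lambda>\<epsilon>. F \<epsilon> (\<theta> \<epsilon>, F \<epsilon> (real j * \<theta> \<epsilon>, z \<epsilon>)))"
      unfolding gen_pt_eq_iff
    proof
      fix k
      obtain K where K: "compact K" "\<forall>\<^sub>F \<epsilon> in at_right 0. z \<epsilon> \<in> K" using gz unfolding gen_pt_def by blast
      obtain J where J: "compact J" "\<forall>\<^sub>F \<epsilon> in at_right 0. real j * \<theta> \<epsilon> \<in> J" using g\<theta> unfolding gen_pt_def by blast
      have "compact (({-t0..t0} \<times> J) \<times> K)" by (intro compact_Times compact_Icc J(1) K(1))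
      from gen_group_action_add[OF F this]
      have "\<forall>\<^sub>F \<epsilon> in at_right 0. \<forall>p\<in>({-t0..t0} \<times> J) \<times> K. norm (F \<epsilon> (fst (fst p) + snd (fst p), snd p) -
          F \<epsilon> (fst (fst p), F \<epsilon> (snd (fst p), snd p))) \<le> \<epsilon> ^ k"
        unfolding unif_negligible_iff by (rule spec)
      then show "\<forall>\<^sub>F \<epsilon> in at_right 0. dist (F \<epsilon> (real (Suc j) * \<theta> \<epsilon>, z \<epsilon>))
          (F \<epsilon> (\<theta> \<epsilon>, F \<epsilon> (real j * \<theta> \<epsilon>, z \<epsilon>))) \<le> \<epsilon> ^ k"
        using K(2) J(2)
      proof eventually_elim
        case (elim \<epsilon>)
        have "((\<theta> \<epsilon>, real j * \<theta> \<epsilon>), z \<epsilon>) \<in> ({-t0..t0} \<times> J) \<times> K"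
          using elim(2,3) \<theta>_bound[of \<epsilon>] t0 by auto
        from bspec[OF elim(1) this] show ?case by (simp add: dist_norm distrib_right)
      qed
    qed
    show ?case by (rule zero_points_gen_pt_eq[OF \<Delta> loc[OF \<theta> Suc.IH] gen_pt_action[OF F gz g\<theta>] eq])
  qed
  note iter = this[of n]
  have eq: "gen_pt_eq (\<lambda>\<epsilon>. F \<epsilon> (\<eta> \<epsilon>, z \<epsilon>)) (\<lambda>\<epsilon>. F \<epsilon> (real n * \<theta> \<epsilon>, z \<epsilon>))"
    unfolding gen_pt_eq_iff
  proof
    fix k
    show "\<forall>\<^sub>F \<epsilon> in at_right 0. dist (F \<epsilon> (\<eta> \<epsilon>, z \<epsilon>)) (F \<epsilon> (real n * \<theta> \<epsilon>, z \<epsilon>)) \<le> \<epsilon> ^ k"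
      using T(2) eventually_I_eps by eventually_elim (use n(1) in \<open>simp add: \<theta>_def dist_norm\<close>)
  qed
  show ?thesis by (rule zero_points_gen_pt_eq[OF \<Delta> iter gen_pt_action[OF F gz \<eta>] eq])
qed

section \<open>Jets of smooth maps\<close>

lemma smooth_on_compose:
  "smooth_on UNIV F \<Longrightarrow> smooth_on UNIV f \<Longrightarrow> smooth_on UNIV (\<lambda>x. F (f x))"
  for F :: "'b::euclidean_space \<Rightarrow> 'c::euclidean_space" and f :: "'a::euclidean_space \<Rightarrow> 'b"
  unfolding smooth_on_iff[of _ "\<lambda>x. F (f x)"]
  by (rule moderate_net_compose[OF open_UNIV open_UNIV])
     (auto intro: moderate_net_smooth c_bounded_continuous smooth_on_continuous_on)

lemma smooth_on_bilinear:
  fixes f :: "'a::euclidean_space \<Rightarrow> 'b::euclidean_space" and g :: "'a \<Rightarrow> 'c::euclidean_space"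
    and bil :: "'b \<Rightarrow> 'c \<Rightarrow> 'd::euclidean_space"
  shows "bounded_bilinear bil \<Longrightarrow> smooth_on UNIV f \<Longrightarrow> smooth_on UNIV g \<Longrightarrow> smooth_on UNIV (\<lambda>x. bil (f x) (g x))"
  unfolding smooth_on_iff by (rule moderate_net_bilinear[OF open_UNIV])

lemma smooth_on_sum:
  fixes f :: "'i \<Rightarrow> 'a::euclidean_space \<Rightarrow> 'b::euclidean_space"
  shows "(\<And>i. i \<in> I \<Longrightarrow> smooth_on UNIV (f i)) \<Longrightarrow> smooth_on UNIV (\<lambda>x. \<Sum>i\<in>I. f i x)"
  unfolding smooth_on_iff by (rule moderate_net_sum[OF open_UNIV])

lemma smooth_on_linear_compose:
  fixes f :: "'a::euclidean_space \<Rightarrow> 'b::euclidean_space" and L :: "'b \<Rightarrow> 'c::euclidean_space"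
  shows "bounded_linear L \<Longrightarrow> smooth_on UNIV f \<Longrightarrow> smooth_on UNIV (\<lambda>x. L (f x))"
  unfolding smooth_on_iff by (rule moderate_net_linear[OF open_UNIV])

lemma smooth_on_const: "smooth_on M (\<lambda>_::'a::euclidean_space. c::'b::euclidean_space)"
  unfolding smooth_on_iff by (rule moderate_net_const)

lemma smooth_on_partials: "smooth_on UNIV f \<Longrightarrow> smooth_on UNIV (partials vs f)"
  for f :: "'a::euclidean_space \<Rightarrow> 'b::euclidean_space"
  by (induction vs) (simp_all add: partials_Cons smooth_on_deriv)

text \<open>Equality of n-jets at a point, by recursion on the order with all directions allowed.
  Compatibility with each operation then follows by induction from the product and chain rules,
  without an explicit formula for higher derivatives of a composition.\<close>

primrec jet_eq ::
  "nat \<Rightarrow> 'a::euclidean_space \<Rightarrow> ('a \<Rightarrow> 'b::euclidean_space) \<Rightarrow> ('a \<Rightarrow> 'b) \<Rightarrow> bool" where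
  "jet_eq 0 x f g \<longleftrightarrow> f x = g x"
| "jet_eq (Suc n) x f g \<longleftrightarrow> f x = g x \<and>
    (\<forall>v. jet_eq n x (\<lambda>y. frechet_derivative f (at y) v) (\<lambda>y. frechet_derivative g (at y) v))"

lemma jet_eq_refl: "jet_eq n x f f"
  by (induction n arbitrary: f) auto

lemma jet_eq_Suc_imp: "jet_eq (Suc n) x f g \<Longrightarrow> jet_eq n x f g"
proof (induction n arbitrary: f g)
  case (Suc n)
  note * = Suc.prems[unfolded jet_eq.simps(2)[of "Suc n"]]
  show ?case
    unfolding jet_eq.simps(2)[of n]
    by (intro conjI allI conjunct1[OF *] Suc.IH spec[OF conjunct2[OF *]])
qed simp

lemma jet_eq_value: "jet_eq n x f g \<Longrightarrow> f x = g x"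
  by (cases n) auto

lemma jet_eq_partials: "jet_eq n x f g \<Longrightarrow> length vs \<le> n \<Longrightarrow> partials vs f x = partials vs g x"
proof (induction vs arbitrary: n f g rule: rev_induct)
  case Nil
  then show ?case by (simp add: jet_eq_value)
next
  case (snoc v vs)
  from snoc.prems(2) obtain k where k: "n = Suc k" "length vs \<le> k" by (cases n) auto
  show ?case
    unfolding partials_snoc by (rule snoc.IH[OF _ k(2)]) (use snoc.prems(1) k(1) in simp)
qed

section \<open>Derivative rules and the compatibility of jets with products and compositions\<close>

lemma frechet_derivative_add:
  assumes "f differentiable (at x)" "g differentiable (at x)"
  shows "frechet_derivative (\<lambda>x. f x + g x) (at x) v = frechet_derivative f (at x) v + frechet_derivative g (at x) v"
  using frechet_derivative_eqI[OF has_derivative_add[OF assms[unfolded frechet_derivative_works]]] by simp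

lemma frechet_derivative_bilinear:
  assumes "bounded_bilinear bil" "f differentiable (at x)" "g differentiable (at x)"
  shows "frechet_derivative (\<lambda>x. bil (f x) (g x)) (at x) v =
    bil (f x) (frechet_derivative g (at x) v) + bil (frechet_derivative f (at x) v) (g x)"
  using frechet_derivative_eqI[OF bounded_bilinear.FDERIV[OF assms(1) assms(2,3)[unfolded frechet_derivative_works]]]
  by simp

lemma frechet_derivative_sum:
  assumes "\<And>i. i \<in> I \<Longrightarrow> f i differentiable (at x)"
  shows "frechet_derivative (\<lambda>x. \<Sum>i\<in>I. f i x) (at x) v = (\<Sum>i\<in>I. frechet_derivative (f i) (at x) v)"
proof -
  have "((\<lambda>x. \<Sum>i\<in>I. f i x) has_derivative (\<lambda>v. \<Sum>i\<in>I. frechet_derivative (f i) (at x) v)) (at x)"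
    by (rule has_derivative_sum) (rule assms[unfolded frechet_derivative_works])
  from frechet_derivative_eqI[OF this] show ?thesis by simp
qed

lemma frechet_derivative_chain:
  fixes f :: "'a::euclidean_space \<Rightarrow> 'b::euclidean_space"
  assumes "F differentiable (at (f x))" "f differentiable (at x)"
  shows "frechet_derivative (\<lambda>x. F (f x)) (at x) v =
    (\<Sum>b\<in>Basis. (frechet_derivative f (at x) v \<bullet> b) *\<^sub>R frechet_derivative F (at (f x)) b)"
proof -
  have "frechet_derivative (\<lambda>x. F (f x)) (at x) v = frechet_derivative F (at (f x)) (frechet_derivative f (at x) v)"
    using frechet_derivative_eqI[OF has_derivative_compose[of f _ x UNIV F,
          OF assms(2,1)[unfolded frechet_derivative_works]]] by simp
  also have "\<dots> = (\<Sum>b\<in>Basis. (frechet_derivative f (at x) v \<bullet> b) *\<^sub>R frechet_derivative F (at (f x)) b)"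
    by (rule frechet_derivative_Basis_sum[OF assms(1)])
  finally show ?thesis .
qed

lemma frechet_derivative_Pair:
  assumes "f differentiable (at x)" "g differentiable (at x)"
  shows "frechet_derivative (\<lambda>x. (f x, g x)) (at x) v = (frechet_derivative f (at x) v, frechet_derivative g (at x) v)"
  using frechet_derivative_eqI[OF has_derivative_Pair[OF assms[unfolded frechet_derivative_works]]] by simp

lemma smooth_differentiable: "smooth_on UNIV f \<Longrightarrow> f differentiable (at x)"
  by (rule smooth_on_differentiable[OF _ UNIV_I])

lemma jet_eq_add:
  "\<lbrakk>smooth_on UNIV f; smooth_on UNIV f'; smooth_on UNIV g; smooth_on UNIV g';
    jet_eq n x f f'; jet_eq n x g g'\<rbrakk> \<Longrightarrow> jet_eq n x (\<lambda>x. f x + g x) (\<lambda>x. f' x + g' x)"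
  by (induction n arbitrary: f f' g g')
     (simp_all add: frechet_derivative_add smooth_differentiable smooth_on_deriv)

lemma jet_eq_sum:
  assumes "\<And>i. i \<in> I \<Longrightarrow> smooth_on UNIV (f i)" "\<And>i. i \<in> I \<Longrightarrow> smooth_on UNIV (g i)"
    "\<And>i. i \<in> I \<Longrightarrow> jet_eq n x (f i) (g i)"
  shows "jet_eq n x (\<lambda>x. \<Sum>i\<in>I. f i x) (\<lambda>x. \<Sum>i\<in>I. g i x)"
  using assms
proof (induction I rule: infinite_finite_induct)
  case (insert i I)
  then show ?case by (simp add: jet_eq_add smooth_on_sum)
qed (auto simp: jet_eq_refl)

lemma jet_eq_bilinear:
  assumes "bounded_bilinear bil" "smooth_on UNIV f" "smooth_on UNIV f'" "smooth_on UNIV g" "smooth_on UNIV g'"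
    "jet_eq n x f f'" "jet_eq n x g g'"
  shows "jet_eq n x (\<lambda>x. bil (f x) (g x)) (\<lambda>x. bil (f' x) (g' x))"
  using assms(2-)
proof (induction n arbitrary: f f' g g')
  case (Suc n)
  note sm = Suc.prems(1-4)
  have eq: "(\<lambda>y. frechet_derivative (\<lambda>x. bil (f x) (g x)) (at y) v) =
      (\<lambda>y. bil (f y) (frechet_derivative g (at y) v) + bil (frechet_derivative f (at y) v) (g y))"
    if "smooth_on UNIV f" "smooth_on UNIV g" for f g v
    by (rule ext, rule frechet_derivative_bilinear[OF assms(1)]) (intro smooth_differentiable that)+
  have "jet_eq n x (\<lambda>y. frechet_derivative (\<lambda>x. bil (f x) (g x)) (at y) v)
      (\<lambda>y. frechet_derivative (\<lambda>x. bil (f' x) (g' x)) (at y) v)" for v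
    unfolding eq[OF sm(1,3)] eq[OF sm(2,4)]
    by (intro jet_eq_add smooth_on_bilinear[OF assms(1)] smooth_on_deriv sm Suc.IH)
       (use Suc.prems(5,6) jet_eq_Suc_imp in auto)
  then show ?case using Suc.prems(5,6) by (simp add: jet_eq_value)
qed simp

lemma jet_eq_linear:
  assumes "bounded_linear L" "smooth_on UNIV f" "smooth_on UNIV f'" "jet_eq n x f f'"
  shows "jet_eq n x (\<lambda>x. L (f x)) (\<lambda>x. L (f' x))"
  using assms(2-)
  by (induction n arbitrary: f f')
     (simp_all add: frechet_derivative_linear_compose[OF assms(1)] smooth_differentiable smooth_on_deriv)

lemma jet_eq_Pair:
  "\<lbrakk>smooth_on UNIV f; smooth_on UNIV f'; smooth_on UNIV g; smooth_on UNIV g';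
    jet_eq n x f f'; jet_eq n x g g'\<rbrakk> \<Longrightarrow> jet_eq n x (\<lambda>x. (f x, g x)) (\<lambda>x. (f' x, g' x))"
  by (induction n arbitrary: f f' g g')
     (simp_all add: frechet_derivative_Pair smooth_differentiable smooth_on_deriv)

text \<open>A derivative of F o f is a sum of products of D_v f . b and (D_b F) o f. The first
  factors have equal n-jets by assumption, the second by the induction hypothesis for D_b F, hence F
  varies in the induction.\<close>

lemma jet_eq_compose_left:
  fixes F :: "'b::euclidean_space \<Rightarrow> 'c::euclidean_space" and f f' :: "'a::euclidean_space \<Rightarrow> 'b"
  assumes "smooth_on UNIV F" "smooth_on UNIV f" "smooth_on UNIV f'" "jet_eq n x f f'"
  shows "jet_eq n x (\<lambda>x. F (f x)) (\<lambda>x. F (f' x))"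
  using assms(1,4)
proof (induction n arbitrary: F)
  case (Suc n)
  note sm = assms(2,3) Suc.prems(1)
  have eq: "(\<lambda>y. frechet_derivative (\<lambda>x. F (f x)) (at y) v) =
      (\<lambda>y. \<Sum>b\<in>Basis. (frechet_derivative f (at y) v \<bullet> b) *\<^sub>R frechet_derivative F (at (f y)) b)"
    if "smooth_on UNIV f" for f :: "'a \<Rightarrow> 'b" and v
    by (rule ext, rule frechet_derivative_chain) (intro smooth_differentiable that sm)+
  have "jet_eq n x (\<lambda>y. frechet_derivative (\<lambda>x. F (f x)) (at y) v)
      (\<lambda>y. frechet_derivative (\<lambda>x. F (f' x)) (at y) v)" for v
    unfolding eq[OF sm(1)] eq[OF sm(2)]
  proof (intro jet_eq_sum smooth_on_bilinear[OF bounded_bilinear_scaleR] jet_eq_bilinear[OF bounded_bilinear_scaleR]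
      smooth_on_linear_compose[OF bounded_linear_inner_left] smooth_on_deriv
      smooth_on_compose[OF smooth_on_deriv[OF sm(3)]] sm jet_eq_linear[OF bounded_linear_inner_left])
    show "jet_eq n x (\<lambda>y. frechet_derivative f (at y) v) (\<lambda>y. frechet_derivative f' (at y) v)"
      using Suc.prems(2) by simp
    show "jet_eq n x (\<lambda>y. frechet_derivative F (at (f y)) b) (\<lambda>y. frechet_derivative F (at (f' y)) b)" for b
      by (rule Suc.IH[OF smooth_on_deriv[OF sm(3)] jet_eq_Suc_imp[OF Suc.prems(2)]])
  qed
  then show ?case using Suc.prems(2) by (simp add: jet_eq_value)
qed simp

text \<open>In the same chain rule the factors D_v g . b are now common to both sides, and (D_b f) o
  g is compared with (D_b f') o g one order lower; hence f and f' vary in the induction while g is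
  fixed.\<close>

lemma jet_eq_compose_right:
  fixes f f' :: "'b::euclidean_space \<Rightarrow> 'c::euclidean_space" and g :: "'a::euclidean_space \<Rightarrow> 'b"
  assumes "smooth_on UNIV f" "smooth_on UNIV f'" "smooth_on UNIV g" "jet_eq n (g x) f f'"
  shows "jet_eq n x (\<lambda>x. f (g x)) (\<lambda>x. f' (g x))"
  using assms(1,2,4)
proof (induction n arbitrary: f f')
  case (Suc n)
  note sm = Suc.prems(1,2) assms(3)
  have eq: "(\<lambda>y. frechet_derivative (\<lambda>x. f (g x)) (at y) v) =
      (\<lambda>y. \<Sum>b\<in>Basis. (frechet_derivative g (at y) v \<bullet> b) *\<^sub>R frechet_derivative f (at (g y)) b)"
    if "smooth_on UNIV f" for f :: "'b \<Rightarrow> 'c" and v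
    by (rule ext, rule frechet_derivative_chain) (intro smooth_differentiable that sm)+
  have "jet_eq n x (\<lambda>y. frechet_derivative (\<lambda>x. f (g x)) (at y) v)
      (\<lambda>y. frechet_derivative (\<lambda>x. f' (g x)) (at y) v)" for v
    unfolding eq[OF sm(1)] eq[OF sm(2)]
  proof (intro jet_eq_sum smooth_on_bilinear[OF bounded_bilinear_scaleR] jet_eq_bilinear[OF bounded_bilinear_scaleR]
      smooth_on_linear_compose[OF bounded_linear_inner_left]
      smooth_on_compose[OF smooth_on_deriv sm(3)] smooth_on_deriv sm jet_eq_refl)
    show "jet_eq n x (\<lambda>y. frechet_derivative f (at (g y)) b) (\<lambda>y. frechet_derivative f' (at (g y)) b)" for b
      by (rule Suc.IH[OF smooth_on_deriv[OF sm(1)] smooth_on_deriv[OF sm(2)]]) (use Suc.prems(3) in simp)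
  qed
  then show ?case using Suc.prems(3) by (simp add: jet_eq_value)
qed simp

lemma jet_eqI_partials:
  fixes f g :: "'a::euclidean_space \<Rightarrow> 'b::euclidean_space"
  assumes "smooth_on UNIV f" "smooth_on UNIV g"
    "\<And>vs. set vs \<subseteq> Basis \<Longrightarrow> length vs \<le> n \<Longrightarrow> partials vs f x = partials vs g x"
  shows "jet_eq n x f g"
  using assms
proof (induction n arbitrary: f g)
  case 0
  from 0(3)[of "[]"] show ?case by simp
next
  case (Suc n)
  note sm = Suc.prems(1,2)
  have eq: "(\<lambda>y. frechet_derivative f (at y) v) = (\<lambda>y. \<Sum>b\<in>Basis. (v \<bullet> b) *\<^sub>R frechet_derivative f (at y) b)"
    if "smooth_on UNIV f" for f :: "'a \<Rightarrow> 'b" and v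
    by (rule ext, rule frechet_derivative_Basis_sum) (rule smooth_differentiable[OF that])
  have "jet_eq n x (\<lambda>y. frechet_derivative f (at y) v) (\<lambda>y. frechet_derivative g (at y) v)" for v
    unfolding eq[OF sm(1), of v] eq[OF sm(2), of v]
  proof (intro jet_eq_sum smooth_on_linear_compose[OF bounded_linear_scaleR_right]
      jet_eq_linear[OF bounded_linear_scaleR_right] smooth_on_deriv sm Suc.IH)
    fix b :: 'a and vs :: "'a list" assume "b \<in> Basis" "set vs \<subseteq> Basis" "length vs \<le> n"
    then show "partials vs (\<lambda>y. frechet_derivative f (at y) b) x = partials vs (\<lambda>y. frechet_derivative g (at y) b) x"
      using Suc.prems(3)[of "vs @ [b]"] by (simp add: partials_snoc)
  qed
  then show ?case using Suc.prems(3)[of "[]"] by simp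
qed

lemma partials_move_front:
  fixes f :: "'a::euclidean_space \<Rightarrow> 'b::euclidean_space"
  assumes "smooth_on UNIV f"
  shows "partials (vs @ v # ws) f = partials (v # vs @ ws) f"
proof (induction vs)
  case (Cons w vs)
  have "partials ((w # vs) @ v # ws) f = (\<lambda>x. frechet_derivative (partials (v # vs @ ws) f) (at x) w)"
    using Cons by (simp add: partials_Cons)
  also have "\<dots> = partials (v # (w # vs) @ ws) f"
    unfolding partials_Cons append_Cons
    by (rule ext, rule symmetric_second_derivative[OF smooth_on_partials[OF assms]])
  finally show ?case .
qed simp

text \<open>By symmetry of second derivatives the order of differentiation is immaterial, so lists
  of directions may be replaced by multi-indices.\<close>

lemma partials_mset_cong:
  fixes f :: "'a::euclidean_space \<Rightarrow> 'b::euclidean_space"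
  assumes "smooth_on UNIV f" "mset vs = mset ws"
  shows "partials vs f = partials ws f"
  using assms(2)
proof (induction vs arbitrary: ws)
  case (Cons v vs)
  then have "v \<in> set ws" by (metis list.set_intros(1) set_mset_mset)
  then obtain ws1 ws2 where ws: "ws = ws1 @ v # ws2" by (meson split_list)
  then have "mset vs = mset (ws1 @ ws2)" using Cons.prems by simp
  from Cons.IH[OF this] show ?case unfolding ws partials_move_front[OF assms(1)] by (simp add: partials_Cons)
qed simp

section \<open>Multi-indices and Taylor polynomials\<close>

text \<open>A right inverse of \<open>count_list\<close>, through which lists of basis directions
  and multi-indices are exchanged.\<close>

definition index_list :: "('p::{finite,linorder} \<Rightarrow> nat) \<Rightarrow> 'p list" where
  "index_list \<alpha> = concat (map (\<lambda>i. replicate (\<alpha> i) i) (sorted_list_of_set UNIV))"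

lemma mpartial_index_list: "mpartial \<alpha> h = partials (map (\<lambda>i. axis i 1) (index_list \<alpha>)) h"
  by (simp add: mpartial_def index_list_def map_concat o_def)

lemma count_concat_replicate:
  "distinct xs \<Longrightarrow> count_list (concat (map (\<lambda>i. replicate (\<alpha> i) i) xs)) j = (if j \<in> set xs then \<alpha> j else 0)"
proof (induction xs)
  case (Cons i xs)
  have "count_list (replicate k i) j = (if i = j then k else 0)" for k by (induction k) auto
  with Cons show ?case by auto
qed simp

lemma count_index_list: "count_list (index_list \<alpha>) j = \<alpha> j"
  unfolding index_list_def by (subst count_concat_replicate) auto

lemma length_index_list: "length (index_list \<alpha>) = (\<Sum>i\<in>UNIV. \<alpha> i)"
  using sum_count_set[of "index_list \<alpha>" UNIV] by (simp add: count_index_list)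

lemma partials_axis_eq_mpartial:
  fixes f :: "'p::{finite,linorder} rvec \<Rightarrow> 'b::euclidean_space"
  assumes "smooth_on UNIV f"
  shows "partials (map (\<lambda>i. axis i 1) js) f = mpartial (count_list js) f"
proof -
  have "mset js = mset (index_list (count_list js))"
    by (rule multiset_eqI) (simp only: count_mset count_index_list)
  then have "mset (map (\<lambda>i. axis i 1 :: 'p rvec) js) = mset (map (\<lambda>i. axis i 1) (index_list (count_list js)))"
    unfolding mset_map by (rule arg_cong)
  from partials_mset_cong[OF assms this] show ?thesis by (simp only: mpartial_index_list)
qed

lemma Basis_rvec: "Basis = range (\<lambda>i. axis i 1 :: 'p::finite rvec)"
  by (auto simp: Basis_vec_def)

text \<open>A list of at most n basis directions has a count vector of total order at most n; by
  surjectivity of the labelling it is some \<mu> m, so \<open>pr\<close> determines the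
  corresponding iterated derivative.\<close>

lemma jet_eqI_pr:
  fixes f g :: "'p::{finite,linorder} rvec \<Rightarrow> 'q::finite rvec"
  assumes sm: "smooth_on UNIV f" "smooth_on UNIV g" and \<mu>: "jet_labelling n \<mu>" and pr: "pr \<mu> f x = pr \<mu> g x"
  shows "jet_eq n x f g"
proof (rule jet_eqI_partials[OF sm])
  fix vs :: "'p rvec list" assume vs: "set vs \<subseteq> Basis" "length vs \<le> n"
  then have "\<forall>v\<in>set vs. \<exists>i. v = axis i 1" unfolding Basis_rvec by blast
  then obtain js where js: "vs = map (\<lambda>i. axis i 1) js"
    unfolding ex_map_conv[symmetric] by blast
  have "(\<Sum>i\<in>UNIV. count_list js i) \<le> n"
    using sum_count_set[of js UNIV] vs(2) js by simp
  then have "count_list js \<in> range \<mu>"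
    using \<mu> unfolding jet_labelling_def bij_betw_def by simp
  then obtain m where m: "count_list js = \<mu> m" by blast
  have "mpartial (\<mu> m) f x = mpartial (\<mu> m) g x"
    using arg_cong[OF pr, of "\<lambda>u. u $ m"] by (simp add: pr_def)
  then show "partials vs f x = partials vs g x"
    unfolding js partials_axis_eq_mpartial[OF sm(1)] partials_axis_eq_mpartial[OF sm(2)] m .
qed

lemma pr_cong_jet_eq:
  assumes "jet_labelling n \<mu>" "jet_eq n x f g"
  shows "pr \<mu> f x = pr \<mu> g x"
proof -
  have "mpartial (\<mu> m) f x = mpartial (\<mu> m) g x" for m
  proof -
    have "\<mu> m \<in> {\<alpha>. (\<Sum>i\<in>UNIV. \<alpha> i) \<le> n}" using assms(1) unfolding jet_labelling_def bij_betw_def by blast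
    then show ?thesis
      unfolding mpartial_index_list by (intro jet_eq_partials[OF assms(2)]) (simp add: length_index_list)
  qed
  then show ?thesis by (simp add: pr_def)
qed

text \<open>The divided power (y - x)^\<alpha> / \<alpha>!, normalised so that differentiation
  lowers an exponent without producing a factor.\<close>

definition monomial :: "('p::finite \<Rightarrow> nat) \<Rightarrow> 'p rvec \<Rightarrow> 'p rvec \<Rightarrow> real" where
  "monomial \<alpha> x y = (\<Prod>i\<in>UNIV. (y $ i - x $ i) ^ \<alpha> i / fact (\<alpha> i))"

lemma taylor_eq: "taylor \<mu> z = (\<lambda>y. \<Sum>m\<in>UNIV. monomial (\<mu> m) (fst z) y *\<^sub>R (snd z $ m))"
  by (rule ext) (simp add: taylor_def monomial_def)

lemma smooth_on_prod:
  fixes f :: "'i \<Rightarrow> 'a::euclidean_space \<Rightarrow> real"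
  shows "(\<And>i. i \<in> I \<Longrightarrow> smooth_on UNIV (f i)) \<Longrightarrow> smooth_on UNIV (\<lambda>x. \<Prod>i\<in>I. f i x)"
proof (induction I rule: infinite_finite_induct)
  case (insert i I)
  then show ?case by (simp add: smooth_on_bilinear[OF bounded_bilinear_mult])
qed (simp_all add: smooth_on_const)

lemma smooth_on_power:
  fixes f :: "'a::euclidean_space \<Rightarrow> real"
  shows "smooth_on UNIV f \<Longrightarrow> smooth_on UNIV (\<lambda>x. f x ^ n)"
  by (induction n) (simp_all add: smooth_on_const smooth_on_bilinear[OF bounded_bilinear_mult])

text \<open>The prolonged action treats the jet z, hence the centre of its Taylor polynomial, as a
  variable; smoothness in the argument alone would not suffice.\<close>

lemma smooth_on_monomial_joint:
  "smooth_on UNIV (\<lambda>p :: 'p::finite rvec \<times> 'p rvec. monomial \<alpha> (fst p) (snd p))"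
proof -
  have "smooth_on UNIV (\<lambda>p :: 'p rvec \<times> 'p rvec. (snd p $ i - fst p $ i) ^ \<alpha> i / fact (\<alpha> i))" for i
    unfolding divide_inverse
    by (intro smooth_on_bilinear[OF bounded_bilinear_mult] smooth_on_const smooth_on_power smooth_on_linear
        bounded_linear_sub bounded_linear_compose[OF bounded_linear_vec_nth] bounded_linear_fst bounded_linear_snd)
  then show ?thesis unfolding monomial_def by (rule smooth_on_prod)
qed

lemma smooth_on_Pair:
  fixes f :: "'a::euclidean_space \<Rightarrow> 'b::euclidean_space" and g :: "'a \<Rightarrow> 'c::euclidean_space"
  shows "smooth_on UNIV f \<Longrightarrow> smooth_on UNIV g \<Longrightarrow> smooth_on UNIV (\<lambda>x. (f x, g x))"
  unfolding smooth_on_iff by (rule moderate_net_Pair[OF open_UNIV])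

lemma smooth_on_ident: "smooth_on M (\<lambda>x. x)"
  by (rule smooth_on_linear[OF bounded_linear_ident])

lemma smooth_on_monomial: "smooth_on UNIV (monomial \<alpha> x)"
  using smooth_on_compose[OF smooth_on_monomial_joint smooth_on_Pair[OF smooth_on_const smooth_on_ident]] by simp

lemma smooth_on_taylor_joint:
  "smooth_on UNIV (\<lambda>p :: ('p::finite, 'q::finite, 'm::finite) jet \<times> 'p rvec. taylor \<mu> (fst p) (snd p))"
proof -
  have "smooth_on UNIV (\<lambda>p :: ('p, 'q, 'm) jet \<times> 'p rvec. monomial (\<mu> m) (fst (fst p)) (snd p))" for m
    using smooth_on_compose[OF smooth_on_monomial_joint smooth_on_Pair[OF
          smooth_on_linear[OF bounded_linear_compose[OF bounded_linear_fst bounded_linear_fst]]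
          smooth_on_linear[OF bounded_linear_snd]]] by simp
  moreover have "smooth_on UNIV (\<lambda>p :: ('p, 'q, 'm) jet \<times> 'p rvec. snd (fst p) $ m)" for m
    by (intro smooth_on_linear bounded_linear_compose[OF bounded_linear_vec_nth]
        bounded_linear_compose[OF bounded_linear_snd] bounded_linear_fst)
  ultimately show ?thesis
    unfolding taylor_eq by (intro smooth_on_sum smooth_on_bilinear[OF bounded_bilinear_scaleR])
qed

lemma smooth_on_taylor: "smooth_on UNIV (taylor \<mu> z)"
  for z :: "('p::finite, 'q::finite, 'm::finite) jet"
  using smooth_on_compose[OF smooth_on_taylor_joint smooth_on_Pair[OF smooth_on_const smooth_on_ident]] by simp

lemma frechet_derivative_monomial:
  "frechet_derivative (monomial \<alpha> x) (at y) (axis j 1) =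
    (if \<alpha> j = 0 then 0 else monomial (\<alpha>(j := \<alpha> j - 1)) x y)"
proof -
  \<comment> \<open>Along axis j only one factor of the product varies; C collects the
    others.\<close>
  define C where "C = (\<Prod>i\<in>UNIV - {j}. (y $ i - x $ i) ^ \<alpha> i / fact (\<alpha> i))"
  have eq: "monomial \<alpha> x (y + s *\<^sub>R axis j 1) = (y $ j + s - x $ j) ^ \<alpha> j / fact (\<alpha> j) * C" for s
  proof -
    have "monomial \<alpha> x (y + s *\<^sub>R axis j 1) = (y $ j + s - x $ j) ^ \<alpha> j / fact (\<alpha> j) *
        (\<Prod>i\<in>UNIV - {j}. ((y + s *\<^sub>R axis j 1) $ i - x $ i) ^ \<alpha> i / fact (\<alpha> i))"
      unfolding monomial_def by (subst prod.remove[of _ j]) (simp_all add: axis_def)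
    also have "(\<Prod>i\<in>UNIV - {j}. ((y + s *\<^sub>R axis j 1) $ i - x $ i) ^ \<alpha> i / fact (\<alpha> i)) = C"
      unfolding C_def by (rule prod.cong) (auto simp: axis_def)
    finally show ?thesis .
  qed
  have "((\<lambda>s. (y $ j + s - x $ j) ^ \<alpha> j / fact (\<alpha> j) * C) has_real_derivative
      real (\<alpha> j) * (y $ j - x $ j) ^ (\<alpha> j - 1) / fact (\<alpha> j) * C) (at 0)"
    by (auto intro!: derivative_eq_intros)
  moreover have "((\<lambda>s. monomial \<alpha> x (y + s *\<^sub>R axis j 1)) has_real_derivative
      frechet_derivative (monomial \<alpha> x) (at (y + 0 *\<^sub>R axis j 1)) (axis j 1)) (at 0)"
    by (rule has_real_derivative_along_line) (rule smooth_differentiable[OF smooth_on_monomial])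
  ultimately have *: "frechet_derivative (monomial \<alpha> x) (at y) (axis j 1) =
      real (\<alpha> j) * (y $ j - x $ j) ^ (\<alpha> j - 1) / fact (\<alpha> j) * C"
    unfolding eq using DERIV_unique by fastforce
  show ?thesis
  proof (cases "\<alpha> j")
    case (Suc k)
    have "monomial (\<alpha>(j := k)) x y = (y $ j - x $ j) ^ k / fact k *
        (\<Prod>i\<in>UNIV - {j}. (y $ i - x $ i) ^ (\<alpha>(j := k)) i / fact ((\<alpha>(j := k)) i))"
      unfolding monomial_def by (subst prod.remove[of _ j]) simp_all
    also have "(\<Prod>i\<in>UNIV - {j}. (y $ i - x $ i) ^ (\<alpha>(j := k)) i / fact ((\<alpha>(j := k)) i)) = C"
      unfolding C_def by (rule prod.cong) auto
    finally have mk: "monomial (\<alpha>(j := k)) x y = (y $ j - x $ j) ^ k / fact k * C" .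
    have "\<alpha>(j := \<alpha> j - 1) = \<alpha>(j := k)" using Suc by simp
    then have "monomial (\<alpha>(j := \<alpha> j - 1)) x y = (y $ j - x $ j) ^ k / fact k * C" by (simp only: mk)
    then show ?thesis using Suc unfolding * by (simp add: fact_Suc del: of_nat_Suc)
  qed (simp add: *)
qed

lemma partials_monomial:
  "partials (map (\<lambda>i. axis i 1) js) (monomial \<alpha> x) = (\<lambda>y.
    if \<forall>i. count_list js i \<le> \<alpha> i then monomial (\<lambda>i. \<alpha> i - count_list js i) x y else 0)"
proof (induction js)
  case (Cons j js)
  let ?c = "count_list js"
  have IH: "partials (map (\<lambda>i. axis i 1) (j # js)) (monomial \<alpha> x) = (\<lambda>y. frechet_derivative
      (\<lambda>y. if \<forall>i. ?c i \<le> \<alpha> i then monomial (\<lambda>i. \<alpha> i - ?c i) x y else 0) (at y) (axis j 1))"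
    using Cons by (simp add: partials_Cons)
  show ?case
  proof (cases "\<forall>i. ?c i \<le> \<alpha> i")
    case le: True
    show ?thesis
    \<comment> \<open>The exponent of j is used up: the remaining monomial is constant along axis j,
      so the next derivative vanishes.\<close>
    proof (cases "\<alpha> j - ?c j = 0")
      case True
      then have "\<not> count_list (j # js) j \<le> \<alpha> j" by simp
      then have *: "\<not> (\<forall>i. count_list (j # js) i \<le> \<alpha> i)" by blast
      show ?thesis unfolding IH if_P[OF le] if_not_P[OF *] by (simp only: frechet_derivative_monomial True if_True simp_thms)
    next
      case False
      have *: "\<forall>i. count_list (j # js) i \<le> \<alpha> i" using le False by (auto simp: Suc_le_eq)
      have **: "(\<lambda>i. \<alpha> i - ?c i)(j := \<alpha> j - ?c j - 1) = (\<lambda>i. \<alpha> i - count_list (j # js) i)"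
        by (rule ext) simp
      show ?thesis
        unfolding IH if_P[OF le] if_P[OF *] by (rule ext) (simp only: frechet_derivative_monomial if_not_P[OF False] **)
    qed
  next
    case False
    then obtain i where "\<not> ?c i \<le> \<alpha> i" by blast
    then have "\<not> count_list (j # js) i \<le> \<alpha> i" by auto
    then have *: "\<not> (\<forall>i. count_list (j # js) i \<le> \<alpha> i)" by blast
    show ?thesis unfolding IH if_not_P[OF False] if_not_P[OF *] by simp
  qed
qed simp

text \<open>At the centre a monomial vanishes unless all its exponents are 0. This is the duality
  between monomials and partial derivatives behind Taylor coefficients.\<close>

lemma mpartial_monomial:
  fixes x :: "'p::{finite,linorder} rvec"
  shows "mpartial \<beta> (monomial \<alpha> x) x = (if \<beta> = \<alpha> then 1 else 0)"
proof -
  have 0: "monomial \<gamma> x x = (if \<forall>i. \<gamma> i = 0 then 1 else 0)" for \<gamma> :: "'p \<Rightarrow> nat"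
  proof (cases "\<forall>i. \<gamma> i = 0")
    case False
    then obtain i where "\<gamma> i \<noteq> 0" by blast
    then have "monomial \<gamma> x x = 0" unfolding monomial_def by (intro prod_zero) (auto intro!: bexI[of _ i])
    then show ?thesis by (simp only: if_not_P[OF False])
  qed (simp add: monomial_def)
  have "mpartial \<beta> (monomial \<alpha> x) x =
      (if \<forall>i. \<beta> i \<le> \<alpha> i then if \<forall>i. \<alpha> i - \<beta> i = 0 then 1 else 0 else 0)"
    unfolding mpartial_index_list partials_monomial count_index_list 0 ..
  also have "\<dots> = (if \<beta> = \<alpha> then 1 else 0)"
    by (auto simp: fun_eq_iff intro: le_antisym)
  finally show ?thesis .
qed

lemma partials_sum_scaleR:
  fixes f :: "'i \<Rightarrow> 'a::euclidean_space \<Rightarrow> real" and c :: "'i \<Rightarrow> 'b::euclidean_space"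
  assumes "\<And>i. i \<in> I \<Longrightarrow> smooth_on UNIV (f i)"
  shows "partials vs (\<lambda>y. \<Sum>i\<in>I. f i y *\<^sub>R c i) = (\<lambda>y. \<Sum>i\<in>I. partials vs (f i) y *\<^sub>R c i)"
proof (induction vs)
  case (Cons v vs)
  have sm: "smooth_on UNIV (partials vs (f i))" if "i \<in> I" for i
    using smooth_on_partials assms that by blast
  show ?case
    unfolding partials_Cons Cons
  proof
    fix y
    have "frechet_derivative (\<lambda>y. \<Sum>i\<in>I. partials vs (f i) y *\<^sub>R c i) (at y) v =
        (\<Sum>i\<in>I. frechet_derivative (\<lambda>y. partials vs (f i) y *\<^sub>R c i) (at y) v)"
      by (intro frechet_derivative_sum smooth_differentiable smooth_on_bilinear[OF bounded_bilinear_scaleR]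
          sm smooth_on_const)
    also have "\<dots> = (\<Sum>i\<in>I. frechet_derivative (partials vs (f i)) (at y) v *\<^sub>R c i)"
      by (intro sum.cong refl frechet_derivative_linear_compose[OF bounded_linear_scaleR_left]
          smooth_differentiable sm)
    finally show "frechet_derivative (\<lambda>y. \<Sum>i\<in>I. partials vs (f i) y *\<^sub>R c i) (at y) v =
        (\<Sum>i\<in>I. frechet_derivative (partials vs (f i)) (at y) v *\<^sub>R c i)" .
  qed
qed simp

text \<open>By duality only terms with \<mu> m = \<mu> k survive, and injectivity of the labelling
  leaves the single term m = k.\<close>

lemma pr_taylor:
  fixes z :: "('p::{finite,linorder}, 'q::finite, 'm::finite) jet"
  assumes "jet_labelling n \<mu>"
  shows "pr \<mu> (taylor \<mu> z) (fst z) = snd z"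
proof -
  have inj: "inj \<mu>" using assms unfolding jet_labelling_def bij_betw_def by blast
  have "mpartial (\<mu> k) (taylor \<mu> z) (fst z) = snd z $ k" for k
  proof -
    have "mpartial (\<mu> k) (taylor \<mu> z) (fst z) =
        (\<Sum>m\<in>UNIV. mpartial (\<mu> k) (monomial (\<mu> m) (fst z)) (fst z) *\<^sub>R (snd z $ m))"
      unfolding mpartial_index_list taylor_eq by (subst partials_sum_scaleR) (simp_all add: smooth_on_monomial)
    also have "\<dots> = (\<Sum>m\<in>UNIV. if k = m then snd z $ m else 0)"
      unfolding mpartial_monomial by (intro sum.cong refl) (use inj in \<open>auto dest: injD\<close>)
    finally show ?thesis by simp
  qed
  then show ?thesis by (simp add: pr_def vec_eq_iff)
qed

section \<open>Prolonged actions on solutions\<close>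

lemma EMap_UNIV_iff: "u \<in> EMap UNIV UNIV \<longleftrightarrow> moderate_net UNIV u \<and> c_bounded UNIV UNIV u"
  by (simp add: EMap_iff)

lemma EMap_compose:
  assumes "F \<in> EMap UNIV UNIV" "f \<in> EMap UNIV UNIV"
  shows "(\<lambda>\<epsilon> x. F \<epsilon> (f \<epsilon> x)) \<in> EMap UNIV UNIV"
  using assms moderate_net_compose[OF open_UNIV open_UNIV, of F f] c_bounded_compose[of UNIV UNIV F UNIV f]
  unfolding EMap_UNIV_iff by blast

lemma EMap_Pair:
  assumes "f \<in> EMap UNIV UNIV" "g \<in> EMap UNIV UNIV"
  shows "(\<lambda>\<epsilon> x. (f \<epsilon> x, g \<epsilon> x)) \<in> EMap UNIV UNIV"
  using assms moderate_net_Pair[OF open_UNIV, of f g] c_bounded_Pair[of UNIV UNIV f UNIV g]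
  unfolding EMap_UNIV_iff by simp

lemma EMap_gen_pt: "gen_pt UNIV c \<Longrightarrow> (\<lambda>\<epsilon> _. c \<epsilon>) \<in> EMap UNIV UNIV"
  unfolding EMap_UNIV_iff by (blast intro: moderate_net_gen_pt c_bounded_gen_pt)

lemma EMap_smooth: "smooth_on UNIV f \<Longrightarrow> (\<lambda>_. f) \<in> EMap UNIV UNIV"
  unfolding EMap_UNIV_iff
  by (intro conjI moderate_net_smooth c_bounded_continuous smooth_on_continuous_on) auto

lemma gen_pt_EMap: "u \<in> EMap UNIV UNIV \<Longrightarrow> gen_pt UNIV x \<Longrightarrow> gen_pt UNIV (\<lambda>\<epsilon>. u \<epsilon> (x \<epsilon>))"
proof -
  assume u: "u \<in> EMap UNIV UNIV" and "gen_pt UNIV x"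
  then obtain K where K: "compact K" "\<forall>\<^sub>F \<epsilon> in at_right 0. x \<epsilon> \<in> K" unfolding gen_pt_def by blast
  have "c_bounded UNIV UNIV u" using u unfolding EMap_UNIV_iff by blast
  then obtain K' where K': "compact K'" "\<forall>\<^sub>F \<epsilon> in at_right 0. u \<epsilon> ` K \<subseteq> K'"
    by (rule c_boundedD[OF _ K(1) subset_UNIV])
  have "\<forall>\<^sub>F \<epsilon> in at_right 0. u \<epsilon> (x \<epsilon>) \<in> K'" using K(2) K'(2) by eventually_elim blast
  then show ?thesis by (rule gen_pt_UNIV_I[OF K'(1)])
qed

lemma moderate_net_vec_lambda:
  fixes f :: "'m::finite \<Rightarrow> real \<Rightarrow> 'a::euclidean_space \<Rightarrow> 'b::euclidean_space"
  assumes "\<And>m. moderate_net UNIV (f m)"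
  shows "moderate_net UNIV (\<lambda>\<epsilon> x. \<chi> m. f m \<epsilon> x)"
proof -
  have lin: "bounded_linear (\<lambda>b::'b. axis m b :: 'b^'m)" for m
    by (intro linear_conv_bounded_linear[THEN iffD1] linearI) (auto simp: vec_eq_iff axis_def)
  have eq: "(\<lambda>\<epsilon> x. \<chi> m. f m \<epsilon> x) = (\<lambda>\<epsilon> x. \<Sum>m\<in>UNIV. axis m (f m \<epsilon> x))"
    by (intro ext) (simp add: vec_eq_iff axis_def)
  show ?thesis
    unfolding eq by (intro moderate_net_sum open_UNIV moderate_net_linear[OF open_UNIV lin] assms)
qed

lemma moderate_net_pr: "moderate_net UNIV u \<Longrightarrow> moderate_net UNIV (\<lambda>\<epsilon>. pr \<mu> (u \<epsilon>))"
  unfolding pr_def[abs_def] mpartial_index_list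
  by (rule moderate_net_vec_lambda) (rule moderate_net_partials)

text \<open>Differentiating in the second variable alone means using the directions (0,v); a family
  of maps y -> f(z,y) can thus be treated as one map of (z,y).\<close>

lemma partials_slice:
  fixes f :: "'a::euclidean_space \<times> 'b::euclidean_space \<Rightarrow> 'c::euclidean_space"
  assumes "smooth_on UNIV f"
  shows "partials vs (\<lambda>y. f (z, y)) = (\<lambda>y. partials (map (Pair 0) vs) f (z, y))"
proof (induction vs)
  case (Cons v vs)
  have "frechet_derivative (\<lambda>y. partials (map (Pair 0) vs) f (z, y)) (at y) v =
      frechet_derivative (partials (map (Pair 0) vs) f) (at (z, y)) (0, v)" for y
  proof -
    have "((\<lambda>y. (z, y)) has_derivative (\<lambda>v. (0, v))) (at y)"
      by (auto intro!: derivative_eq_intros)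
    moreover have "(partials (map (Pair 0) vs) f has_derivative
        frechet_derivative (partials (map (Pair 0) vs) f) (at (z, y))) (at (z, y))"
      using smooth_differentiable[OF smooth_on_partials[OF assms]] unfolding frechet_derivative_works .
    ultimately have "((\<lambda>y. partials (map (Pair 0) vs) f (z, y)) has_derivative
        (\<lambda>v. frechet_derivative (partials (map (Pair 0) vs) f) (at (z, y)) (0, v))) (at y)"
      by (rule has_derivative_compose)
    from frechet_derivative_eqI[OF this] show ?thesis by simp
  qed
  then show ?case unfolding partials_Cons list.map Cons by (intro ext)
qed simp

text \<open>To compare jets at two nearby base points, \<open>pr\<close> of a parameter-dependent
  family must itself be a moderate net in the parameter and the base point.\<close>

lemma moderate_net_pr_slice:
  fixes G :: "real \<Rightarrow> 'a::euclidean_space \<times> 'p::{finite,linorder} rvec \<Rightarrow> 'q::finite rvec"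
  assumes "moderate_net UNIV G"
  shows "moderate_net UNIV (\<lambda>\<epsilon> p. pr \<mu> (\<lambda>y. G \<epsilon> (fst p, y)) (snd p))"
proof (rule moderate_net_cong[OF open_UNIV])
  show "moderate_net UNIV (\<lambda>\<epsilon> p. \<chi> m. partials (map (Pair 0) (map (\<lambda>i. axis i 1) (index_list (\<mu> m)))) (G \<epsilon>) p)"
    by (intro moderate_net_vec_lambda moderate_net_partials assms)
  fix \<epsilon> and p :: "'a \<times> 'p rvec" assume "\<epsilon> \<in> I_eps"
  then have "smooth_on UNIV (G \<epsilon>)" by (rule moderate_net_imp_smooth[OF assms])
  from partials_slice[OF this]
  show "(\<chi> m. partials (map (Pair 0) (map (\<lambda>i. axis i 1) (index_list (\<mu> m)))) (G \<epsilon>) p) =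
      pr \<mu> (\<lambda>y. G \<epsilon> (fst p, y)) (snd p)"
    unfolding pr_def mpartial_index_list by simp
qed

text \<open>The parameter p is carried along so that one statement covers two uses: u ignoring it,
  with \<open>a\<close> the identity, and u the Taylor polynomial of a variable jet, with
  \<open>a\<close> the projection to the base point.\<close>

lemma EMap_transform:
  assumes \<Xi>: "\<Xi> \<in> EMap UNIV UNIV" and \<Psi>: "\<Psi> \<in> EMap UNIV UNIV" and \<eta>: "gen_pt UNIV \<eta>"
    and u: "u \<in> EMap UNIV UNIV" and a: "a \<in> EMap UNIV UNIV"
  shows "(\<lambda>\<epsilon> p. \<Psi> \<epsilon> (\<eta> \<epsilon>, \<Xi> \<epsilon> (- \<eta> \<epsilon>, a \<epsilon> p), u \<epsilon> (p, \<Xi> \<epsilon> (- \<eta> \<epsilon>, a \<epsilon> p)))) \<in> EMap UNIV UNIV"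
proof -
  have neg: "gen_pt UNIV (\<lambda>\<epsilon>. - \<eta> \<epsilon>)"
    using gen_pt_EMap[OF EMap_smooth[OF smooth_on_linear[OF bounded_linear_minus[OF bounded_linear_ident]]] \<eta>] .
  have x: "(\<lambda>\<epsilon> p. \<Xi> \<epsilon> (- \<eta> \<epsilon>, a \<epsilon> p)) \<in> EMap UNIV UNIV"
    by (rule EMap_compose[OF \<Xi> EMap_Pair[OF EMap_gen_pt[OF neg] a]])
  show ?thesis
    by (rule EMap_compose[OF \<Psi> EMap_Pair[OF EMap_gen_pt[OF \<eta>] EMap_Pair[OF x
            EMap_compose[OF u EMap_Pair[OF EMap_smooth[OF smooth_on_ident] x]]]]])
qed

section \<open>Comparison of the prolonged action with the jets of transformed maps\<close>

lemma norm_fst_le_norm: "norm (fst p) \<le> norm p"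
  by (cases p) (simp add: norm_fst_le)

lemma fst_pr_action: "fst (pr_action \<mu> \<Xi> \<Psi> \<epsilon> (\<eta>, z)) = \<Xi> \<epsilon> (\<eta>, fst z)"
  by (simp add: pr_action_def)

text \<open>The first component of the prolonged action is \<Xi>; its group law at times \<eta> and
  -\<eta>, read at the jets (x,0), shows that \<Xi>(\<eta>,.) undoes \<Xi>(-\<eta>,.) up to
  negligible nets.\<close>

lemma pr_action_inverse:
  fixes \<Xi> :: "real \<Rightarrow> real \<times> 'p::{finite,linorder} rvec \<Rightarrow> 'p rvec" and \<mu> :: "'m::finite \<Rightarrow> 'p \<Rightarrow> nat"
    and \<Psi> :: "real \<Rightarrow> real \<times> 'p rvec \<times> 'q::finite rvec \<Rightarrow> 'q rvec"
  assumes P: "gen_group_action UNIV (pr_action \<mu> \<Xi> \<Psi>)" and \<eta>: "gen_pt UNIV \<eta>" and K: "compact K"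
  shows "unif_negligible (\<lambda>_. K) (\<lambda>\<epsilon> x. x - \<Xi> \<epsilon> (\<eta> \<epsilon>, \<Xi> \<epsilon> (- \<eta> \<epsilon>, x)))"
proof -
  let ?P = "pr_action \<mu> \<Xi> \<Psi>"
  obtain T where T: "\<forall>\<^sub>F \<epsilon> in at_right 0. \<eta> \<epsilon> \<in> cball 0 T" using gen_pt_norm_bounded[OF \<eta>] by blast
  let ?K = "K \<times> {0 :: ('q rvec, 'm) vec}"
  have cK: "compact ?K" using K by (intro compact_Times) auto
  have cT: "compact ((cball (0::real) T \<times> cball (0::real) T) \<times> ?K)" for T :: real
    by (rule compact_Times[OF compact_Times[OF compact_cball compact_cball] cK])
  show ?thesis
    unfolding unif_negligible_iff
  proof
    fix k
    have "\<forall>\<^sub>F \<epsilon> in at_right 0. \<forall>x\<in>?K. norm (?P \<epsilon> (0, x) - x) \<le> \<epsilon> ^ Suc k"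
      using gen_group_action_zero[OF P cK] unfolding unif_negligible_iff by (rule spec)
    moreover have "\<forall>\<^sub>F \<epsilon> in at_right 0. \<forall>p\<in>(cball 0 T \<times> cball 0 T) \<times> ?K.
        norm (?P \<epsilon> (fst (fst p) + snd (fst p), snd p) - ?P \<epsilon> (fst (fst p), ?P \<epsilon> (snd (fst p), snd p))) \<le> \<epsilon> ^ Suc k"
      using gen_group_action_add[OF P cT] unfolding unif_negligible_iff by (rule spec)
    ultimately show "\<forall>\<^sub>F \<epsilon> in at_right 0. \<forall>x\<in>K. norm (x - \<Xi> \<epsilon> (\<eta> \<epsilon>, \<Xi> \<epsilon> (- \<eta> \<epsilon>, x))) \<le> \<epsilon> ^ k"
      using T eventually_I_eps eventually_mult_less[of 2]
    proof eventually_elim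
      case (elim \<epsilon>)
      show ?case
      proof
        fix x assume "x \<in> K"
        then have x: "(x, 0) \<in> ?K" "((\<eta> \<epsilon>, - \<eta> \<epsilon>), (x, 0)) \<in> (cball 0 T \<times> cball 0 T) \<times> ?K"
          using elim(3) by auto
        have "norm (\<Xi> \<epsilon> (0, x) - x) \<le> \<epsilon> ^ Suc k"
          using order_trans[OF norm_fst_le_norm bspec[OF elim(1) x(1)]] by (simp add: fst_pr_action)
        moreover have "norm (\<Xi> \<epsilon> (0, x) - \<Xi> \<epsilon> (\<eta> \<epsilon>, \<Xi> \<epsilon> (- \<eta> \<epsilon>, x))) \<le> \<epsilon> ^ Suc k"
          using order_trans[OF norm_fst_le_norm bspec[OF elim(2) x(2)]] by (simp add: fst_pr_action)
        ultimately have "norm (x - \<Xi> \<epsilon> (\<eta> \<epsilon>, \<Xi> \<epsilon> (- \<eta> \<epsilon>, x))) \<le> \<epsilon> ^ Suc k + \<epsilon> ^ Suc k"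
          using norm_triangle_ineq4[of "\<Xi> \<epsilon> (0, x) - \<Xi> \<epsilon> (\<eta> \<epsilon>, \<Xi> \<epsilon> (- \<eta> \<epsilon>, x))" "\<Xi> \<epsilon> (0, x) - x"] by simp
        also have "\<dots> = (2 * \<epsilon>) * \<epsilon> ^ k" by simp
        also have "\<dots> \<le> 1 * \<epsilon> ^ k" using elim(4,5) by (intro mult_right_mono) auto
        finally show "norm (x - \<Xi> \<epsilon> (\<eta> \<epsilon>, \<Xi> \<epsilon> (- \<eta> \<epsilon>, x))) \<le> \<epsilon> ^ k" by simp
      qed
    qed
  qed
qed

text \<open>Only the \<open>n\<close>-jet of \<open>u\<close> at \<open>\<Xi>(-\<eta>, x)\<close> enters the \<open>n\<close>-jet of \<open>\<Phi>\<^sub>\<eta>(u)\<close> at \<open>x\<close>.\<close>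

lemma pr_transform_taylor:
  fixes \<Xi> :: "real \<times> 'p::{finite,linorder} rvec \<Rightarrow> 'p rvec" and u :: "'p rvec \<Rightarrow> 'q::finite rvec"
    and \<mu> :: "'m::finite \<Rightarrow> 'p \<Rightarrow> nat"
  assumes \<mu>: "jet_labelling n \<mu>"
    and sm: "smooth_on UNIV \<Xi>" "smooth_on UNIV \<Psi>" "smooth_on UNIV u"
    and x': "x' = \<Xi> (- \<eta>, x)"
  shows "pr \<mu> (transform \<Xi> \<Psi> \<eta> u) x = pr \<mu> (transform \<Xi> \<Psi> \<eta> (taylor \<mu> (x', pr \<mu> u x'))) x"
proof -
  let ?t = "taylor \<mu> (x', pr \<mu> u x')"
  have sX: "smooth_on UNIV (\<lambda>x. \<Xi> (- \<eta>, x))"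
    by (rule smooth_on_compose[OF sm(1) smooth_on_Pair[OF smooth_on_const smooth_on_ident]])
  have "jet_eq n x' u ?t"
    by (rule jet_eqI_pr[OF sm(3) smooth_on_taylor \<mu>]) (use pr_taylor[OF \<mu>, of "(x', pr \<mu> u x')"] in simp)
  then have "jet_eq n x (\<lambda>x. u (\<Xi> (- \<eta>, x))) (\<lambda>x. ?t (\<Xi> (- \<eta>, x)))"
    unfolding x' by (intro jet_eq_compose_right[where g="\<lambda>x. \<Xi> (- \<eta>, x)"] sm(3) smooth_on_taylor sX)
  then have "jet_eq n x (\<lambda>x. \<Psi> (\<eta>, \<Xi> (- \<eta>, x), u (\<Xi> (- \<eta>, x)))) (\<lambda>x. \<Psi> (\<eta>, \<Xi> (- \<eta>, x), ?t (\<Xi> (- \<eta>, x))))"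
    by (intro jet_eq_compose_left[OF sm(2)] jet_eq_Pair smooth_on_Pair smooth_on_const sX jet_eq_refl
        smooth_on_compose[OF sm(3) sX] smooth_on_compose[OF smooth_on_taylor sX])
  then show ?thesis unfolding transform_def by (rule pr_cong_jet_eq[OF \<mu>])
qed

text \<open>Both jets are values of one moderate net H, the jet of the transformed Taylor polynomial
  of z: once at the base point x, once at \<Xi>(\<eta>, \<Xi>(-\<eta>, x)). The two base points
  differ by a negligible net, and H has moderate Lipschitz constants.\<close>

lemma pr_transform_close:
  fixes \<Xi> :: "real \<Rightarrow> real \<times> 'p::{finite,linorder} rvec \<Rightarrow> 'p rvec" and \<mu> :: "'m::finite \<Rightarrow> 'p \<Rightarrow> nat"
    and \<Psi> :: "real \<Rightarrow> real \<times> 'p rvec \<times> 'q::finite rvec \<Rightarrow> 'q rvec"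
    and u :: "real \<Rightarrow> 'p rvec \<Rightarrow> 'q rvec" and \<eta> :: "real \<Rightarrow> real"
  defines "z \<equiv> \<lambda>\<epsilon> x. (\<Xi> \<epsilon> (- \<eta> \<epsilon>, x), pr \<mu> (u \<epsilon>) (\<Xi> \<epsilon> (- \<eta> \<epsilon>, x)))"
  assumes \<mu>: "jet_labelling n \<mu>"
    and \<Xi>: "\<Xi> \<in> EMap UNIV UNIV" and \<Psi>: "\<Psi> \<in> EMap UNIV UNIV" and u: "u \<in> EMap UNIV UNIV"
    and P: "gen_group_action UNIV (pr_action \<mu> \<Xi> \<Psi>)" and \<eta>: "gen_pt UNIV \<eta>"
    and z: "z \<in> EMap UNIV UNIV" and K: "compact K"
  shows "unif_negligible (\<lambda>_. K) (\<lambda>\<epsilon> x.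
    (x, pr \<mu> (transform (\<Xi> \<epsilon>) (\<Psi> \<epsilon>) (\<eta> \<epsilon>) (u \<epsilon>)) x) - pr_action \<mu> \<Xi> \<Psi> \<epsilon> (\<eta> \<epsilon>, z \<epsilon> x))"
proof -
  let ?G = "\<lambda>\<epsilon> p. transform (\<Xi> \<epsilon>) (\<Psi> \<epsilon>) (\<eta> \<epsilon>) (taylor \<mu> (fst p :: ('p, 'q, 'm) jet)) (snd p)"
  define H where "H \<epsilon> p = pr \<mu> (\<lambda>y. ?G \<epsilon> (fst p, y)) (snd p)" for \<epsilon> and p :: "('p, 'q, 'm) jet \<times> 'p rvec"
  let ?y = "\<lambda>\<epsilon> x. \<Xi> \<epsilon> (\<eta> \<epsilon>, \<Xi> \<epsilon> (- \<eta> \<epsilon>, x))"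
  have T: "smooth_on UNIV (\<lambda>q :: (('p, 'q, 'm) jet \<times> 'p rvec) \<times> 'p rvec. taylor \<mu> (fst (fst q)) (snd q))"
    using smooth_on_compose[OF smooth_on_taylor_joint smooth_on_Pair[OF
          smooth_on_linear[OF bounded_linear_compose[OF bounded_linear_fst bounded_linear_fst]]
          smooth_on_linear[OF bounded_linear_snd]]] by simp
  have "?G \<in> EMap UNIV UNIV"
    using EMap_transform[OF \<Xi> \<Psi> \<eta> EMap_smooth[OF T] EMap_smooth[OF smooth_on_linear[OF bounded_linear_snd]]]
    unfolding transform_def by simp
  then have "moderate_net UNIV ?G" unfolding EMap_UNIV_iff by (rule conjunct1)
  then have H: "moderate_net UNIV H" unfolding H_def[abs_def] by (rule moderate_net_pr_slice)
  have eq: "pr \<mu> (transform (\<Xi> \<epsilon>) (\<Psi> \<epsilon>) (\<eta> \<epsilon>) (u \<epsilon>)) x = H \<epsilon> (z \<epsilon> x, x)" if "\<epsilon> \<in> I_eps" for \<epsilon> x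
  proof -
    have "smooth_on UNIV (\<Xi> \<epsilon>)" "smooth_on UNIV (\<Psi> \<epsilon>)" "smooth_on UNIV (u \<epsilon>)"
      using \<Xi> \<Psi> u moderate_net_imp_smooth[OF _ that] unfolding EMap_UNIV_iff by blast+
    from pr_transform_taylor[OF \<mu> this refl, of "\<eta> \<epsilon>" x]
    show ?thesis unfolding H_def z_def fst_conv snd_conv .
  qed
  have action: "pr_action \<mu> \<Xi> \<Psi> \<epsilon> (\<eta> \<epsilon>, z \<epsilon> x) = (?y \<epsilon> x, H \<epsilon> (z \<epsilon> x, ?y \<epsilon> x))" for \<epsilon> x
    by (simp add: pr_action_def H_def z_def)
  have y: "unif_negligible (\<lambda>_. K) (\<lambda>\<epsilon> x. x - ?y \<epsilon> x)" by (rule pr_action_inverse[OF P \<eta> K])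
  have "c_bounded UNIV UNIV z" using z unfolding EMap_UNIV_iff by blast
  then obtain L where L: "compact L" "\<forall>\<^sub>F \<epsilon> in at_right 0. z \<epsilon> ` K \<subseteq> L"
    by (rule c_boundedD[OF _ K subset_UNIV])
  obtain R1 where R1: "L \<subseteq> cball 0 R1" using compact_subset_cball[OF L(1)] by blast
  obtain R2 where R2: "K \<subseteq> cball 0 R2" using compact_subset_cball[OF K] by blast
  let ?B = "cball (0 :: ('p, 'q, 'm) jet) R1 \<times> cball (0 :: 'p rvec) (R2 + 1)"
  have B: "compact ?B" "convex ?B"
    by (rule compact_Times[OF compact_cball compact_cball], rule convex_Times[OF convex_cball convex_cball])
  obtain N where N: "\<forall>\<^sub>F \<epsilon> in at_right 0. \<forall>p q. closed_segment p q \<subseteq> ?B \<longrightarrow>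
      norm (H \<epsilon> p - H \<epsilon> q) \<le> inverse (\<epsilon> ^ N) * norm (p - q)"
    by (rule moderate_net_lipschitzE[OF H B(1) subset_UNIV])
  show ?thesis
    unfolding unif_negligible_iff
  proof
    fix k
    \<comment> \<open>N covers the Lipschitz factor of H; the extra power absorbs the sum of the two
      components.\<close>
    have "\<forall>\<^sub>F \<epsilon> in at_right 0. \<forall>x\<in>K. norm (x - ?y \<epsilon> x) \<le> \<epsilon> ^ (N + Suc k)"
      using y unfolding unif_negligible_iff by (rule spec)
    then show "\<forall>\<^sub>F \<epsilon> in at_right 0. \<forall>x\<in>K. norm ((x, pr \<mu> (transform (\<Xi> \<epsilon>) (\<Psi> \<epsilon>) (\<eta> \<epsilon>) (u \<epsilon>)) x) -
        pr_action \<mu> \<Xi> \<Psi> \<epsilon> (\<eta> \<epsilon>, z \<epsilon> x)) \<le> \<epsilon> ^ k"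
      using L(2) N eventually_I_eps eventually_mult_less[of 2]
    proof eventually_elim
      case (elim \<epsilon>)
      have \<epsilon>: "0 < \<epsilon>" "\<epsilon> \<le> 1" "2 * \<epsilon> < 1" using elim(4,5) by auto
      show ?case
      proof
        fix x assume x: "x \<in> K"
        have xy: "norm (x - ?y \<epsilon> x) \<le> \<epsilon> ^ (N + Suc k)" using elim(1) x by (rule bspec)
        also have "\<dots> \<le> 1" using \<epsilon> by (intro power_le_one) auto
        finally have xy1: "norm (x - ?y \<epsilon> x) \<le> 1" .
        have xR: "norm x \<le> R2" using x R2 by auto
        have "norm (?y \<epsilon> x) \<le> R2 + 1"
          using norm_triangle_ineq4[of x "x - ?y \<epsilon> x"] xy1 xR by simp
        moreover have "z \<epsilon> x \<in> cball 0 R1" using elim(2) x R1 by blast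
        ultimately have "(z \<epsilon> x, x) \<in> ?B" "(z \<epsilon> x, ?y \<epsilon> x) \<in> ?B" using xR by auto
        then have "closed_segment (z \<epsilon> x, x) (z \<epsilon> x, ?y \<epsilon> x) \<subseteq> ?B" by (rule closed_segment_subset[OF _ _ B(2)])
        with elim(3) have "norm (H \<epsilon> (z \<epsilon> x, x) - H \<epsilon> (z \<epsilon> x, ?y \<epsilon> x)) \<le>
            inverse (\<epsilon> ^ N) * norm ((z \<epsilon> x, x) - (z \<epsilon> x, ?y \<epsilon> x))" by blast
        also have "\<dots> = inverse (\<epsilon> ^ N) * norm (x - ?y \<epsilon> x)" by simp
        also have "\<dots> \<le> inverse (\<epsilon> ^ N) * \<epsilon> ^ (N + Suc k)" using xy \<epsilon> by (intro mult_left_mono) auto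
        also have "\<dots> = \<epsilon> ^ Suc k" by (rule inverse_power_mult[OF \<epsilon>(1)])
        finally have h: "norm (H \<epsilon> (z \<epsilon> x, x) - H \<epsilon> (z \<epsilon> x, ?y \<epsilon> x)) \<le> \<epsilon> ^ Suc k" .
        have "\<epsilon> ^ (N + Suc k) \<le> \<epsilon> ^ Suc k" using \<epsilon> by (intro power_decreasing) auto
        with xy h have "norm (x - ?y \<epsilon> x) + norm (H \<epsilon> (z \<epsilon> x, x) - H \<epsilon> (z \<epsilon> x, ?y \<epsilon> x)) \<le> (2 * \<epsilon>) * \<epsilon> ^ k"
          by simp
        also have "\<dots> \<le> 1 * \<epsilon> ^ k" using \<epsilon> by (intro mult_right_mono) auto
        finally have sum: "norm (x - ?y \<epsilon> x) + norm (H \<epsilon> (z \<epsilon> x, x) - H \<epsilon> (z \<epsilon> x, ?y \<epsilon> x)) \<le> \<epsilon> ^ k" by simp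
        show "norm ((x, pr \<mu> (transform (\<Xi> \<epsilon>) (\<Psi> \<epsilon>) (\<eta> \<epsilon>) (u \<epsilon>)) x) -
            pr_action \<mu> \<Xi> \<Psi> \<epsilon> (\<eta> \<epsilon>, z \<epsilon> x)) \<le> \<epsilon> ^ k"
          unfolding action eq[OF elim(4)] diff_Pair
          by (rule order_trans[OF norm_Pair_le sum])
      qed
    qed
  qed
qed

text \<open>A is the image under the prolonged action of the graph of
  \<open>pr \<mu> (u \<epsilon>)\<close>, parametrised by x through \<Xi>(-\<eta>, x). c-boundedness
  of the prolonged graph is part of being a solution and does not follow from that of T; it is
  inherited from A, which is c-bounded as a composition.\<close>

lemma solution_transform:
  fixes \<Xi> :: "real \<Rightarrow> real \<times> 'p::{finite,linorder} rvec \<Rightarrow> 'p rvec" and \<mu> :: "'m::finite \<Rightarrow> 'p \<Rightarrow> nat"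
    and \<Psi> :: "real \<Rightarrow> real \<times> 'p rvec \<times> 'q::finite rvec \<Rightarrow> 'q rvec"
  assumes \<mu>: "jet_labelling n \<mu>"
    and \<Xi>: "\<Xi> \<in> EMap UNIV UNIV" and \<Psi>: "\<Psi> \<in> EMap UNIV UNIV"
    and P: "gen_group_action UNIV (pr_action \<mu> \<Xi> \<Psi>)" and \<Delta>: "\<And>\<nu>. \<nu> \<in> {1..l} \<Longrightarrow> \<Delta> \<nu> \<in> EM UNIV"
    and inv: "\<And>z. z \<in> zero_points l \<Delta> \<Longrightarrow> (\<lambda>\<epsilon>. pr_action \<mu> \<Xi> \<Psi> \<epsilon> (\<eta> \<epsilon>, z \<epsilon>)) \<in> zero_points l \<Delta>"
    and u: "solution \<mu> l \<Delta> u" and \<eta>: "gen_pt UNIV \<eta>"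
  shows "solution \<mu> l \<Delta> (\<lambda>\<epsilon>. transform (\<Xi> \<epsilon>) (\<Psi> \<epsilon>) (\<eta> \<epsilon>) (u \<epsilon>))"
proof -
  let ?P = "pr_action \<mu> \<Xi> \<Psi>"
  define T where "T = (\<lambda>\<epsilon>. transform (\<Xi> \<epsilon>) (\<Psi> \<epsilon>) (\<eta> \<epsilon>) (u \<epsilon>))"
  define z where "z = (\<lambda>\<epsilon> x. (\<Xi> \<epsilon> (- \<eta> \<epsilon>, x), pr \<mu> (u \<epsilon>) (\<Xi> \<epsilon> (- \<eta> \<epsilon>, x))))"
  define A where "A = (\<lambda>\<epsilon> x. ?P \<epsilon> (\<eta> \<epsilon>, z \<epsilon> x))"
  have uE: "u \<in> EMap UNIV UNIV" and gu: "(\<lambda>\<epsilon> x. (x, pr \<mu> (u \<epsilon>) x)) \<in> EMap UNIV UNIV"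
    and \<Delta>u: "\<And>\<nu>. \<nu> \<in> {1..l} \<Longrightarrow> (\<lambda>\<epsilon> x. \<Delta> \<nu> \<epsilon> (x, pr \<mu> (u \<epsilon>) x)) \<in> Negl UNIV"
    using u unfolding solution_def by blast+
  have neg: "gen_pt UNIV (\<lambda>\<epsilon>. - \<eta> \<epsilon>)"
    using gen_pt_EMap[OF EMap_smooth[OF smooth_on_linear[OF bounded_linear_minus[OF bounded_linear_ident]]] \<eta>] .
  have X: "(\<lambda>\<epsilon> x. \<Xi> \<epsilon> (- \<eta> \<epsilon>, x)) \<in> EMap UNIV UNIV"
    by (rule EMap_compose[OF \<Xi> EMap_Pair[OF EMap_gen_pt[OF neg] EMap_smooth[OF smooth_on_ident]]])
  have zE: "z \<in> EMap UNIV UNIV" unfolding z_def by (rule EMap_compose[OF gu X])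
  have AE: "A \<in> EMap UNIV UNIV"
    unfolding A_def by (rule EMap_compose[OF gen_group_action_EMap[OF P] EMap_Pair[OF EMap_gen_pt[OF \<eta>] zE]])
  have TE: "T \<in> EMap UNIV UNIV"
    unfolding T_def transform_def
    by (rule EMap_transform[OF \<Xi> \<Psi> \<eta> EMap_compose[OF uE EMap_smooth[OF smooth_on_linear[OF bounded_linear_snd]]]
          EMap_smooth[OF smooth_on_ident], unfolded snd_conv])
  have close: "unif_negligible (\<lambda>_. K) (\<lambda>\<epsilon> x. (x, pr \<mu> (T \<epsilon>) x) - A \<epsilon> x)" if "compact K" for K
    unfolding T_def A_def z_def
    by (rule pr_transform_close[OF \<mu> \<Xi> \<Psi> uE P \<eta> zE[unfolded z_def] that])
  have gT: "(\<lambda>\<epsilon> x. (x, pr \<mu> (T \<epsilon>) x)) \<in> EMap UNIV UNIV"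
    unfolding EMap_UNIV_iff
  proof
    show "moderate_net UNIV (\<lambda>\<epsilon> x. (x, pr \<mu> (T \<epsilon>) x))"
      using TE unfolding EMap_UNIV_iff
      by (intro moderate_net_Pair open_UNIV moderate_net_smooth smooth_on_ident moderate_net_pr) blast
    show "c_bounded UNIV UNIV (\<lambda>\<epsilon> x. (x, pr \<mu> (T \<epsilon>) x))"
      unfolding c_bounded_def
    proof (intro allI impI)
      fix K :: "'p rvec set" assume "compact K \<and> K \<subseteq> UNIV"
      then have K: "compact K" by blast
      have "c_bounded UNIV UNIV A" using AE unfolding EMap_UNIV_iff by blast
      then obtain L where L: "compact L" "\<forall>\<^sub>F \<epsilon> in at_right 0. A \<epsilon> ` K \<subseteq> L"
        by (rule c_boundedD[OF _ K subset_UNIV])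
      obtain R where R: "L \<subseteq> cball 0 R" using compact_subset_cball[OF L(1)] by blast
      \<comment> \<open>Power 0: a distance of at most 1 from A is enough for boundedness.\<close>
      have "\<forall>\<^sub>F \<epsilon> in at_right 0. \<forall>x\<in>K. norm ((x, pr \<mu> (T \<epsilon>) x) - A \<epsilon> x) \<le> \<epsilon> ^ 0"
        using close[OF K] unfolding unif_negligible_iff by (rule spec)
      then have "\<forall>\<^sub>F \<epsilon> in at_right 0. (\<lambda>x. (x, pr \<mu> (T \<epsilon>) x)) ` K \<subseteq> cball 0 (R + 1)"
        using L(2)
      proof eventually_elim
        case (elim \<epsilon>)
        show ?case
        proof (rule image_subsetI)
          fix x assume x: "x \<in> K"
          have "norm ((x, pr \<mu> (T \<epsilon>) x) - A \<epsilon> x) \<le> 1" using bspec[OF elim(1) x] by simp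
          moreover have "A \<epsilon> x \<in> cball 0 R" using elim(2) x R by blast
          then have "norm (A \<epsilon> x) \<le> R" by simp
          ultimately show "(x, pr \<mu> (T \<epsilon>) x) \<in> cball 0 (R + 1)"
            using norm_triangle_ineq[of "(x, pr \<mu> (T \<epsilon>) x) - A \<epsilon> x" "A \<epsilon> x"] by simp
        qed
      qed
      then show "\<exists>K'. compact K' \<and> K' \<subseteq> UNIV \<and> (\<forall>\<^sub>F \<epsilon> in at_right 0. (\<lambda>x. (x, pr \<mu> (T \<epsilon>) x)) ` K \<subseteq> K')"
        by (intro exI[of _ "cball 0 (R + 1)"] conjI compact_cball subset_UNIV)
    qed
  qed
  have "(\<lambda>\<epsilon> x. \<Delta> \<nu> \<epsilon> (x, pr \<mu> (T \<epsilon>) x)) \<in> Negl UNIV" if \<nu>: "\<nu> \<in> {1..l}" for \<nu>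
    unfolding Negl_iff[OF open_UNIV]
  proof (intro conjI allI impI)
    have "moderate_net UNIV (\<Delta> \<nu>)" using \<Delta>[OF \<nu>] by (simp only: EM_iff[OF open_UNIV])
    then show "moderate_net UNIV (\<lambda>\<epsilon> x. \<Delta> \<nu> \<epsilon> (x, pr \<mu> (T \<epsilon>) x))"
      by (rule moderate_net_compose[OF open_UNIV open_UNIV]) (use gT in \<open>simp_all add: EMap_UNIV_iff\<close>)
    fix K :: "'p rvec set" assume "compact K \<and> K \<subseteq> UNIV"
    then have K: "compact K" by blast
    show "unif_negligible (\<lambda>_. K) (\<lambda>\<epsilon> x. \<Delta> \<nu> \<epsilon> (x, pr \<mu> (T \<epsilon>) x))"
    \<comment> \<open>Invariance is known for one generalized point at a time; selecting worst
      points turns it into a bound on K. The default 0 serves the indices without a violation and is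
      therefore added to K below.\<close>
    proof (rule unif_negligible_choice[where d="\<lambda>_. 0"])
      fix x :: "real \<Rightarrow> 'p rvec" assume x: "\<And>\<epsilon>. x \<epsilon> \<in> K \<or> x \<epsilon> = 0"
      have xK: "x \<epsilon> \<in> insert 0 K" for \<epsilon> using x[of \<epsilon>] by blast
      have K0: "compact (insert 0 K)" using K by (rule compact_insert)
      have gx: "gen_pt UNIV x" by (rule gen_pt_UNIV_I[OF K0]) (simp add: xK del: insert_iff)
      have gX: "gen_pt UNIV (\<lambda>\<epsilon>. \<Xi> \<epsilon> (- \<eta> \<epsilon>, x \<epsilon>))" by (rule gen_pt_EMap[OF X gx])
      have "zero_num (\<lambda>\<epsilon>. \<Delta> \<nu>' \<epsilon> (z \<epsilon> (x \<epsilon>)))" if \<nu>': "\<nu>' \<in> {1..l}" for \<nu>'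
        unfolding zero_num_iff
      proof
        fix k
        obtain L where L: "compact L" "\<forall>\<^sub>F \<epsilon> in at_right 0. \<Xi> \<epsilon> (- \<eta> \<epsilon>, x \<epsilon>) \<in> L"
          using gX unfolding gen_pt_def by blast
        have "unif_negligible (\<lambda>_. L) (\<lambda>\<epsilon> x. \<Delta> \<nu>' \<epsilon> (x, pr \<mu> (u \<epsilon>) x))"
          using \<Delta>u[OF \<nu>'] L(1) unfolding Negl_def by simp
        then have "\<forall>\<^sub>F \<epsilon> in at_right 0. \<forall>x\<in>L. norm (\<Delta> \<nu>' \<epsilon> (x, pr \<mu> (u \<epsilon>) x)) \<le> \<epsilon> ^ k"
          unfolding unif_negligible_iff by (rule spec)
        then show "\<forall>\<^sub>F \<epsilon> in at_right 0. \<bar>\<Delta> \<nu>' \<epsilon> (z \<epsilon> (x \<epsilon>))\<bar> \<le> \<epsilon> ^ k"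
          using L(2) unfolding z_def real_norm_def by eventually_elim (rule bspec)
      qed
      with gen_pt_EMap[OF zE gx] have "(\<lambda>\<epsilon>. z \<epsilon> (x \<epsilon>)) \<in> zero_points l \<Delta>"
        unfolding zero_points_def by simp
      from inv[OF this] have Ax: "(\<lambda>\<epsilon>. A \<epsilon> (x \<epsilon>)) \<in> zero_points l \<Delta>" unfolding A_def .
      have "gen_pt_eq (\<lambda>\<epsilon>. (x \<epsilon>, pr \<mu> (T \<epsilon>) (x \<epsilon>))) (\<lambda>\<epsilon>. A \<epsilon> (x \<epsilon>))"
        unfolding gen_pt_eq_iff
      proof
        fix k
        have "\<forall>\<^sub>F \<epsilon> in at_right 0. \<forall>x\<in>insert 0 K. norm ((x, pr \<mu> (T \<epsilon>) x) - A \<epsilon> x) \<le> \<epsilon> ^ k"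
          using close[OF K0] unfolding unif_negligible_iff by (rule spec)
        then show "\<forall>\<^sub>F \<epsilon> in at_right 0. dist (x \<epsilon>, pr \<mu> (T \<epsilon>) (x \<epsilon>)) (A \<epsilon> (x \<epsilon>)) \<le> \<epsilon> ^ k"
          unfolding dist_norm by eventually_elim (rule bspec, assumption, rule xK)
      qed
      from zero_points_gen_pt_eq[OF \<Delta> Ax gen_pt_EMap[OF gT gx] this]
      have "(\<lambda>\<epsilon>. (x \<epsilon>, pr \<mu> (T \<epsilon>) (x \<epsilon>))) \<in> zero_points l \<Delta>" by blast
      then have "zero_num (\<lambda>\<epsilon>. \<Delta> \<nu> \<epsilon> (x \<epsilon>, pr \<mu> (T \<epsilon>) (x \<epsilon>)))"
        using \<nu> unfolding zero_points_def by blast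
      then show "zero_num (\<lambda>\<epsilon>. norm (\<Delta> \<nu> \<epsilon> (x \<epsilon>, pr \<mu> (T \<epsilon>) (x \<epsilon>))))"
        unfolding zero_num_iff by simp
    qed
  qed
  with TE gT have "solution \<mu> l \<Delta> T" unfolding solution_def by blast
  then show ?thesis unfolding T_def .
qed

theorem theorem6p6:
  fixes n l :: nat
    and \<mu> :: "'m::finite \<Rightarrow> 'p::{finite,linorder} \<Rightarrow> nat"
    and \<Delta> :: "nat \<Rightarrow> real \<Rightarrow> ('p, 'q::finite, 'm) jet \<Rightarrow> real"
    and \<Phi> :: "real \<Rightarrow> real \<times> 'p rvec \<times> 'q rvec \<Rightarrow> 'p rvec \<times> 'q rvec"
    and \<Xi> :: "real \<Rightarrow> real \<times> 'p rvec \<Rightarrow> 'p rvec"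
    and \<Psi> :: "real \<Rightarrow> real \<times> 'p rvec \<times> 'q rvec \<Rightarrow> 'q rvec"
    and \<xi> :: "real \<Rightarrow> 'p rvec \<times> 'q rvec \<Rightarrow> 'p rvec \<times> 'q rvec"
    and \<eta>\<^sub>0 :: real
    and U :: "('p, 'q, 'm) jet set"
    and V :: "'d::{finite,linorder} rvec set"
    and \<psi> :: "real \<Rightarrow> ('p, 'q, 'm) jet \<Rightarrow> 'd rvec"
    and \<psi>' :: "real \<Rightarrow> 'd rvec \<Rightarrow> ('p, 'q, 'm) jet"
  assumes labelling: "jet_labelling n \<mu>"
    and dim: "CARD('d) = DIM(('p, 'q, 'm) jet)"
    and Delta: "\<forall>\<nu>\<in>{1..l}. \<Delta> \<nu> \<in> EM UNIV"
    and action: "gen_group_action UNIV \<Phi>"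
    and projectable: "projectable_via \<Phi> \<Xi> \<Psi>"
    and generator: "inf_generator UNIV \<xi> \<Phi>"
    and a: "strictly_G_complete UNIV (pr_field \<mu> \<Xi> \<Psi>) (pr_action \<mu> \<Xi> \<Psi>)"
    and b: "\<eta>\<^sub>0 > 0" "open U" "open V"
      "\<forall>\<eta> z. gen_pt {-\<eta>\<^sub>0<..<\<eta>\<^sub>0} \<eta> \<and> z \<in> zero_points l \<Delta> \<longrightarrow>
         (\<exists>w. gen_pt U w \<and> gen_pt_eq w (\<lambda>\<epsilon>. pr_action \<mu> \<Xi> \<Psi> \<epsilon> (\<eta> \<epsilon>, z \<epsilon>)))"
      "max_rank_via l \<Delta> U V \<psi> \<psi>'"
    and c: "(V = UNIV \<and> linear_growth (push_field \<psi> \<psi>' (pr_field \<mu> \<Xi> \<Psi>))) \<or>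
            (is_box V \<and> deriv_log_type V (push_field \<psi> \<psi>' (pr_field \<mu> \<Xi> \<Psi>)))"
    and criterion: "\<forall>z\<in>zero_points l \<Delta>. \<forall>\<nu>\<in>{1..l}.
      zero_num (\<lambda>\<epsilon>. field_deriv (pr_field \<mu> \<Xi> \<Psi>) (\<Delta> \<nu>) \<epsilon> (z \<epsilon>))"
  shows "symmetry_group \<mu> l \<Delta> \<Xi> \<Psi>"
proof -
  let ?P = "pr_action \<mu> \<Xi> \<Psi>"
  have P: "gen_group_action UNIV ?P"
    using a unfolding strictly_G_complete_def G_complete_def by blast
  have \<Xi>: "\<Xi> \<in> EMap UNIV UNIV" and \<Psi>: "\<Psi> \<in> EMap UNIV UNIV"
    using projectable unfolding projectable_via_def by blast+
  have \<Delta>: "\<Delta> \<nu> \<in> EM UNIV" if "\<nu> \<in> {1..l}" for \<nu>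
    using Delta that by blast
  \<comment> \<open>The prolonged generator is the time derivative at 0 of this very representative
    of the action, which is the field X of the invariance lemmas; the criterion therefore applies to
    X.\<close>
  have field: "pr_field \<mu> \<Xi> \<Psi> = (\<lambda>\<epsilon> x. vector_derivative (\<lambda>t. ?P \<epsilon> (t, x)) (at 0))"
    by (intro ext) (simp add: pr_field_def)
  have loc: "(\<lambda>\<epsilon>. ?P \<epsilon> (\<eta> \<epsilon>, z \<epsilon>)) \<in> zero_points l \<Delta>"
    if \<eta>: "gen_pt {-\<eta>\<^sub>0<..<\<eta>\<^sub>0} \<eta>" and z: "z \<in> zero_points l \<Delta>" for \<eta> z
  proof (rule zero_points_invariant_local[OF P \<Delta> b(1-3) _ b(5) _ z \<eta>])
    show "\<exists>w. gen_pt U w \<and> gen_pt_eq w (\<lambda>\<epsilon>. ?P \<epsilon> (\<eta>' \<epsilon>, z' \<epsilon>))"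
      if "gen_pt {-\<eta>\<^sub>0<..<\<eta>\<^sub>0} \<eta>'" "z' \<in> zero_points l \<Delta>" for \<eta>' z'
      using b(4) that by blast
    show "zero_num (\<lambda>\<epsilon>. field_deriv (\<lambda>\<epsilon> x. vector_derivative (\<lambda>t. ?P \<epsilon> (t, x)) (at 0)) (\<Delta> \<nu>) \<epsilon> (z' \<epsilon>))"
      if "z' \<in> zero_points l \<Delta>" "\<nu> \<in> {1..l}" for z' \<nu>
      using criterion that unfolding field by blast
  qed
  show ?thesis
    unfolding symmetry_group_def
  proof (intro allI impI, elim conjE)
    fix u :: "real \<Rightarrow> 'p rvec \<Rightarrow> 'q rvec" and \<eta> :: "real \<Rightarrow> real"
    assume u: "solution \<mu> l \<Delta> u" and \<eta>: "gen_pt UNIV \<eta>"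
    show "solution \<mu> l \<Delta> (\<lambda>\<epsilon>. transform (\<Xi> \<epsilon>) (\<Psi> \<epsilon>) (\<eta> \<epsilon>) (u \<epsilon>))"
    proof (rule solution_transform[OF labelling \<Xi> \<Psi> P \<Delta> _ u \<eta>])
      show "(\<lambda>\<epsilon>. ?P \<epsilon> (\<eta> \<epsilon>, z \<epsilon>)) \<in> zero_points l \<Delta>" if "z \<in> zero_points l \<Delta>" for z
        by (rule zero_points_invariant[OF P \<Delta> b(1) loc that \<eta>])
    qed
  qed
qed

end
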